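(* Let $\beta>7$ be an odd integer. There is a constant $C_\beta$ depending only on $\beta$ such that the following holds. Let $N$ be a positive integer, $f\in L^1(T)$, $\lambda>\|f\|_1/(2\pi)$, let $(n_j)_{j\ge1}$ be a sequence of positive integers with $n_{j+1}\ge q\,n_j$ for all $j$, where $q>2.5$, and for $j=1,\dots,N$ let $\beta_j$ be defined by $n_j\beta_j=20(j+1)\log^2(j+1)$ and let $m_j=\lfloor n_j/10\rfloor$. Then \[ \left\|\sum_{j=1}^{N}\left(S_{n_j}f-V_{n_j}f\right)\left(\sigma_{m_j}1_{\overline{\beta F_{\beta_j}}}\right)\right\|_2^2 =\sum_{j=1}^{N}\left\||S_{n_j}f-V_{n_j}f|\,\left|\sigma_{m_j}1_{\overline{\beta F_{\beta_j}}}\right|\right\|_2^2 \le C_\beta N\log^5(N+1)\,\|f\|_1\lambda . \]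
   Context: $T=[-\pi,\pi)$ is regarded as a circle (addition modulo $2\pi$); $|A|$ is Lebesgue measure; $\|f\|_1=\int_T|f|$, $\|f\|_2^2=\int_T|f|^2$; $1_A$ is the characteristic function of $A$ and $\overline A=T\setminus A$; $\log$ is the natural logarithm. For $n\ge 0$, $\mathcal I_n$ is the partition of $T$ into the $2^n$ half-open intervals $[-\pi+2\pi k/2^n,-\pi+2\pi(k+1)/2^n)$, $0\le k<2^n$; the elements of $\mathcal I=\bigcup_{n\ge0}\mathcal I_n$ are the dyadic intervals. For $I\in\mathcal I$ and $i\in\mathbb Z$, $I^{(i)}=I+|I|\,i$ (modulo $T$). For an odd positive integer $\beta$, $\beta I=\bigcup_{|i|\le(\beta-1)/2}I^{(i)}$. Given $f\in L^1(T)$ and $\lambda>\|f\|_1/(2\pi)$: $\mathcal F$ is the set of dyadic intervals $I$ with $|I|^{-1}\int_I|f|>\lambda$ and $|J|^{-1}\int_J|f|\le\lambda$ for every dyadic interval $J\supsetneq I$. For $\epsilon>0$, $\mathcal F_\epsilon=\{I\in\mathcal F:|I|>\epsilon\}$ and $\beta F_\epsilon=\bigcup_{I\in\mathcal F_\epsilon}\beta I$ (so $\beta F_{\beta_j}=\bigcup_{I\in\mathcal F,\,|I|>\beta_j}\beta I$). With $\hat f(k)=\frac1{2\pi}\int_Tf(t)e^{-\imath kt}dt$: $S_nf(y)=\sum_{k=-n}^n\hat f(k)e^{\imath ky}$; the Fejér mean is $\sigma_mf=\frac1{m+1}\sum_{k=0}^mS_kf$ ($m\ge0$); the de la Vallée-Poussin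 mean is $V_nf=\frac1n\sum_{j=n}^{2n-1}S_jf$ ($n\ge1$). *)

theory Defs
  imports "HOL-Analysis.Analysis"
begin

text \<open>The circle is the interval \<open>[-\<pi>, \<pi>)\<close>; functions on it are functions on the reals of which
  only the restriction to this interval is ever used.\<close>

definition circle :: "real set" where
  "circle = {- pi..<pi}"

abbreviation len :: "real set \<Rightarrow> real" where
  "len A \<equiv> measure lebesgue A"

abbreviation integrable_circle :: "(real \<Rightarrow> complex) \<Rightarrow> bool" where
  "integrable_circle f \<equiv> set_integrable lebesgue circle f"

definition norm_L1 :: "(real \<Rightarrow> 'a::real_normed_vector) \<Rightarrow> real" where
  "norm_L1 f = (LINT x:circle|lebesgue. norm (f x))"

definition norm_L2 :: "(real \<Rightarrow> 'a::real_normed_vector) \<Rightarrow> real" where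
  "norm_L2 f = sqrt (LINT x:circle|lebesgue. (norm (f x))\<^sup>2)"

definition dyadic_level :: "nat \<Rightarrow> real set set" where
  "dyadic_level n =
     {{- pi + 2 * pi * real k / 2 ^ n ..< - pi + 2 * pi * (real k + 1) / 2 ^ n} | k. k < 2 ^ n}"

definition dyadic :: "real set set" where
  "dyadic = (\<Union>n. dyadic_level n)"

text \<open>Translation by \<open>a\<close> modulo \<open>2\<pi>\<close>, with representatives in \<open>[-\<pi>, \<pi>)\<close>.\<close>

definition circle_translate :: "real set \<Rightarrow> real \<Rightarrow> real set" where
  "circle_translate A a = {x \<in> circle. \<exists>y\<in>A. \<exists>k::int. x = y + a + 2 * pi * of_int k}"

definition neighbour :: "real set \<Rightarrow> int \<Rightarrow> real set" where
  "neighbour I i = circle_translate I (len I * of_int i)"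

definition dilate :: "nat \<Rightarrow> real set \<Rightarrow> real set" where
  "dilate \<beta> I = (\<Union>i\<in>{i::int. real_of_int \<bar>i\<bar> \<le> (real \<beta> - 1) / 2}. neighbour I i)"

definition average :: "(real \<Rightarrow> complex) \<Rightarrow> real set \<Rightarrow> real" where
  "average f I = (LINT x:I|lebesgue. norm (f x)) / len I"

text \<open>The maximal dyadic intervals on which the mean of \<open>\<bar>f\<bar>\<close> exceeds \<open>lam\<close>.\<close>

definition stopping :: "(real \<Rightarrow> complex) \<Rightarrow> real \<Rightarrow> real set set" where
  "stopping f lam =
     {I \<in> dyadic. average f I > lam \<and> (\<forall>J\<in>dyadic. I \<subset> J \<longrightarrow> average f J \<le> lam)}"

text \<open>The set written \<open>\<beta>F\<^sub>\<epsilon>\<close>.\<close>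

definition dilated_stopping :: "nat \<Rightarrow> (real \<Rightarrow> complex) \<Rightarrow> real \<Rightarrow> real \<Rightarrow> real set" where
  "dilated_stopping \<beta> f lam \<epsilon> = (\<Union>I\<in>{I \<in> stopping f lam. len I > \<epsilon>}. dilate \<beta> I)"

definition fourier_coeff :: "(real \<Rightarrow> complex) \<Rightarrow> int \<Rightarrow> complex" where
  "fourier_coeff f k =
     1 / (2 * of_real pi) * (LINT t:circle|lebesgue. f t * exp (- (\<i> * of_int k * of_real t)))"

definition partial_sum :: "nat \<Rightarrow> (real \<Rightarrow> complex) \<Rightarrow> real \<Rightarrow> complex" where
  "partial_sum n f y =
     (\<Sum>k\<in>{- int n..int n}. fourier_coeff f k * exp (\<i> * of_int k * of_real y))"

definition fejer_mean :: "nat \<Rightarrow> (real \<Rightarrow> complex) \<Rightarrow> real \<Rightarrow> complex" where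
  "fejer_mean m f y = 1 / (of_nat m + 1) * (\<Sum>k=0..m. partial_sum k f y)"

text \<open>The de la Vallee-Poussin mean; only meaningful for \<open>n \<ge> 1\<close>.\<close>

definition vp_mean :: "nat \<Rightarrow> (real \<Rightarrow> complex) \<Rightarrow> real \<Rightarrow> complex" where
  "vp_mean n f y = 1 / of_nat n * (\<Sum>j\<in>{n..<2 * n}. partial_sum j f y)"

end

theory Submission
  imports Defs
begin

text \<open>
  Up to sign, the multiplier of \<open>S\<^sub>n - V\<^sub>n\<close> lives on \<open>n < \<bar>k\<bar> < 2n\<close>, so each product with a Fejer mean of
  order at most \<open>n/10\<close> has frequencies in \<open>0.9n < \<bar>k\<bar> < 2.1n\<close>; for ratio \<open>q > 2.5\<close> these bands are disjoint, which gives
  the equality. For the bound split \<open>f\<close> at a fixed scale into three parts: on stopping intervals longer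
  than \<open>\<beta>\<^sub>j\<close>, on those with length in \<open>(1/n\<^sub>j, \<beta>\<^sub>j]\<close>, and the rest. The rest has averages at most \<open>\<lambda>\<close> at scale
  \<open>1/n\<^sub>j\<close>, so duality with a Fejer kernel bounds its contribution by \<open>\<lambda>\<parallel>f\<parallel>\<^sub>1\<close>. The middle part costs an
  extra factor \<open>n\<^sub>j\<beta>\<^sub>j\<close>, but by lacunarity every stopping interval is in the middle range for only
  \<open>O(log N)\<close> indices \<open>j\<close>. On a large interval subtract from \<open>f\<close> a multiple of \<open>e\<^bsup>int\<^esup>\<close> so that the remainder is
  orthogonal to \<open>e\<^bsup>int\<^esup>\<close>: the subtracted part is bounded by \<open>2\<lambda>\<close>, and the remainder decays like
  \<open>\<lambda>\<bar>I\<bar>\<^sup>2/dist\<^sup>2\<close> away from \<open>I\<close>, while near \<open>I\<close> the weight is \<open>O(1/(n\<^sub>j\<bar>I\<bar>))\<close>, just enough to beat the trivial bound.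
\<close>

section \<open>The circle and its chord metric\<close>

text \<open>The kernel of \<open>S_n - V_n\<close> carries two oscillations, e^{int} and e^{-int}; a
  remainder orthogonal to one of them gains nothing against the other. So the positive half
  \<open>Tpos\<close> is estimated alone. The other half is the conjugate of \<open>Tpos\<close>
  applied to the conjugate of f, which has the same modulus and hence the same stopping intervals.
  Once e^{in(x-t)} is pulled out, the rest of the kernel varies like 1/(1 - z) at z = e^{i(x-t)}, so
  its change across an interval I seen from distance d is O(|I|/d^2), uniformly in n; this is the
  decay of the remainder. As f is only integrable, L^2 bounds have two sources: the L^1 norm times
  the supremum of a Fejer mean, which dyadic averages control, and pointwise domination by bumps
  sitting on the intervals, whose total length is at most the L^1 norm of f over \<lambda>. In the
  final estimate a factor N comes both from the number of scales and from n_j \<beta>_j; the latter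
  also brings two logarithms, and the overlap count of the middle ranges a third.\<close>

lemma exp_eq_cis: "exp (\<i> * of_int k * of_real t) = cis (of_int k * t)"
  by (simp add: cis_conv_exp mult.assoc)

text \<open>Restricting the measure once turns all set integrals into integrals over a finite
  measure space, where bounded measurable functions are integrable. The completed measure is kept
  because f is only Lebesgue measurable.\<close>

definition circ :: "real measure" where
  "circ = restrict_space lebesgue circle"

lemma circle_sets [measurable, simp]: "circle \<in> sets lebesgue"
  unfolding circle_def by simp

lemma space_circ [simp]: "space circ = circle"
  unfolding circ_def by simp

lemma set_integrable_circ: "set_integrable lebesgue circle f \<longleftrightarrow> integrable circ f"
  for f :: "real \<Rightarrow> 'a::{banach,second_countable_topology}"
  unfolding circ_def set_integrable_def by (subst integrable_restrict_space) auto

lemma set_integral_circ: "(LINT x:circle|lebesgue. f x) = integral\<^sup>L circ f"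
  for f :: "real \<Rightarrow> 'a::{banach,second_countable_topology}"
  unfolding circ_def set_lebesgue_integral_def by (subst integral_restrict_space) auto

lemma emeasure_circ: "emeasure circ (space circ) = 2 * pi"
  by (simp add: circ_def emeasure_restrict_space circle_def)

interpretation circ: finite_measure circ
  by (rule finite_measureI) (simp only: emeasure_circ, simp)

lemma measure_circ: "measure circ circle = 2 * pi"
  using emeasure_circ by (simp add: measure_def)

lemma measurable_circ: "f \<in> borel_measurable borel \<Longrightarrow> f \<in> borel_measurable circ"
  unfolding circ_def
  by (intro measurable_restrict_space1) (simp add: borel_measurable_if_lebesgue_on measurable_completion)

lemma sets_circ: "A \<in> sets borel \<Longrightarrow> A \<subseteq> circle \<Longrightarrow> A \<in> sets circ"
  unfolding circ_def by (subst sets_restrict_space_iff) auto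

lemma set_integral_sub_circ:
  fixes f :: "real \<Rightarrow> 'a::{banach,second_countable_topology}"
  assumes "A \<subseteq> circle"
  shows "(LINT x:A|lebesgue. f x) = (LINT x|circ. indicator A x *\<^sub>R f x)"
proof -
  have "(LINT x|circ. indicator A x *\<^sub>R f x) = (LINT x:circle|lebesgue. indicator A x *\<^sub>R f x)"
    by (rule set_integral_circ[symmetric])
  also have "\<dots> = (LINT x:A|lebesgue. f x)"
    unfolding set_lebesgue_integral_def
    by (rule Bochner_Integration.integral_cong) (use assms in \<open>auto simp: indicator_def\<close>)
  finally show ?thesis ..
qed

lemma integrable_circ_bounded:
  fixes f :: "real \<Rightarrow> 'a::{banach,second_countable_topology}"
  assumes "f \<in> borel_measurable circ" "\<And>x. x \<in> circle \<Longrightarrow> norm (f x) \<le> B"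
  shows "integrable circ f"
  by (rule circ.integrable_const_bound[of _ B]) (use assms in \<open>auto intro!: AE_I2\<close>)

lemma integrable_circ_mult:
  fixes f g :: "real \<Rightarrow> complex"
  assumes "integrable circ f" "g \<in> borel_measurable circ" "\<And>x. x \<in> circle \<Longrightarrow> cmod (g x) \<le> B"
  shows "integrable circ (\<lambda>x. f x * g x)"
proof (rule Bochner_Integration.integrable_bound)
  show "integrable circ (\<lambda>x. of_real B * f x)" using assms by simp
  show "(\<lambda>x. f x * g x) \<in> borel_measurable circ"
    using assms by (auto intro!: borel_measurable_times)
  show "AE x in circ. cmod (f x * g x) \<le> cmod (complex_of_real B * f x)"
  proof (rule AE_I2)
    fix x assume "x \<in> space circ"
    hence "cmod (g x) \<le> \<bar>B\<bar>" using assms(3)[of x] by auto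
    thus "cmod (f x * g x) \<le> cmod (complex_of_real B * f x)"
      by (simp add: norm_mult mult_right_mono mult.commute[of "cmod (f x)"])
  qed
qed

lemma integrable_circ_mult_real:
  fixes f g :: "real \<Rightarrow> real"
  assumes "integrable circ f" "g \<in> borel_measurable circ" "\<And>x. x \<in> circle \<Longrightarrow> \<bar>g x\<bar> \<le> B"
  shows "integrable circ (\<lambda>x. f x * g x)"
proof (rule Bochner_Integration.integrable_bound)
  show "integrable circ (\<lambda>x. B * f x)" using assms by simp
  show "(\<lambda>x. f x * g x) \<in> borel_measurable circ"
    using assms by (auto intro!: borel_measurable_times)
  show "AE x in circ. norm (f x * g x) \<le> norm (B * f x)"
  proof (rule AE_I2)
    fix x assume "x \<in> space circ"
    hence "\<bar>g x\<bar> \<le> \<bar>B\<bar>" using assms(3)[of x] by auto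
    thus "norm (f x * g x) \<le> norm (B * f x)"
      by (simp add: abs_mult mult_right_mono mult.commute[of "\<bar>f x\<bar>"])
  qed
qed

text \<open>The chord is comparable to the distance on the circle, and using it avoids all case distinctions
  about wrapping around.\<close>

definition rho :: "real \<Rightarrow> real \<Rightarrow> real" where
  "rho x t = cmod (cis x - cis t)"

lemma rho_nonneg [simp]: "0 \<le> rho x t"
  by (simp add: rho_def)

lemma rho_commute: "rho x t = rho t x"
  by (simp add: rho_def norm_minus_commute)

lemma rho_triangle: "rho x z \<le> rho x y + rho y z"
  unfolding rho_def using norm_triangle_ineq[of "cis x - cis y" "cis y - cis z"] by simp

lemma continuous_cis [continuous_intros]:
  "continuous_on A f \<Longrightarrow> continuous_on A (\<lambda>x. cis (f x))"
  unfolding cis_conv_exp by (intro continuous_intros)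

lemma measurable_cis [measurable]: "cis \<in> borel_measurable borel"
  by (intro borel_measurable_continuous_onI continuous_intros)

lemma rho_measurable [measurable]: "rho x \<in> borel_measurable borel" "(\<lambda>x. rho x t) \<in> borel_measurable borel"
  unfolding rho_def by measurable

lemma rho_eq_sin: "rho x t = 2 * \<bar>sin ((x - t) / 2)\<bar>"
proof -
  have "(rho x t)\<^sup>2 = (cos x - cos t)\<^sup>2 + (sin x - sin t)\<^sup>2"
    by (simp add: rho_def cmod_power2)
  also have "\<dots> = (sin x)\<^sup>2 + (cos x)\<^sup>2 + (sin t)\<^sup>2 + (cos t)\<^sup>2 - 2 * (cos x * cos t + sin x * sin t)"
    by (simp add: power2_eq_square algebra_simps)
  also have "\<dots> = 2 - 2 * cos (x - t)"
    by (simp add: cos_diff)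
  also have "\<dots> = 4 * (sin ((x - t) / 2))\<^sup>2"
    using cos_double_sin[of "(x - t) / 2"] unfolding times_divide_eq_right nonzero_mult_div_cancel_left[OF zero_neq_numeral[symmetric]] by simp
  also have "\<dots> = (2 * \<bar>sin ((x - t) / 2)\<bar>)\<^sup>2"
    by (simp add: power2_eq_square)
  finally show ?thesis
    by (subst (asm) power2_eq_iff_nonneg) auto
qed

lemma rho_le: "rho x t \<le> \<bar>x - t\<bar>"
  using abs_sin_x_le_abs_x[of "(x - t) / 2"] by (simp add: rho_eq_sin)

lemma rho_shift: "rho x (t + 2 * pi * of_int k) = rho x t"
proof -
  have "cis (t + 2 * pi * of_int k) = cis t"
    unfolding cis_mult[symmetric] using cis_multiple_2pi[of "of_int k"] by simp
  thus ?thesis by (simp add: rho_def)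
qed

text \<open>Jordan's inequality: the concave graph lies above its chord over [0, pi/2], and x
  divides this interval with weight 2x/pi.\<close>

lemma sin_ge_chord:
  fixes x :: real
  assumes "0 \<le> x" "x \<le> pi / 2"
  shows "2 / pi * x \<le> sin x"
proof -
  have "concave_on {0..pi/2} sin"
  proof (rule f''_le0_imp_concave)
    show "(sin has_real_derivative cos y) (at y)" for y by (rule DERIV_sin)
    show "(cos has_real_derivative - sin y) (at y)" for y by (rule DERIV_cos)
    show "- sin y \<le> 0" if "y \<in> {0..pi/2}" for y
      using that by (auto intro!: sin_ge_zero)
  qed simp
  from concave_onD[OF this, of "2 / pi * x" 0 "pi/2"] show ?thesis
    using assms by (simp add: field_simps)
qed

lemma rho_ge: "\<bar>x - t\<bar> \<le> pi \<Longrightarrow> 2 / pi * \<bar>x - t\<bar> \<le> rho x t"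
proof -
  assume a: "\<bar>x - t\<bar> \<le> pi"
  have "2 / pi * (\<bar>x - t\<bar> / 2) \<le> sin (\<bar>x - t\<bar> / 2)"
    by (rule sin_ge_chord) (use a in auto)
  also have "\<dots> \<le> \<bar>sin ((x - t) / 2)\<bar>"
  proof (cases "x \<ge> t")
    case False
    hence "sin (\<bar>x - t\<bar> / 2) = sin (- ((x - t) / 2))" by (intro arg_cong[where f = sin]) (simp add: field_simps)
    thus ?thesis by simp
  qed simp
  finally show ?thesis by (simp add: rho_eq_sin)
qed

section \<open>Integrals of Poisson-type bumps over the circle\<close>

lemma integral_circ_closed:
  fixes g :: "real \<Rightarrow> 'a::euclidean_space"
  assumes "continuous_on UNIV g"
  shows "integral\<^sup>L circ g = integral {-pi..pi} g"
proof -
  have "(LINT s|circ. g s) = (LINT s:circle|lebesgue. g s)"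
    by (simp add: set_integral_circ)
  also have "\<dots> = (LINT s:{-pi..pi}|lebesgue. g s)"
    unfolding set_lebesgue_integral_def
  proof (rule integral_cong_AE)
    have gm: "g \<in> borel_measurable lebesgue"
      by (intro measurable_completion) (simp add: borel_measurable_continuous_onI assms)
    show "(\<lambda>s. indicat_real circle s *\<^sub>R g s) \<in> borel_measurable lebesgue"
      using gm by (intro borel_measurable_scaleR borel_measurable_indicator) auto
    show "(\<lambda>s. indicat_real {-pi..pi} s *\<^sub>R g s) \<in> borel_measurable lebesgue"
      using gm by (intro borel_measurable_scaleR borel_measurable_indicator) auto
    have "AE s in lebesgue. s \<noteq> pi"
      by (intro AE_completion AE_lborel_singleton)
    thus "AE s in lebesgue. indicat_real circle s *\<^sub>R g s = indicat_real {-pi..pi} s *\<^sub>R g s"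
      by eventually_elim (auto simp: indicator_def circle_def)
  qed
  also have "\<dots> = integral {-pi..pi} g"
    by (intro set_lebesgue_integral_eq_integral(2) absolutely_integrable_continuous_real
          continuous_on_subset[OF assms]) simp
  finally show ?thesis .
qed

text \<open>The antiderivative is a rescaled arctan, whose variation is at most pi wherever the
  centre lies. The centre \<open>y\<close> is an arbitrary real because translates by 2 pi of points
  of the circle will be inserted.\<close>

lemma integral_cauchy_le:
  assumes "r > 0"
  shows "(LINT s|circ. 1 / (r\<^sup>2 + (2 / pi * (s - y))\<^sup>2)) \<le> pi\<^sup>2 / (2 * r)"
proof -
  let ?g = "\<lambda>s. 1 / (r\<^sup>2 + (2 / pi * (s - y))\<^sup>2)"
  let ?G = "\<lambda>s. pi / (2 * r) * arctan (2 / pi * (s - y) / r)"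
  have pos: "r\<^sup>2 + (2 / pi * (s - y))\<^sup>2 > 0" for s using assms by (simp add: add_pos_nonneg)
  have cont: "continuous_on UNIV ?g"
    by (intro continuous_intros) (metis pos less_irrefl)
  have hi: "(?g has_integral (?G pi - ?G (-pi))) {-pi..pi}"
  proof (rule fundamental_theorem_of_calculus)
    show "(?G has_vector_derivative ?g s) (at s within {-pi..pi})" for s
    proof -
      have "(?G has_real_derivative
          pi / (2 * r) * (inverse (1 + (2 / pi * (s - y) / r)\<^sup>2) * (2 / pi / r))) (at s within {-pi..pi})"
        using assms by (auto intro!: derivative_eq_intros)
      moreover have "pi / (2 * r) * (inverse (1 + (2 / pi * (s - y) / r)\<^sup>2) * (2 / pi / r)) = ?g s"
      proof -
        have "r\<^sup>2 * (1 + (2 / pi * (s - y) / r)\<^sup>2) = r\<^sup>2 + (2 / pi * (s - y))\<^sup>2"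
          using assms by (simp add: power_divide power_mult_distrib distrib_left)
        moreover have "pi / (2 * r) * (inverse (1 + (2 / pi * (s - y) / r)\<^sup>2) * (2 / pi / r))
            = 1 / (r\<^sup>2 * (1 + (2 / pi * (s - y) / r)\<^sup>2))"
          using assms by (simp add: divide_simps power2_eq_square)
        ultimately show ?thesis by simp
      qed
      ultimately show ?thesis
        by (simp add: has_real_derivative_iff_has_vector_derivative)
    qed
  qed simp
  have "(LINT s|circ. ?g s) = integral {-pi..pi} ?g"
    by (rule integral_circ_closed[OF cont])
  also have "\<dots> = ?G pi - ?G (-pi)"
    using hi by (rule integral_unique)
  also have "\<dots> = pi / (2 * r) * (arctan (2 / pi * (pi - y) / r) - arctan (2 / pi * (-pi - y) / r))"
    by (simp add: right_diff_distrib)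
  also have "\<dots> \<le> pi / (2 * r) * pi"
  proof (rule mult_left_mono)
    show "arctan (2 / pi * (pi - y) / r) - arctan (2 / pi * (-pi - y) / r) \<le> pi"
      using arctan_ubound[of "2 / pi * (pi - y) / r"] arctan_lbound[of "2 / pi * (-pi - y) / r"] by linarith
  qed (use assms in simp)
  finally show ?thesis by (simp add: power2_eq_square)
qed

lemma poisson_measurable [measurable]:
  "(\<lambda>s. 1 / (r\<^sup>2 + (rho x s)\<^sup>2)) \<in> borel_measurable borel"
  by measurable

lemma poisson_integrable:
  assumes "r > 0"
  shows "integrable circ (\<lambda>s. 1 / (r\<^sup>2 + (rho x s)\<^sup>2))"
proof (rule integrable_circ_bounded)
  show "norm (1 / (r\<^sup>2 + (rho x s)\<^sup>2)) \<le> 1 / r\<^sup>2" for s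
    using assms by (simp add: frac_le)
qed (simp add: measurable_circ)

lemma pi_less_32: "pi < 3.2"
  using pi_approx by simp

text \<open>One of x, x - 2 pi, x + 2 pi lies within pi of s, and there Jordan's inequality bounds
  the chord from below by 2/pi times the distance. The periodic bump is therefore dominated by three
  Cauchy densities on the line, with total integral 3 pi^2/(2r) < 16/r.\<close>

lemma poisson_integral_le:
  assumes "r > 0" "x \<in> circle"
  shows "(LINT s|circ. 1 / (r\<^sup>2 + (rho x s)\<^sup>2)) \<le> 16 / r"
proof -
  let ?g = "\<lambda>y s. 1 / (r\<^sup>2 + (2 / pi * (s - y))\<^sup>2)"
  have pos: "r\<^sup>2 + z\<^sup>2 > 0" for z :: real using assms by (simp add: add_pos_nonneg)
  have int: "integrable circ (?g y)" for y
    by (rule integrable_circ_bounded[of _ "1 / r\<^sup>2"])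
       (use assms in \<open>auto intro!: measurable_circ divide_left_mono mult_pos_pos simp: pos\<close>)
  have nn: "0 \<le> ?g y s" for y s using pos[of "2 / pi * (s - y)"] by simp
  have key: "1 / (r\<^sup>2 + (rho x s)\<^sup>2) \<le> ?g (x - 2 * pi) s + ?g x s + ?g (x + 2 * pi) s"
    if "s \<in> circle" for s
  proof -
    have *: "1 / (r\<^sup>2 + (rho x s)\<^sup>2) \<le> ?g y s" if "\<bar>y - s\<bar> \<le> pi" "rho y s = rho x s" for y
    proof -
      have "(2 / pi * (s - y))\<^sup>2 = (2 / pi * \<bar>y - s\<bar>)\<^sup>2"
        by (simp only: power_mult_distrib power2_abs power2_commute[of s y])
      also have "\<dots> \<le> (rho x s)\<^sup>2"
        using rho_ge[OF that(1)] that(2) by (intro power_mono) auto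
      finally show ?thesis
        using pos by (intro divide_left_mono mult_pos_pos) auto
    qed
    have sh: "rho (x - 2 * pi) s = rho x s" "rho (x + 2 * pi) s = rho x s"
      using rho_shift[of s x 1] rho_shift[of s x "-1"] by (simp_all add: rho_commute)
    have "\<bar>x - s\<bar> \<le> pi \<or> \<bar>x - 2 * pi - s\<bar> \<le> pi \<or> \<bar>x + 2 * pi - s\<bar> \<le> pi"
      using assms that by (auto simp: circle_def)
    thus ?thesis
    proof (elim disjE)
      assume "\<bar>x - s\<bar> \<le> pi" from *[OF this refl] nn[where y = "x - 2 * pi" and s = s] nn[where y = "x + 2 * pi" and s = s] show ?thesis by linarith
    next
      assume "\<bar>x - 2 * pi - s\<bar> \<le> pi"
      from *[OF this sh(1)] nn[where y = "x" and s = s] nn[where y = "x + 2 * pi" and s = s] show ?thesis by linarith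
    next
      assume "\<bar>x + 2 * pi - s\<bar> \<le> pi"
      from *[OF this sh(2)] nn[where y = "x" and s = s] nn[where y = "x - 2 * pi" and s = s] show ?thesis by linarith
    qed
  qed
  have "(LINT s|circ. 1 / (r\<^sup>2 + (rho x s)\<^sup>2))
      \<le> (LINT s|circ. ?g (x - 2 * pi) s + ?g x s + ?g (x + 2 * pi) s)"
  proof (rule integral_mono)
    show "integrable circ (\<lambda>s. ?g (x - 2 * pi) s + ?g x s + ?g (x + 2 * pi) s)"
      by (intro Bochner_Integration.integrable_add int)
  qed (use key assms in \<open>auto intro!: poisson_integrable\<close>)
  also have "\<dots> = (LINT s|circ. ?g (x - 2 * pi) s) + (LINT s|circ. ?g x s) + (LINT s|circ. ?g (x + 2 * pi) s)"
    by (simp only: Bochner_Integration.integral_add Bochner_Integration.integrable_add int)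
  also have "\<dots> \<le> pi\<^sup>2 / (2 * r) + pi\<^sup>2 / (2 * r) + pi\<^sup>2 / (2 * r)"
    by (intro add_mono integral_cauchy_le assms)
  also have "\<dots> = 3 / 2 * pi\<^sup>2 / r" by simp
  also have "\<dots> \<le> 16 / r"
  proof (rule divide_right_mono)
    have "pi\<^sup>2 \<le> 3.2\<^sup>2" using pi_less_32 by (intro power_mono) auto
    thus "3 / 2 * pi\<^sup>2 \<le> 16" by (simp add: power2_eq_square)
  qed (use assms in simp)
  finally show ?thesis .
qed

section \<open>Fourier multipliers as integral operators\<close>

lemma cis_measurable_lin [measurable]: "(\<lambda>t. cis (c * t)) \<in> borel_measurable borel"
  "(\<lambda>t. cis (c * (x - t))) \<in> borel_measurable borel"
  by (intro borel_measurable_continuous_onI continuous_intros)+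

lemma integrable_circ_cis:
  "integrable circ h \<Longrightarrow> integrable circ (\<lambda>t. h t * cis (c * t))"
  by (rule integrable_circ_mult[where B = 1]) (auto intro: measurable_circ)

lemma fourier_coeff_eq:
  "fourier_coeff h k = 1 / (2 * pi) * (LINT t|circ. h t * cis (- of_int k * t))"
  unfolding fourier_coeff_def set_integral_circ
  by (simp add: cis_conv_exp mult.assoc)

lemma partial_sum_eq:
  "partial_sum n h x = (\<Sum>k\<in>{- int n..int n}. fourier_coeff h k * cis (of_int k * x))"
  unfolding partial_sum_def exp_eq_cis ..

text \<open>The frequency map \<phi> makes one lemma serve both symmetric integer ranges (partial
  sums) and ranges of natural numbers (\<open>Tpos\<close>).\<close>

lemma multiplier_integral:
  fixes c :: "'b \<Rightarrow> complex" and \<phi> :: "'b \<Rightarrow> int"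
  assumes "integrable circ h" "finite A"
  shows "(\<Sum>k\<in>A. c k * fourier_coeff h (\<phi> k) * cis (of_int (\<phi> k) * x))
    = 1 / (2 * pi) * (LINT t|circ. h t * (\<Sum>k\<in>A. c k * cis (of_int (\<phi> k) * (x - t))))"
proof -
  have "(LINT t|circ. h t * (\<Sum>k\<in>A. c k * cis (of_int (\<phi> k) * (x - t))))
     = (LINT t|circ. (\<Sum>k\<in>A. c k * cis (of_int (\<phi> k) * x) * (h t * cis (- of_int (\<phi> k) * t))))"
  proof (intro Bochner_Integration.integral_cong refl)
    fix t
    have *: "cis (of_int (\<phi> k) * (x - t)) = cis (of_int (\<phi> k) * x) * cis (- of_int (\<phi> k) * t)" for k
      by (subst cis_mult) (simp add: algebra_simps)
    show "h t * (\<Sum>k\<in>A. c k * cis (of_int (\<phi> k) * (x - t)))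
       = (\<Sum>k\<in>A. c k * cis (of_int (\<phi> k) * x) * (h t * cis (- of_int (\<phi> k) * t)))"
      unfolding * by (simp add: sum_distrib_left mult_ac)
  qed
  also have "\<dots> = (\<Sum>k\<in>A. c k * cis (of_int (\<phi> k) * x) * (LINT t|circ. h t * cis (- of_int (\<phi> k) * t)))"
    by (subst Bochner_Integration.integral_sum)
       (intro integrable_mult_right integrable_circ_cis assms, rule sum.cong[OF refl], rule integral_mult_right_zero)
  finally show ?thesis
    unfolding fourier_coeff_eq by (simp add: sum_distrib_left mult_ac)
qed

section \<open>Orthogonality of the exponentials\<close>

lemma integral_cis: "(LINT t|circ. cis (of_int k * t)) = (if k = 0 then 2 * pi else 0)"
proof (cases "k = 0")
  case True
  thus ?thesis by (simp add: measure_circ scaleR_conv_of_real)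
next
  case False
  let ?G = "\<lambda>t. cis (of_int k * t) / (\<i> * of_int k)"
  have "((\<lambda>t. cis (of_int k * t)) has_integral (?G pi - ?G (-pi))) {-pi..pi}"
  proof (rule fundamental_theorem_of_calculus)
    fix t
    show "(?G has_vector_derivative cis (of_int k * t)) (at t within {-pi..pi})"
      unfolding cis_conv_exp using False
      by (auto intro!: derivative_eq_intros has_vector_derivative_real_field simp: field_simps)
  qed simp
  moreover have "?G pi = ?G (-pi)"
  proof -
    have "cis (of_int k * pi) = cis (of_int k * (-pi) + 2 * pi * of_int k)"
      by (simp add: algebra_simps)
    also have "\<dots> = cis (of_int k * (- pi))"
      unfolding cis_mult[symmetric] using cis_multiple_2pi[of "of_int k"] by simp
    finally show ?thesis by simp
  qed
  ultimately have "integral {-pi..pi} (\<lambda>t. cis (of_int k * t)) = 0"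
    by (simp add: integral_unique)
  thus ?thesis using False
    by (subst integral_circ_closed) (auto intro!: continuous_intros)
qed

lemma integral_trig_prod:
  assumes "finite P" "finite Q"
  shows "(LINT x|circ. (\<Sum>p\<in>P. c p * cis (of_int (\<phi> p) * x)) * cnj (\<Sum>q\<in>Q. d q * cis (of_int (\<psi> q) * x)))
    = 2 * pi * (\<Sum>p\<in>P. \<Sum>q\<in>Q. if \<phi> p = \<psi> q then c p * cnj (d q) else 0)"
proof -
  have "(LINT x|circ. (\<Sum>p\<in>P. c p * cis (of_int (\<phi> p) * x)) * cnj (\<Sum>q\<in>Q. d q * cis (of_int (\<psi> q) * x)))
    = (LINT x|circ. (\<Sum>p\<in>P. \<Sum>q\<in>Q. c p * cnj (d q) * cis (of_int (\<phi> p - \<psi> q) * x)))"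
  proof (intro Bochner_Integration.integral_cong refl)
    fix x
    have *: "cis (of_int (\<phi> p - \<psi> q) * x) = cis (of_int (\<phi> p) * x) * cnj (cis (of_int (\<psi> q) * x))" for p q
      unfolding cis_cnj by (subst cis_mult) (simp add: algebra_simps)
    show "(\<Sum>p\<in>P. c p * cis (of_int (\<phi> p) * x)) * cnj (\<Sum>q\<in>Q. d q * cis (of_int (\<psi> q) * x))
       = (\<Sum>p\<in>P. \<Sum>q\<in>Q. c p * cnj (d q) * cis (of_int (\<phi> p - \<psi> q) * x))"
      unfolding * by (simp add: sum_product mult_ac)
  qed
  also have "\<dots> = (\<Sum>p\<in>P. \<Sum>q\<in>Q. c p * cnj (d q) * (LINT x|circ. cis (of_int (\<phi> p - \<psi> q) * x)))"
  proof -
    have i: "integrable circ (\<lambda>x. cis (of_int k * x))" for k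
      by (rule integrable_circ_bounded[where B = 1]) (auto intro: measurable_circ)
    have j: "integrable circ (\<lambda>x. c p * cnj (d q) * cis (of_int (\<phi> p - \<psi> q) * x))" for p q
      by (intro integrable_mult_right i)
    show ?thesis
      by (simp only: Bochner_Integration.integral_sum Bochner_Integration.integrable_sum j integral_mult_right_zero)
  qed
  also have "\<dots> = 2 * pi * (\<Sum>p\<in>P. \<Sum>q\<in>Q. if \<phi> p = \<psi> q then c p * cnj (d q) else 0)"
    unfolding integral_cis by (simp add: sum_distrib_left if_distrib cong: if_cong) 
      (intro sum.cong refl, auto)
  finally show ?thesis .
qed

lemma parseval_trig:
  assumes "finite P" "inj_on \<phi> P"
  shows "(LINT x|circ. (cmod (\<Sum>p\<in>P. c p * cis (of_int (\<phi> p) * x)))\<^sup>2) = 2 * pi * (\<Sum>p\<in>P. (cmod (c p))\<^sup>2)"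
proof -
  have "complex_of_real (LINT x|circ. (cmod (\<Sum>p\<in>P. c p * cis (of_int (\<phi> p) * x)))\<^sup>2)
     = (LINT x|circ. of_real ((cmod (\<Sum>p\<in>P. c p * cis (of_int (\<phi> p) * x)))\<^sup>2))"
    by (rule integral_complex_of_real[symmetric])
  also have "\<dots> = (LINT x|circ. (\<Sum>p\<in>P. c p * cis (of_int (\<phi> p) * x)) * cnj (\<Sum>q\<in>P. c q * cis (of_int (\<phi> q) * x)))"
    by (simp only: complex_norm_square)
  also have "\<dots> = 2 * pi * (\<Sum>p\<in>P. \<Sum>q\<in>P. if p = q then c p * cnj (c q) else 0)"
  proof -
    have "(\<phi> p = \<phi> q) = (p = q)" if "p \<in> P" "q \<in> P" for p q
      using that assms(2) by (auto dest: inj_onD)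
    thus ?thesis by (subst integral_trig_prod[OF assms(1) assms(1)]) (simp cong: sum.cong)
  qed
  also have "\<dots> = of_real (2 * pi * (\<Sum>p\<in>P. (cmod (c p))\<^sup>2))"
    using assms(1) by (simp add: complex_norm_square[symmetric] del: of_real_power)
  finally show ?thesis by (simp only: of_real_eq_iff)
qed

section \<open>Size of the Fejer kernel\<close>

definition fejer_ker :: "nat \<Rightarrow> real \<Rightarrow> complex" where
  "fejer_ker m u = 1 / (of_nat m + 1) * (\<Sum>k=0..m. \<Sum>l\<in>{- int k..int k}. cis (of_int l * u))"

lemma fejer_ker_measurable [measurable]: "(\<lambda>t. fejer_ker m (x - t)) \<in> borel_measurable borel"
  unfolding fejer_ker_def by measurable

lemma norm_fejer_ker_le1: "cmod (fejer_ker m u) \<le> real m + 1"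
proof -
  have "cmod (\<Sum>k=0..m. \<Sum>l\<in>{- int k..int k}. cis (of_int l * u))
    \<le> (\<Sum>k=0..m. \<Sum>l\<in>{- int k..int k}. 1)"
    by (intro sum_norm_le) simp
  also have "\<dots> = (\<Sum>k=0..m. 2 * real k + 1)"
    by (simp add: nat_add_distrib algebra_simps)
  also have "\<dots> = (real m + 1) * (real m + 1)"
    by (induction m) (auto simp: algebra_simps)
  finally show ?thesis
    unfolding fejer_ker_def using norm_of_nat[of "Suc m", where 'a = complex]
    by (simp add: norm_mult norm_divide field_simps del: norm_of_nat)
qed

lemma dirichlet_closed:
  "(cis u - 1) * (\<Sum>l\<in>{- int k..int k}. cis (of_int l * u)) = cis ((real k + 1) * u) - cis (- real k * u)"
proof (induction k)
  case 0
  show ?case by simp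
next
  case (Suc k)
  have "{- int (Suc k)..int (Suc k)} = insert (int (Suc k)) (insert (- int (Suc k)) {- int k..int k})"
    by auto
  hence "(\<Sum>l\<in>{- int (Suc k)..int (Suc k)}. cis (of_int l * u))
     = cis ((real k + 1) * u) + cis (- (real k + 1) * u) + (\<Sum>l\<in>{- int k..int k}. cis (of_int l * u))"
    by (simp add: add_ac)
  hence "(cis u - 1) * (\<Sum>l\<in>{- int (Suc k)..int (Suc k)}. cis (of_int l * u)) =
      (cis u - 1) * (cis ((real k + 1) * u) + cis (- (real k + 1) * u)) + (cis ((real k + 1) * u) - cis (- real k * u))"
    by (simp add: distrib_left Suc)
  also have "\<dots> = cis (u + (real k + 1) * u) + cis (u + (- (real k + 1) * u)) 
       - cis (- (real k + 1) * u) - cis (- real k * u)"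
    unfolding cis_mult[symmetric] by (simp add: algebra_simps)
  also have "u + (real k + 1) * u = (real (Suc k) + 1) * u" by (simp add: algebra_simps)
  also have "u + (- (real k + 1) * u) = - real k * u" by (simp add: algebra_simps)
  also have "- (real k + 1) * u = - real (Suc k) * u" by (simp add: algebra_simps)
  finally show ?case by simp
qed

text \<open>The usual closed formula with its denominator multiplied out, so that u = 0 needs no
  separate treatment. The right side has modulus at most 1 + 2 + 1 = 4, which is the source of the
  quadratic decay.\<close>

lemma fejer_closed:
  "(cis u - 1)\<^sup>2 * (\<Sum>k=0..m. \<Sum>l\<in>{- int k..int k}. cis (of_int l * u))
     = cis ((real m + 2) * u) - 2 * cis u + cis (- real m * u)"
proof -
  have "(cis u - 1)\<^sup>2 * (\<Sum>k=0..m. \<Sum>l\<in>{- int k..int k}. cis (of_int l * u))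
     = (cis u - 1) * (\<Sum>k=0..m. cis ((real k + 1) * u) - cis (- real k * u))"
    unfolding dirichlet_closed[symmetric] sum_distrib_left[symmetric] by (simp only: power2_eq_square mult.assoc)
  also have "\<dots> = cis ((real m + 2) * u) - 2 * cis u + cis (- real m * u)"
  proof (induction m)
    case 0
    show ?case using cis_mult[of u u] by (simp add: algebra_simps)
  next
    case (Suc m)
    have "(cis u - 1) * (\<Sum>k=0..Suc m. cis ((real k + 1) * u) - cis (- real k * u))
       = cis ((real m + 2) * u) - 2 * cis u + cis (- real m * u)
          + (cis u - 1) * (cis ((real m + 2) * u) - cis (- (real m + 1) * u))"
    proof -
      have "(\<Sum>k=0..Suc m. cis ((real k + 1) * u) - cis (- real k * u))
        = (\<Sum>k=0..m. cis ((real k + 1) * u) - cis (- real k * u)) + (cis ((real m + 2) * u) - cis (- (real m + 1) * u))"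
        by (simp add: algebra_simps)
      thus ?thesis by (simp only: distrib_left Suc)
    qed
    also have "\<dots> = - 2 * cis u + cis (- real m * u) + cis (u + (real m + 2) * u) - cis (u + (- (real m + 1) * u)) + cis (- (real m + 1) * u)"
      unfolding cis_mult[symmetric] by (simp add: algebra_simps)
    also have "u + (real m + 2) * u = (real (Suc m) + 2) * u" by (simp add: algebra_simps)
    also have "u + (- (real m + 1) * u) = - real m * u" by (simp add: algebra_simps)
    also have "- (real m + 1) * u = - real (Suc m) * u" by (simp add: algebra_simps)
    finally show ?case by simp
  qed
  finally show ?thesis .
qed

lemma rho_diff: "cmod (cis (x - t) - 1) = rho x t"
proof -
  have "cis (x - t) - 1 = cis (- t) * (cis x - cis t)"
    using cis_mult[of "-t" x] cis_mult[of "-t" t] by (simp add: algebra_simps)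
  hence "cmod (cis (x - t) - 1) = cmod (cis (- t)) * cmod (cis x - cis t)" by (simp only: norm_mult)
  thus ?thesis by (simp add: rho_def)
qed

lemma norm_fejer_ker_le2: "cmod (fejer_ker m (x - t)) * (rho x t)\<^sup>2 \<le> 4 / (real m + 1)"
proof -
  have "cmod (fejer_ker m (x - t)) * (rho x t)\<^sup>2 = cmod ((cis (x - t) - 1)\<^sup>2 * fejer_ker m (x - t))"
    by (simp add: norm_mult norm_power rho_diff)
  also have "(cis (x - t) - 1)\<^sup>2 * fejer_ker m (x - t) = 
      (cis ((real m + 2) * (x - t)) - 2 * cis (x - t) + cis (- real m * (x - t))) / (of_nat m + 1)"
    unfolding fejer_ker_def by (subst fejer_closed[symmetric]) simp
  also have "cmod \<dots> = cmod (cis ((real m + 2) * (x - t)) - 2 * cis (x - t) + cis (- real m * (x - t))) / (real m + 1)"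
    using norm_of_nat[of "Suc m", where 'a = complex] by (simp add: norm_divide add_ac del: norm_of_nat)
  also have "\<dots> \<le> 4 / (real m + 1)"
  proof (rule divide_right_mono)
    have "cmod (cis ((real m + 2) * (x - t)) - 2 * cis (x - t) + cis (- real m * (x - t)))
      \<le> cmod (cis ((real m + 2) * (x - t))) + cmod (2 * cis (x - t)) + cmod (cis (- real m * (x - t)))"
      by (smt (verit) norm_triangle_ineq norm_triangle_ineq4)
    thus "cmod (cis ((real m + 2) * (x - t)) - 2 * cis (x - t) + cis (- real m * (x - t))) \<le> 4"
      by (simp add: norm_mult)
  qed simp
  finally show ?thesis .
qed

text \<open>With M = m + 1, adding the height bound M to M^2 times the decay bound gives a single
  majorant valid at all distances; 5 = 1 + 4.\<close>

lemma norm_fejer_ker_le: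
  "cmod (fejer_ker m (x - t)) \<le> 5 * (real m + 1) / (1 + (real m + 1)\<^sup>2 * (rho x t)\<^sup>2)"
proof -
  let ?M = "real m + 1" and ?F = "cmod (fejer_ker m (x - t))"
  have "?M\<^sup>2 * (?F * (rho x t)\<^sup>2) \<le> ?M\<^sup>2 * (4 / ?M)"
    by (intro mult_left_mono norm_fejer_ker_le2) simp
  also have "?M\<^sup>2 * (4 / ?M) = 4 * ?M" by (simp add: power2_eq_square)
  finally have "?F * (1 + ?M\<^sup>2 * (rho x t)\<^sup>2) \<le> 5 * ?M"
    using norm_fejer_ker_le1[of m "x - t"] by (simp add: algebra_simps)
  moreover have "1 + ?M\<^sup>2 * (rho x t)\<^sup>2 > 0" by (simp add: add_pos_nonneg)
  ultimately show ?thesis by (simp add: pos_le_divide_eq)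
qed

lemma fejer_mean_integral:
  assumes "integrable circ h"
  shows "fejer_mean m h x = 1 / (2 * pi) * (LINT t|circ. h t * fejer_ker m (x - t))"
proof -
  have ps: "partial_sum k h x = 1 / (2 * pi) * (LINT t|circ. h t * (\<Sum>l\<in>{- int k..int k}. cis (of_int l * (x - t))))" for k
    using multiplier_integral[OF assms, of "{- int k..int k}" "\<lambda>_. 1" "\<lambda>l. l" x]
    by (simp add: partial_sum_eq)
  have int: "integrable circ (\<lambda>t. h t * (\<Sum>l\<in>{- int k..int k}. cis (of_int l * (x - t))))" for k
    by (rule integrable_circ_mult[OF assms, of _ "\<Sum>l\<in>{- int k..int k}. 1"])
       (auto intro!: measurable_circ sum_norm_le simp del: sum_constant)
  have "(LINT t|circ. h t * fejer_ker m (x - t)) 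
     = (LINT t|circ. 1 / (of_nat m + 1) * (\<Sum>k=0..m. h t * (\<Sum>l\<in>{- int k..int k}. cis (of_int l * (x - t)))))"
    unfolding fejer_ker_def by (intro Bochner_Integration.integral_cong refl) (simp add: sum_distrib_left mult_ac)
  also have "\<dots> = 1 / (of_nat m + 1) * (\<Sum>k=0..m. (LINT t|circ. h t * (\<Sum>l\<in>{- int k..int k}. cis (of_int l * (x - t)))))"
    using int by (simp add: Bochner_Integration.integral_sum)
  finally show ?thesis
    unfolding fejer_mean_def ps by (simp add: sum_distrib_left mult_ac)
qed

section \<open>Fejer means and the positive half of the multiplier\<close>

lemma norm_fejer_mean_le:
  assumes "integrable circ h"
  shows "cmod (fejer_mean m h x) \<le> 1 / (2 * pi) *
    (LINT t|circ. cmod (h t) * (5 * (real m + 1) / (1 + (real m + 1)\<^sup>2 * (rho x t)\<^sup>2)))"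
proof -
  have b: "\<bar>5 * (real m + 1) / (1 + (real m + 1)\<^sup>2 * (rho x t)\<^sup>2)\<bar> \<le> 5 * (real m + 1)" for t
  proof -
    have "1 + (real m + 1)\<^sup>2 * (rho x t)\<^sup>2 \<ge> 1" by simp
    hence "5 * (real m + 1) / (1 + (real m + 1)\<^sup>2 * (rho x t)\<^sup>2) \<le> 5 * (real m + 1) / 1"
      by (intro frac_le) auto
    thus ?thesis by simp
  qed
  have "cmod (LINT t|circ. h t * fejer_ker m (x - t)) \<le> (LINT t|circ. cmod (h t * fejer_ker m (x - t)))"
    by (rule integral_norm_bound)
  also have "\<dots> \<le> (LINT t|circ. cmod (h t) * (5 * (real m + 1) / (1 + (real m + 1)\<^sup>2 * (rho x t)\<^sup>2)))"
  proof (rule integral_mono)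
    show "integrable circ (\<lambda>t. cmod (h t * fejer_ker m (x - t)))"
      by (intro integrable_norm integrable_circ_mult[OF assms, of _ "real m + 1"] norm_fejer_ker_le1 measurable_circ)
         measurable
    show "integrable circ (\<lambda>t. cmod (h t) * (5 * (real m + 1) / (1 + (real m + 1)\<^sup>2 * (rho x t)\<^sup>2)))"
      by (intro integrable_circ_mult_real[OF integrable_norm[OF assms], of _ "5 * (real m + 1)"] b measurable_circ)
         measurable
    fix t
    show "cmod (h t * fejer_ker m (x - t)) \<le> cmod (h t) * (5 * (real m + 1) / (1 + (real m + 1)\<^sup>2 * (rho x t)\<^sup>2))"
      unfolding norm_mult by (intro mult_left_mono norm_fejer_ker_le) simp
  qed
  finally show ?thesis
    by (simp add: fejer_mean_integral[OF assms] norm_mult norm_divide divide_right_mono)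
qed

text \<open>Replacing the natural width 1/M by any d \<ge> 1/M keeps the height 5M and only enlarges
  the tail. This freedom lets the width be matched to a dyadic length later.\<close>

lemma fejer_poisson:
  fixes M d p :: real
  assumes "M > 0" "d > 0" "M * d \<ge> 1"
  shows "5 * M / (1 + M\<^sup>2 * p\<^sup>2) \<le> 5 * M * d\<^sup>2 * (1 / (d\<^sup>2 + p\<^sup>2))"
proof -
  have "1 * p\<^sup>2 \<le> (M * d)\<^sup>2 * p\<^sup>2"
    using assms by (intro mult_right_mono) (auto simp: one_le_power)
  hence "d\<^sup>2 + p\<^sup>2 \<le> d\<^sup>2 * (1 + M\<^sup>2 * p\<^sup>2)"
    by (simp add: algebra_simps power_mult_distrib)
  moreover have "d\<^sup>2 + p\<^sup>2 > 0" "1 + M\<^sup>2 * p\<^sup>2 > 0" using assms by (auto intro!: add_pos_nonneg)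
  ultimately have "1 / (1 + M\<^sup>2 * p\<^sup>2) \<le> d\<^sup>2 / (d\<^sup>2 + p\<^sup>2)"
    by (simp add: field_simps)
  hence "5 * M * (1 / (1 + M\<^sup>2 * p\<^sup>2)) \<le> 5 * M * (d\<^sup>2 / (d\<^sup>2 + p\<^sup>2))"
    using assms by (intro mult_left_mono) auto
  thus ?thesis by simp
qed

text \<open>At width 1/M the majorant has integral at most 5 * 16 = 80, and 80/(2 pi) < 16. With A =
  1 this becomes the universal bound 16 on the weights.\<close>

lemma norm_fejer_mean_bounded:
  assumes "integrable circ h" "\<And>t. t \<in> circle \<Longrightarrow> cmod (h t) \<le> A" "x \<in> circle"
  shows "cmod (fejer_mean m h x) \<le> 16 * A"
proof -
  let ?M = "real m + 1"
  have A: "0 \<le> A" using assms(2)[OF assms(3)] norm_ge_zero order_trans by blast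
  have "(LINT t|circ. cmod (h t) * (5 * ?M / (1 + ?M\<^sup>2 * (rho x t)\<^sup>2)))
      \<le> (LINT t|circ. A * (5 * ?M * (1 / ?M)\<^sup>2) * (1 / ((1 / ?M)\<^sup>2 + (rho x t)\<^sup>2)))"
  proof (rule integral_mono')
    fix t assume "t \<in> space circ"
    hence "cmod (h t) * (5 * ?M / (1 + ?M\<^sup>2 * (rho x t)\<^sup>2)) \<le> A * (5 * ?M * (1 / ?M)\<^sup>2 * (1 / ((1 / ?M)\<^sup>2 + (rho x t)\<^sup>2)))"
      using assms(2) A by (intro mult_mono fejer_poisson) auto
    thus "cmod (h t) * (5 * ?M / (1 + ?M\<^sup>2 * (rho x t)\<^sup>2)) \<le> A * (5 * ?M * (1 / ?M)\<^sup>2) * (1 / ((1 / ?M)\<^sup>2 + (rho x t)\<^sup>2))"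
      by (simp add: mult.assoc)
    show "0 \<le> A * (5 * ?M * (1 / ?M)\<^sup>2) * (1 / ((1 / ?M)\<^sup>2 + (rho x t)\<^sup>2))"
      using A by auto
  next
    show "integrable circ (\<lambda>t. A * (5 * ?M * (1 / ?M)\<^sup>2) * (1 / ((1 / ?M)\<^sup>2 + (rho x t)\<^sup>2)))"
      by (intro integrable_mult_right poisson_integrable) simp
  qed
  also have "\<dots> = A * (5 * ?M * (1 / ?M)\<^sup>2) * (LINT t|circ. 1 / ((1 / ?M)\<^sup>2 + (rho x t)\<^sup>2))"
    by (rule integral_mult_right_zero)
  also have "\<dots> \<le> A * (5 * ?M * (1 / ?M)\<^sup>2) * (16 / (1 / ?M))"
    using A assms by (intro mult_left_mono poisson_integral_le) auto
  also have "\<dots> = 80 * A"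
  proof -
    have "?M \<noteq> 0" by linarith
    thus ?thesis by (simp add: power2_eq_square divide_simps del: add_divide_distrib) (simp add: algebra_simps)
  qed
  finally have "cmod (fejer_mean m h x) \<le> 1 / (2 * pi) * (80 * A)"
    by (intro order_trans[OF norm_fejer_mean_le[OF assms(1)]] mult_left_mono) auto
  also have "\<dots> = 40 / pi * A" by simp
  also have "\<dots> \<le> 16 * A"
  proof (rule mult_right_mono[OF _ A])
    show "40 / pi \<le> 16" using pi_approx by (simp add: field_simps)
  qed
  finally show ?thesis .
qed

text \<open>Pair \<open>h\<close> with its Fejer mean: the weights are nonnegative, and at least \<open>1/2\<close> on \<open>\<bar>k\<bar> \<le> 2n\<close>.\<close>

lemma fourier_coeff_square_bound:
  assumes h: "integrable circ h" and A: "\<And>x. x \<in> circle \<Longrightarrow> cmod (fejer_mean (4 * n) h x) \<le> A"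
  shows "(\<Sum>k\<in>{- int (2 * n)..int (2 * n)}. (cmod (fourier_coeff h k))\<^sup>2) \<le> A / pi * (LINT t|circ. cmod (h t))"
proof -
  let ?c = "fourier_coeff h" and ?M = "4 * n" and ?K = "\<lambda>l. {- int l..int l}"
  define W where "W = (\<Sum>l=0..?M. \<Sum>k\<in>?K l. (cmod (?c k))\<^sup>2)"
  define Q where "Q = (\<Sum>k\<in>?K (2 * n). (cmod (?c k))\<^sup>2)"
  have Q0: "0 \<le> Q" unfolding Q_def by (intro sum_nonneg) auto
  \<comment> \<open>Order 4n is chosen so that the 2n + 1 partial sums of order 2n to 4n, more than
    half of all 4n + 1, contain every frequency up to 2n.\<close>
  have "(real ?M + 1) / 2 * Q \<le> (2 * real n + 1) * Q"
    using Q0 by (intro mult_right_mono) auto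
  also have "\<dots> = (\<Sum>l\<in>{2*n..?M}. Q)" by (simp add: algebra_simps)
  also have "\<dots> \<le> (\<Sum>l\<in>{2*n..?M}. \<Sum>k\<in>?K l. (cmod (?c k))\<^sup>2)"
    unfolding Q_def by (intro sum_mono sum_mono2) auto
  also have "\<dots> \<le> W"
    unfolding W_def by (intro sum_mono2) (auto intro: sum_nonneg)
  finally have QW: "(real ?M + 1) / 2 * Q \<le> W" .
  have int: "integrable circ (\<lambda>t. h t * cnj (?c k * cis (of_int k * t)))" for k
    by (rule integrable_circ_mult[OF h, of _ "cmod (?c k)"])
       (intro measurable_circ borel_measurable_continuous_onI continuous_intros, simp add: norm_mult)
  have one: "(LINT t|circ. h t * cnj (?c k * cis (of_int k * t))) = of_real (2 * pi) * of_real ((cmod (?c k))\<^sup>2)" for k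
  proof -
    have "(LINT t|circ. h t * cnj (?c k * cis (of_int k * t))) = (LINT t|circ. cnj (?c k) * (h t * cis (- of_int k * t)))"
      by (intro Bochner_Integration.integral_cong refl) (simp add: cis_cnj mult_ac)
    also have "\<dots> = cnj (?c k) * (LINT t|circ. h t * cis (- of_int k * t))"
      by (rule integral_mult_right_zero)
    also have "(LINT t|circ. h t * cis (- of_int k * t)) = of_real (2 * pi) * ?c k"
      by (simp add: fourier_coeff_eq)
    finally show ?thesis by (simp only: complex_norm_square) (simp only: mult_ac)
  qed
  \<comment> \<open>The Fejer mean is a trigonometric polynomial, so pairing it with h expands into
    finitely many squared coefficients although h need not be square integrable.\<close>
  have "(LINT t|circ. h t * cnj (fejer_mean ?M h t))
     = (LINT t|circ. 1 / (of_nat ?M + 1) * (\<Sum>l=0..?M. \<Sum>k\<in>?K l. h t * cnj (?c k * cis (of_int k * t))))"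
    unfolding fejer_mean_def partial_sum_eq
    by (intro Bochner_Integration.integral_cong refl) (simp add: sum_distrib_left mult_ac)
  also have "\<dots> = 1 / (of_nat ?M + 1) * (\<Sum>l=0..?M. \<Sum>k\<in>?K l. (LINT t|circ. h t * cnj (?c k * cis (of_int k * t))))"
    using int by (simp only: Bochner_Integration.integral_sum Bochner_Integration.integrable_sum int integral_mult_right_zero)
  also have "\<dots> = 1 / (of_nat ?M + 1) * (of_real (2 * pi) * of_real W)"
    unfolding one W_def by (simp only: of_real_sum sum_distrib_left)
  also have "\<dots> = of_real (2 * pi * W / (real ?M + 1))" by simp
  finally have eq: "(LINT t|circ. h t * cnj (fejer_mean ?M h t)) = of_real (2 * pi * W / (real ?M + 1))" .
  have "pi * Q \<le> 2 * pi * W / (real ?M + 1)"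
  proof -
    have "pi * Q = 2 * pi / (real ?M + 1) * ((real ?M + 1) / 2 * Q)" by simp
    also have "\<dots> \<le> 2 * pi / (real ?M + 1) * W" by (intro mult_left_mono QW) simp
    finally show ?thesis by simp
  qed
  also have "\<dots> \<le> cmod (LINT t|circ. h t * cnj (fejer_mean ?M h t))"
    unfolding eq norm_of_real by (rule abs_ge_self)
  also have "\<dots> \<le> (LINT t|circ. cmod (h t * cnj (fejer_mean ?M h t)))" by (rule integral_norm_bound)
  also have "\<dots> \<le> (LINT t|circ. A * cmod (h t))"
  proof (rule integral_mono')
    fix t assume t: "t \<in> space circ"
    show "cmod (h t * cnj (fejer_mean ?M h t)) \<le> A * cmod (h t)"
      using mult_right_mono[OF A[of t], of "cmod (h t)"] t by (simp add: norm_mult mult.commute)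
    thus "0 \<le> A * cmod (h t)" using norm_ge_zero order_trans by blast
  qed (use h in auto)
  finally have "pi * Q \<le> A * (LINT t|circ. cmod (h t))" by simp
  thus ?thesis unfolding Q_def by (simp add: field_simps)
qed

text \<open>The positive-frequency half of \<open>V\<^sub>n f - S\<^sub>n f\<close>; conjugating \<open>f\<close> and the result gives the other half.\<close>

definition Tpos :: "nat \<Rightarrow> (real \<Rightarrow> complex) \<Rightarrow> real \<Rightarrow> complex" where
  "Tpos n h x = (\<Sum>k\<in>{n<..<2 * n}. of_real ((2 * real n - real k) / real n) * fourier_coeff h (int k) * cis (of_int (int k) * x))"

lemma fourier_coeff_cnj: "fourier_coeff (\<lambda>t. cnj (h t)) k = cnj (fourier_coeff h (- k))"
proof -
  have "(LINT t|circ. cnj (h t) * cis (- of_int k * t)) = (LINT t|circ. cnj (h t * cis (- of_int (- k) * t)))"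
    by (intro Bochner_Integration.integral_cong refl) (simp add: cis_cnj)
  also have "\<dots> = cnj (LINT t|circ. h t * cis (- of_int (- k) * t))"
    by (rule Bochner_Integration.integral_cnj)
  finally show ?thesis unfolding fourier_coeff_eq by simp
qed

text \<open>A frequency k with n < |k| < 2n occurs in the partial sums of order |k| to 2n - 1, that
  is in 2n - |k| of the n averaged ones. Frequencies up to n occur in all of them and cancel against
  S_n.\<close>

lemma partial_sum_minus_vp_mean:
  assumes "n > 0"
  shows "partial_sum n f x - vp_mean n f x = - (Tpos n f x + cnj (Tpos n (\<lambda>t. cnj (f t)) x))"
proof -
  define u where "u k = fourier_coeff f k * cis (of_int k * x)" for k
  define p where "p k = u (int k) + u (- int k)" for k
  have psuc: "partial_sum (Suc j) f x = partial_sum j f x + p (Suc j)" for j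
  proof -
    have "{- int (Suc j)..int (Suc j)} = insert (int (Suc j)) (insert (- int (Suc j)) {- int j..int j})"
      by auto
    thus ?thesis unfolding partial_sum_eq p_def u_def by (simp add: add_ac)
  qed
  have ps: "partial_sum j f x = partial_sum n f x + (\<Sum>k\<in>{n<..j}. p k)" if "j \<ge> n" for j
  proof -
    have "partial_sum (n + d) f x = partial_sum n f x + (\<Sum>k\<in>{n<..n + d}. p k)" for d
    proof (induction d)
      case (Suc d)
      have "{n<..n + Suc d} = insert (Suc (n + d)) {n<..n + d}" by auto
      hence "(\<Sum>k\<in>{n<..n + Suc d}. p k) = p (Suc (n + d)) + (\<Sum>k\<in>{n<..n + d}. p k)" by simp
      thus ?case unfolding add_Suc_right psuc Suc.IH by (simp only: add_ac)
    qed simp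
    from this[of "j - n"] that show ?thesis by simp
  qed
  have T: "Tpos n f x + cnj (Tpos n (\<lambda>t. cnj (f t)) x) = 1 / of_nat n * (\<Sum>k\<in>{n<..<2*n}. of_nat (2 * n - k) * p k)"
  proof -
    have "Tpos n f x + cnj (Tpos n (\<lambda>t. cnj (f t)) x) = (\<Sum>k\<in>{n<..<2*n}. of_real ((2 * real n - real k) / real n) * p k)"
      unfolding Tpos_def p_def u_def fourier_coeff_cnj
      by (simp add: sum.distrib[symmetric] cis_cnj distrib_left mult.assoc)
    also have "\<dots> = (\<Sum>k\<in>{n<..<2*n}. 1 / of_nat n * (of_nat (2 * n - k) * p k))"
      by (intro sum.cong refl) (simp add: of_nat_diff)
    finally show ?thesis by (simp add: sum_distrib_left)
  qed
  have "(\<Sum>j\<in>{n..<2*n}. \<Sum>k\<in>{n<..j}. p k) = (\<Sum>j\<in>{n..<2*n}. \<Sum>k | k \<in> {n<..<2*n} \<and> k \<le> j. p k)"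
    by (intro sum.cong refl) auto
  also have "\<dots> = (\<Sum>k\<in>{n<..<2*n}. \<Sum>j | j \<in> {n..<2*n} \<and> k \<le> j. p k)"
    by (rule sum.swap_restrict) auto
  also have "\<dots> = (\<Sum>k\<in>{n<..<2*n}. of_nat (2 * n - k) * p k)"
  proof (intro sum.cong refl)
    fix k assume "k \<in> {n<..<2*n}"
    hence "{j. j \<in> {n..<2*n} \<and> k \<le> j} = {k..<2*n}" by auto
    thus "(\<Sum>j | j \<in> {n..<2*n} \<and> k \<le> j. p k) = of_nat (2 * n - k) * p k" by simp
  qed
  finally have sw: "(\<Sum>j\<in>{n..<2*n}. \<Sum>k\<in>{n<..j}. p k) = (\<Sum>k\<in>{n<..<2*n}. of_nat (2 * n - k) * p k)" .
  have "vp_mean n f x = 1 / of_nat n * (\<Sum>j\<in>{n..<2*n}. partial_sum n f x + (\<Sum>k\<in>{n<..j}. p k))"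
  proof -
    have "(\<Sum>j\<in>{n..<2*n}. partial_sum j f x) = (\<Sum>j\<in>{n..<2*n}. partial_sum n f x + (\<Sum>k\<in>{n<..j}. p k))"
      by (rule sum.cong[OF refl], rule ps) simp
    thus ?thesis unfolding vp_mean_def by (rule arg_cong)
  qed
  also have "\<dots> = partial_sum n f x + 1 / of_nat n * (\<Sum>k\<in>{n<..<2*n}. of_nat (2 * n - k) * p k)"
    using assms unfolding sum.distrib sw by (simp add: distrib_left)
  finally show ?thesis unfolding T by simp
qed

text \<open>The multiplier (2n - k)/n stays below 1, so Parseval and the coefficient bound suffice.
  This is the only passage from an L^1 norm to an L^2 norm for a general integrable function; the
  supremum \<open>A\<close> is what must be supplied each time.\<close>

lemma Tpos_L2:
  assumes h: "integrable circ h" and A: "\<And>x. x \<in> circle \<Longrightarrow> cmod (fejer_mean (4 * n) h x) \<le> A"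
  shows "(LINT x|circ. (cmod (Tpos n h x))\<^sup>2) \<le> 2 * A * (LINT t|circ. cmod (h t))"
proof -
  have "(LINT x|circ. (cmod (Tpos n h x))\<^sup>2) 
     = 2 * pi * (\<Sum>k\<in>{n<..<2 * n}. (cmod (of_real ((2 * real n - real k) / real n) * fourier_coeff h (int k)))\<^sup>2)"
    unfolding Tpos_def by (rule parseval_trig) auto
  also have "\<dots> \<le> 2 * pi * (\<Sum>k\<in>{n<..<2 * n}. (cmod (fourier_coeff h (int k)))\<^sup>2)"
  proof (intro mult_left_mono sum_mono power_mono)
    fix k assume k: "k \<in> {n<..<2*n}"
    hence "\<bar>(2 * real n - real k) / real n\<bar> \<le> 1" by (simp add: field_simps)
    thus "cmod (of_real ((2 * real n - real k) / real n) * fourier_coeff h (int k)) \<le> cmod (fourier_coeff h (int k))"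
      unfolding norm_mult norm_of_real using mult_right_mono norm_ge_zero by fastforce
  qed auto
  also have "(\<Sum>k\<in>{n<..<2 * n}. (cmod (fourier_coeff h (int k)))\<^sup>2) = (\<Sum>k\<in>int ` {n<..<2 * n}. (cmod (fourier_coeff h k))\<^sup>2)"
    by (subst sum.reindex) auto
  also have "2 * pi * \<dots> \<le> 2 * pi * (\<Sum>k\<in>{- int (2 * n)..int (2 * n)}. (cmod (fourier_coeff h k))\<^sup>2)"
    by (intro mult_left_mono sum_mono2) auto
  also have "\<dots> \<le> 2 * pi * (A / pi * (LINT t|circ. cmod (h t)))"
    by (intro mult_left_mono fourier_coeff_square_bound[OF h A]) auto
  finally show ?thesis by simp
qed

text \<open>The kernel of \<open>Tpos\<close> after the modulation e^{in(x-t)} is removed and k = n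
  + l substituted, as a polynomial in z = e^{i(x-t)}. In this form differences can be estimated
  algebraically.\<close>

definition gker :: "nat \<Rightarrow> complex \<Rightarrow> complex" where
  "gker n z = (\<Sum>l\<in>{0<..<n}. of_real (1 - real l / real n) * z ^ l)"

text \<open>Factoring out \<open>1 - z\<close> leaves a mean of powers of \<open>z\<close>, which is bounded by 1; this gives the
  Lipschitz bound below without derivatives.\<close>

lemma gker_closed:
  assumes "n > 0"
  shows "(1 - z) * (gker n z + 1) = 1 - z * ((\<Sum>l<n. z ^ l) / of_nat n)"
proof -
  \<comment> \<open>Adding 1 restores the term l = 0, absent because the frequency n itself has
    coefficient 0 in S_n - V_n; the full sum then telescopes.\<close>
  have 0: "gker n z + 1 = (\<Sum>l<n. of_real (1 - real l / real n) * z ^ l)"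
  proof -
    have "{..<n} = insert 0 {0<..<n}" using assms by auto
    thus ?thesis unfolding gker_def by simp
  qed
  have "(1 - z) * (\<Sum>l<k. of_real (1 - real l / real n) * z ^ l) = 
     1 - z * ((\<Sum>l<k. z ^ l) / of_nat n) - of_real (1 - real k / real n) * z ^ k" for k
  proof (induction k)
    case (Suc k)
    show ?case using assms
      by (simp only: sum.lessThan_Suc distrib_left Suc.IH) (simp add: field_simps)
  qed simp
  from this[of n] assms show ?thesis unfolding 0 by simp
qed

text \<open>The closed form is (1 - z s(z))/(1 - z) - 1 with s the mean of the first n powers. The
  bound is free of n: the factor n in |z^n - w^n| \<le> n |z - w| is cancelled by the 1/n in s. Half
  of the constant 4 comes from the difference of 1/(1 - z), half from that of s.\<close>

lemma gker_diff:
  assumes n: "n > 0" and z: "cmod z = 1" "z \<noteq> 1" and w: "cmod w = 1" "w \<noteq> 1"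
  shows "cmod (gker n z - gker n w) \<le> 4 * cmod (z - w) / (cmod (1 - z) * cmod (1 - w))"
proof -
  define s where "s v = (\<Sum>l<n. v ^ l) / of_nat n" for v :: complex
  let ?R = "cmod (z - w) / (cmod (1 - z) * cmod (1 - w))"
  have s_closed: "of_nat n * s v * (1 - v) = 1 - v ^ n" for v
    unfolding s_def using n power_diff_sumr2[of 1 n v]
    by (simp add: mult.commute one_diff_power_eq)
  have s1: "cmod (s v) \<le> 1" if "cmod v = 1" for v
  proof -
    have "cmod (\<Sum>l<n. v ^ l) \<le> (\<Sum>l<n. 1)"
      by (intro sum_norm_le) (simp add: norm_power that)
    thus ?thesis unfolding s_def using n by (simp add: norm_divide)
  qed
  have g: "gker n v = (1 - v * s v) / (1 - v) - 1" if "v \<noteq> 1" for v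
    using gker_closed[OF n, of v] that unfolding s_def by (simp add: field_simps)
  have zw: "1 - z \<noteq> 0" "1 - w \<noteq> 0" using z w by auto
  have pw: "cmod (1 - v ^ k) \<le> real k * cmod (1 - v)" if "cmod v = 1" for v k
    using norm_power_diff[of 1 v k] that by (simp add: norm_minus_commute)
  have sdiff: "cmod (s z - s w) \<le> 2 * cmod (z - w) / cmod (1 - z)"
  proof -
    have "of_nat n * (s z - s w) * ((1 - z) * (1 - w)) = (1 - z ^ n) * (1 - w) - (1 - w ^ n) * (1 - z)"
      unfolding s_closed[symmetric] by (simp add: algebra_simps)
    also have "\<dots> = (w ^ n - z ^ n) * (1 - w) + (1 - w ^ n) * (z - w)" by (simp add: algebra_simps)
    finally have "cmod (of_nat n * (s z - s w) * ((1 - z) * (1 - w))) = cmod ((w ^ n - z ^ n) * (1 - w) + (1 - w ^ n) * (z - w))"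
      by simp
    also have "\<dots> \<le> cmod (w ^ n - z ^ n) * cmod (1 - w) + cmod (1 - w ^ n) * cmod (z - w)"
      by (metis norm_mult norm_triangle_ineq)
    also have "\<dots> \<le> (real n * cmod (w - z)) * cmod (1 - w) + (real n * cmod (1 - w)) * cmod (z - w)"
      using z w by (intro add_mono mult_right_mono pw norm_power_diff) auto
    also have "\<dots> = real n * (2 * cmod (z - w) * cmod (1 - w))"
      by (simp add: norm_minus_commute algebra_simps)
    finally have "real n * (cmod (s z - s w) * cmod (1 - z) * cmod (1 - w)) \<le> real n * (2 * cmod (z - w) * cmod (1 - w))"
      by (simp add: norm_mult mult_ac)
    hence "cmod (s z - s w) * cmod (1 - z) \<le> 2 * cmod (z - w)" using n zw by simp
    thus ?thesis using zw by (simp add: field_simps)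
  qed
  \<comment> \<open>Both 1/(1 - z) and z/(1 - z) have the divided difference 1/((1 - z)(1 - w)), so
    freezing s at z collects these two terms in the factor 1 - s(z).\<close>
  have "gker n z - gker n w = (1 - s z) * ((z - w) / ((1 - z) * (1 - w))) - (s z - s w) * (w / (1 - w))"
    unfolding g[OF z(2)] g[OF w(2)] using zw by (simp add: divide_simps) (simp add: algebra_simps)
  hence "cmod (gker n z - gker n w) \<le> cmod (1 - s z) * ?R + cmod (s z - s w) * (1 / cmod (1 - w))"
    using norm_triangle_ineq4[of "(1 - s z) * ((z - w) / ((1 - z) * (1 - w)))" "(s z - s w) * (w / (1 - w))"] w
    by (simp add: norm_mult norm_divide)
  also have "\<dots> \<le> 2 * ?R + 2 * cmod (z - w) / cmod (1 - z) * (1 / cmod (1 - w))"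
  proof (intro add_mono mult_right_mono sdiff)
    show "cmod (1 - s z) \<le> 2" using norm_triangle_ineq4[of 1 "s z"] s1[OF z(1)] by simp
  qed auto
  finally show ?thesis by (simp add: mult.commute)
qed

lemma norm_gker_le:
  assumes "cmod z = 1"
  shows "cmod (gker n z) \<le> real n"
proof -
  have "cmod (gker n z) \<le> (\<Sum>l\<in>{0<..<n}. 1)"
    unfolding gker_def by (intro sum_norm_le) (auto simp: norm_mult norm_power assms field_simps simp del: of_real_diff of_real_divide)
  thus ?thesis by simp
qed

lemma Tpos_kernel:
  assumes h: "integrable circ h"
  shows "Tpos n h x = 1 / (2 * pi) * (LINT t|circ. h t * (cis (real n * (x - t)) * gker n (cis (x - t))))"
proof -
  have ker: "(\<Sum>k\<in>{n<..<2 * n}. of_real ((2 * real n - real k) / real n) * cis (of_int (int k) * u)) 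
     = cis (real n * u) * gker n (cis u)" for u
  proof -
    have "{n<..<2*n} = (\<lambda>l. n + l) ` {0<..<n}" 
    proof
      show "{n<..<2*n} \<subseteq> (\<lambda>l. n + l) ` {0<..<n}"
      proof
        fix k assume "k \<in> {n<..<2*n}" thus "k \<in> (\<lambda>l. n + l) ` {0<..<n}" by (intro image_eqI[of _ _ "k - n"]) auto
      qed
    qed auto
    hence "(\<Sum>k\<in>{n<..<2 * n}. of_real ((2 * real n - real k) / real n) * cis (of_int (int k) * u))
      = (\<Sum>l\<in>{0<..<n}. of_real ((2 * real n - real (n + l)) / real n) * cis (real (n + l) * u))"
      by (simp add: sum.reindex)
    also have "\<dots> = (\<Sum>l\<in>{0<..<n}. cis (real n * u) * (of_real (1 - real l / real n) * cis u ^ l))"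
    proof (intro sum.cong refl)
      fix l assume "l \<in> {0<..<n}"
      hence "(2 * real n - real (n + l)) / real n = 1 - real l / real n" by (simp add: field_simps)
      moreover have "cis (real (n + l) * u) = cis (real n * u) * cis u ^ l"
        using Complex.DeMoivre[of u l] by (simp only: cis_mult distrib_right of_nat_add)
      ultimately show "of_real ((2 * real n - real (n + l)) / real n) * cis (real (n + l) * u) 
        = cis (real n * u) * (of_real (1 - real l / real n) * cis u ^ l)" by (simp only: mult_ac)
    qed
    finally show ?thesis unfolding gker_def by (simp add: sum_distrib_left)
  qed
  show ?thesis
    unfolding Tpos_def by (subst multiplier_integral[OF h]) (simp_all only: ker finite_greaterThanLessThan)
qed

lemma gker_measurable [measurable]: "(\<lambda>t. gker n (cis (x - t))) \<in> borel_measurable borel"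
  unfolding gker_def by measurable

lemma Tpos_near:
  assumes h: "integrable circ h"
  shows "cmod (Tpos n h x) \<le> real n * (LINT t|circ. cmod (h t))"
proof -
  have b: "cmod (cis (real n * (x - t)) * gker n (cis (x - t))) \<le> real n" for t
    by (simp add: norm_mult norm_gker_le)
  have "cmod (Tpos n h x) = 1 / (2 * pi) * cmod (LINT t|circ. h t * (cis (real n * (x - t)) * gker n (cis (x - t))))"
    unfolding Tpos_kernel[OF h] by (simp add: norm_mult norm_divide)
  also have "\<dots> \<le> 1 / (2 * pi) * (LINT t|circ. cmod (h t * (cis (real n * (x - t)) * gker n (cis (x - t)))))"
    by (intro mult_left_mono integral_norm_bound) simp
  also have "\<dots> \<le> 1 * (LINT t|circ. real n * cmod (h t))"
  proof (rule mult_mono)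
    show "1 / (2 * pi) \<le> 1" using pi_approx by simp
    show "(LINT t|circ. cmod (h t * (cis (real n * (x - t)) * gker n (cis (x - t))))) \<le> (LINT t|circ. real n * cmod (h t))"
      using h b by (intro integral_mono') (auto simp: norm_mult mult.commute[of "cmod (h _)"] mult_right_mono norm_gker_le)
  qed auto
  finally show ?thesis by simp
qed

text \<open>The modulation factors as e^{inx} e^{-int}, so by the cancellation the value of
  \<open>gker\<close> at the centre c may be subtracted exactly. The point x is at least twice as
  far from c as the support, hence rho x t \<ge> (rho x c)/2, and the Lipschitz bound gives
  8a/rho^2; the normalisation 1/(2 pi) brings this below 2a/rho^2.\<close>

lemma Tpos_far:
  assumes h: "integrable circ h" and n: "n > 0"
    and cancel: "(LINT t|circ. h t * cis (- real n * t)) = 0"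
    and supp: "\<And>t. h t \<noteq> 0 \<Longrightarrow> rho t c \<le> a"
    and x: "rho x c \<ge> 2 * a" "a > 0"
  shows "cmod (Tpos n h x) \<le> 2 * a / (rho x c)\<^sup>2 * (LINT t|circ. cmod (h t))"
proof -
  let ?D = "\<lambda>t. cis (real n * (x - t)) * (gker n (cis (x - t)) - gker n (cis (x - c)))"
  have int1: "integrable circ (\<lambda>t. h t * (cis (real n * (x - t)) * gker n (cis (x - t))))"
    by (rule integrable_circ_mult[OF h, of _ "real n"]) (auto intro!: measurable_circ simp: norm_mult norm_gker_le)
  have int2: "integrable circ (\<lambda>t. h t * cis (- real n * t) * (cis (real n * x) * gker n (cis (x - c))))"
    by (intro integrable_mult_left integrable_circ_cis h)
  have eq: "h t * ?D t = h t * (cis (real n * (x - t)) * gker n (cis (x - t))) 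
     - h t * cis (- real n * t) * (cis (real n * x) * gker n (cis (x - c)))" for t
  proof -
    have "cis (real n * (x - t)) = cis (real n * x) * cis (- real n * t)"
      by (simp add: cis_mult algebra_simps)
    thus ?thesis by (simp add: algebra_simps)
  qed
  have "(LINT t|circ. h t * ?D t) = (LINT t|circ. h t * (cis (real n * (x - t)) * gker n (cis (x - t))))"
    unfolding eq by (subst Bochner_Integration.integral_diff[OF int1 int2]) (subst integral_mult_left_zero, simp only: cancel mult_zero_left diff_zero)
  hence "cmod (Tpos n h x) = 1 / (2 * pi) * cmod (LINT t|circ. h t * ?D t)"
    unfolding Tpos_kernel[OF h] by (simp add: norm_mult norm_divide)
  also have "\<dots> \<le> 1 / (2 * pi) * (LINT t|circ. cmod (h t * ?D t))"
    by (intro mult_left_mono integral_norm_bound) simp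
  also have "\<dots> \<le> 1 / (2 * pi) * (LINT t|circ. 8 * a / (rho x c)\<^sup>2 * cmod (h t))"
  proof (intro mult_left_mono integral_mono')
    fix t
    show "cmod (h t * ?D t) \<le> 8 * a / (rho x c)\<^sup>2 * cmod (h t)"
    proof (cases "h t = 0")
      case False
      hence tc: "rho t c \<le> a" by (rule supp)
      have xc: "rho x c > 0" using x by linarith
      have xt: "rho x t \<ge> rho x c / 2" using rho_triangle[of x c t] tc x by linarith
      have r: "cmod (1 - cis (x - t)) = rho x t" for t
        using rho_diff[of x t] by (simp add: norm_minus_commute)
      have "cmod (?D t) = cmod (gker n (cis (x - t)) - gker n (cis (x - c)))" by (simp add: norm_mult)
      also have "\<dots> \<le> 4 * cmod (cis (x - t) - cis (x - c)) / (cmod (1 - cis (x - t)) * cmod (1 - cis (x - c)))"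
      proof (rule gker_diff[OF n])
        show "cis (x - t) \<noteq> 1" "cis (x - c) \<noteq> 1" using r[of t] r[of c] xt xc by auto
      qed auto
      also have "cmod (cis (x - t) - cis (x - c)) = rho t c"
      proof -
        have "cis (x - t) - cis (x - c) = cis x * cnj (cis t - cis c)"
          by (simp add: cis_cnj cis_mult right_diff_distrib)
        thus ?thesis unfolding rho_def by (simp only: norm_mult norm_cis complex_mod_cnj mult_1_left)
      qed
      also have "4 * rho t c / (cmod (1 - cis (x - t)) * cmod (1 - cis (x - c))) \<le> 4 * a / (rho x c / 2 * rho x c)"
        unfolding r using tc xc xt x by (intro frac_le mult_mono mult_pos_pos) auto
      also have "\<dots> = 8 * a / (rho x c)\<^sup>2" by (simp add: power2_eq_square)
      finally have "cmod (h t) * cmod (?D t) \<le> cmod (h t) * (8 * a / (rho x c)\<^sup>2)"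
        by (intro mult_left_mono) auto
      thus ?thesis by (simp only: norm_mult[of "h t" "?D t"] mult.commute)
    qed simp
  qed (use h x in auto)
  also have "\<dots> = 4 / pi * (a / (rho x c)\<^sup>2 * (LINT t|circ. cmod (h t)))"
    by simp
  also have "\<dots> \<le> 2 * (a / (rho x c)\<^sup>2 * (LINT t|circ. cmod (h t)))"
    using pi_approx x by (intro mult_right_mono mult_nonneg_nonneg) (auto simp: field_simps)
  finally show ?thesis by simp
qed

section \<open>Stopping intervals\<close>

definition dint :: "nat \<Rightarrow> nat \<Rightarrow> real set" where
  "dint m k = {- pi + 2 * pi * real k / 2 ^ m ..< - pi + 2 * pi * (real k + 1) / 2 ^ m}"

text \<open>The index of the interval of level m that contains x. It turns the dyadic tree into
  integer arithmetic: passing to a coarser level is integer division by a power of 2, which yields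
  nestedness without comparing endpoints.\<close>

definition lev :: "nat \<Rightarrow> real \<Rightarrow> int" where
  "lev m x = \<lfloor>2 ^ m * ((x + pi) / (2 * pi))\<rfloor>"

lemma dyadic_level_eq: "dyadic_level m = dint m ` {..<2 ^ m}"
  unfolding dyadic_level_def dint_def by auto

lemma dint_mem: "x \<in> dint m k \<longleftrightarrow> lev m x = int k"
proof -
  have "x \<in> dint m k \<longleftrightarrow> real k \<le> 2 ^ m * ((x + pi) / (2 * pi)) \<and> 2 ^ m * ((x + pi) / (2 * pi)) < real k + 1"
    unfolding dint_def by (auto simp: field_simps)
  thus ?thesis unfolding lev_def by (simp add: floor_eq_iff)
qed

lemma lev_range: "x \<in> circle \<Longrightarrow> 0 \<le> lev m x \<and> lev m x < 2 ^ m"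
proof -
  assume x: "x \<in> circle"
  have "0 \<le> (x + pi) / (2 * pi)" "(x + pi) / (2 * pi) < 1"
    using x by (auto simp: circle_def field_simps)
  hence "0 \<le> 2 ^ m * ((x + pi) / (2 * pi))" "2 ^ m * ((x + pi) / (2 * pi)) < 2 ^ m * 1"
    by (auto simp only: mult_less_cancel_left_pos zero_less_power zero_less_numeral zero_le_mult_iff zero_le_power zero_le_numeral)
  thus ?thesis unfolding lev_def by (simp add: floor_less_iff)
qed

lemma lev_coarse: "m \<le> n \<Longrightarrow> lev m x = lev n x div 2 ^ (n - m)"
proof -
  assume "m \<le> n"
  hence "(2::real) ^ n = 2 ^ m * 2 ^ (n - m)" by (simp flip: power_add)
  hence "2 ^ m * ((x + pi) / (2 * pi)) = 2 ^ n * ((x + pi) / (2 * pi)) / real_of_int (2 ^ (n - m))"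
    by simp
  thus ?thesis unfolding lev_def by (simp only: floor_divide_real_eq_div zero_le_power zero_le_numeral)
qed

lemma dint_len: "len (dint m k) = 2 * pi / 2 ^ m"
proof -
  have "2 * pi * real k / 2 ^ m \<le> 2 * pi * (real k + 1) / 2 ^ m"
    by (intro divide_right_mono) auto
  thus ?thesis unfolding dint_def
    by (simp add: add_divide_distrib distrib_left)
qed

lemma dint_borel [measurable, simp]: "dint m k \<in> sets borel"
  unfolding dint_def by simp

lemma dint_sub: "k < 2 ^ m \<Longrightarrow> dint m k \<subseteq> circle"
proof
  fix x assume k: "k < 2 ^ m" and x: "x \<in> dint m k"
  have "real k + 1 \<le> 2 ^ m" using k by (metis Suc_eq_plus1 Suc_leI of_nat_1 of_nat_add of_nat_le_iff of_nat_numeral of_nat_power)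
  hence "2 * pi * (real k + 1) \<le> 2 * pi * 2 ^ m" by (intro mult_left_mono) auto
  hence "2 * pi * (real k + 1) / 2 ^ m \<le> 2 * pi" by (simp add: field_simps)
  moreover have "0 \<le> 2 * pi * real k / 2 ^ m" by simp
  ultimately show "x \<in> circle"
    using x unfolding dint_def circle_def atLeastLessThan_iff by linarith
qed

lemma dyadicE:
  assumes "I \<in> dyadic"
  obtains m k where "I = dint m k" "k < 2 ^ m"
  using assms unfolding dyadic_def dyadic_level_eq by auto

lemma dyadic_facts:
  assumes "I \<in> dyadic"
  shows "I \<subseteq> circle" "I \<in> sets borel" "I \<in> sets circ" "len I > 0" "I \<in> sets lebesgue"
proof -
  obtain m k where I: "I = dint m k" "k < 2 ^ m" using assms by (rule dyadicE)
  show a: "I \<subseteq> circle" "I \<in> sets borel" using dint_sub[OF I(2)] I(1) by auto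
  show "I \<in> sets circ" by (intro sets_circ a)
  show "len I > 0" by (simp add: I(1) dint_len)
  show "I \<in> sets lebesgue" using a by simp
qed

lemma dyadic_nested:
  assumes "I \<in> dyadic_level m" "J \<in> dyadic_level n" "m \<le> n" "I \<inter> J \<noteq> {}"
  shows "J \<subseteq> I"
proof -
  obtain k l where kl: "I = dint m k" "J = dint n l" using assms unfolding dyadic_level_eq by auto
  obtain x where x: "x \<in> I" "x \<in> J" using assms by auto
  show ?thesis
  proof
    fix y assume "y \<in> J"
    hence "lev n y = lev n x" using x kl by (simp add: dint_mem)
    hence "lev m y = lev m x" using lev_coarse[OF assms(3)] by simp
    thus "y \<in> I" using x kl by (simp add: dint_mem)
  qed
qed

lemma dyadic_nested':
  assumes "I \<in> dyadic" "J \<in> dyadic" "I \<inter> J \<noteq> {}"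
  shows "J \<subseteq> I \<or> I \<subseteq> J"
proof -
  obtain m n where mn: "I \<in> dyadic_level m" "J \<in> dyadic_level n" using assms unfolding dyadic_def by auto
  show ?thesis
    using dyadic_nested[OF mn] dyadic_nested[OF mn(2,1)] assms(3) by (metis inf_commute nle_le)
qed

lemma dyadic_level_len: "I \<in> dyadic_level m \<Longrightarrow> len I = 2 * pi / 2 ^ m"
  unfolding dyadic_level_eq by (auto simp: dint_len)

lemma dyadic_level_finite: "finite (dyadic_level m)"
  unfolding dyadic_level_eq by simp

lemma dyadic_level_cover: "x \<in> circle \<Longrightarrow> \<exists>I\<in>dyadic_level m. x \<in> I"
proof -
  assume "x \<in> circle"
  from lev_range[OF this, of m] have "x \<in> dint m (nat (lev m x))" "nat (lev m x) < 2 ^ m"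
    by (auto simp: dint_mem nat_less_iff)
  thus ?thesis unfolding dyadic_level_eq by auto
qed

lemma dyadic_level_sub: "dyadic_level m \<subseteq> dyadic"
  unfolding dyadic_def by auto

lemma dyadic_level_disjoint: "disjoint (dyadic_level m)"
proof (rule disjointI)
  fix a b assume ab: "a \<in> dyadic_level m" "b \<in> dyadic_level m" "a \<noteq> b"
  thus "a \<inter> b = {}" using dyadic_nested[OF ab(1,2)] dyadic_nested[OF ab(2,1)] by auto
qed

definition mass :: "(real \<Rightarrow> complex) \<Rightarrow> real set \<Rightarrow> real" where
  "mass f I = (LINT x|circ. indicator I x * cmod (f x))"

lemma indicator_circ_measurable [measurable]: "A \<in> sets circ \<Longrightarrow> indicator A \<in> borel_measurable circ"
  by (rule borel_measurable_indicator)

lemma mass_integrable: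
  assumes "integrable circ f" "A \<in> sets circ"
  shows "integrable circ (\<lambda>x. indicator A x * cmod (f x))"
  using integrable_circ_mult_real[OF integrable_norm[OF assms(1)], of "indicator A" 1] assms(2)
  by (simp add: mult.commute indicator_def)

lemma average_eq: "I \<subseteq> circle \<Longrightarrow> average f I = mass f I / len I"
  unfolding average_def mass_def by (simp add: set_integral_sub_circ)

lemma mass_mono:
  assumes "integrable circ f" "A \<in> sets circ" "B \<in> sets circ" "A \<subseteq> B"
  shows "mass f A \<le> mass f B"
  unfolding mass_def using assms
  by (intro integral_mono mass_integrable) (auto simp: indicator_def)

lemma norm_L1_eq: "norm_L1 f = (LINT x|circ. norm (f x))"
  for f :: "real \<Rightarrow> complex"
  unfolding norm_L1_def by (rule set_integral_circ)

lemma mass_circle: "mass f circle = norm_L1 f"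
  unfolding mass_def norm_L1_eq by (intro Bochner_Integration.integral_cong) auto

lemma sum_indicator_disjoint:
  assumes "finite F" "disjoint F"
  shows "(\<Sum>I\<in>F. indicator I x) = (indicator (\<Union>F) x :: real)"
proof -
  have "indicator (\<Union>I\<in>F. I) x = (\<Sum>I\<in>F. indicator I x :: real)"
    using assms by (intro indicator_UN_disjoint) (auto simp: disjoint_family_on_def disjoint_def)
  thus ?thesis by simp
qed

lemma mass_UN:
  assumes "integrable circ f" "finite F" "disjoint F" "F \<subseteq> sets circ"
  shows "mass f (\<Union>F) = (\<Sum>I\<in>F. mass f I)"
proof -
  have "mass f (\<Union>F) = (LINT x|circ. (\<Sum>I\<in>F. indicator I x * cmod (f x)))"
    unfolding mass_def sum_distrib_right[symmetric] sum_indicator_disjoint[OF assms(2,3)] ..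
  also have "\<dots> = (\<Sum>I\<in>F. mass f I)"
    unfolding mass_def using assms by (subst Bochner_Integration.integral_sum) (auto intro!: mass_integrable)
  finally show ?thesis .
qed

lemma mass_nonneg: "0 \<le> mass f A"
  unfolding mass_def by (intro Bochner_Integration.integral_nonneg) auto

lemma mass_le_norm:
  assumes "integrable circ f" "A \<in> sets circ"
  shows "mass f A \<le> norm_L1 f"
  using mass_mono[OF assms(1,2), of circle] assms sets.sets_into_space[OF assms(2)] sets.top[of circ]
  by (simp add: mass_circle)

lemma norm_L1_nonneg: "0 \<le> norm_L1 f" for f :: "real \<Rightarrow> complex"
  using mass_nonneg[of f circle] by (simp add: mass_circle)

section \<open>Disjointness, height and length of stopping intervals\<close>

lemma stopping_dyadic: "I \<in> stopping f lam \<Longrightarrow> I \<in> dyadic"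
  unfolding stopping_def by auto

lemma stopping_disjoint: "disjoint (stopping f lam)"
proof (rule disjointI)
  fix I J assume IJ: "I \<in> stopping f lam" "J \<in> stopping f lam" "I \<noteq> J"
  show "I \<inter> J = {}"
  proof (rule ccontr)
    assume "I \<inter> J \<noteq> {}"
    from dyadic_nested'[OF stopping_dyadic[OF IJ(1)] stopping_dyadic[OF IJ(2)] this] IJ(3)
    have "I \<subset> J \<or> J \<subset> I" by auto
    thus False using IJ unfolding stopping_def by force
  qed
qed

lemma stopping_lower:
  assumes "I \<in> stopping f lam"
  shows "lam * len I < mass f I"
proof -
  note d = dyadic_facts[OF stopping_dyadic[OF assms]]
  have "average f I > lam" using assms unfolding stopping_def by auto
  thus ?thesis using d by (simp add: average_eq field_simps)
qed

text \<open>The dyadic parent is twice as long and, by maximality, has average at most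
  \<open>lam\<close>. A parent exists because the whole circle is never a stopping interval: its
  average is below \<open>lam\<close> by assumption.\<close>

lemma stopping_upper:
  assumes f: "integrable circ f" and lam: "lam > norm_L1 f / (2 * pi)" and I: "I \<in> stopping f lam"
  shows "mass f I \<le> 2 * lam * len I"
proof -
  obtain m where m: "I \<in> dyadic_level m" using stopping_dyadic[OF I] unfolding dyadic_def by auto
  have lower: "lam * len I < mass f I" by (rule stopping_lower[OF I])
  have "m \<noteq> 0"
  proof
    assume "m = 0"
    hence "I = circle" "len I = 2 * pi" using m dyadic_level_len[OF m] by (auto simp: dyadic_level_def circle_def)
    thus False using lower lam by (simp add: mass_circle field_simps)
  qed
  then obtain n where n: "m = Suc n" by (cases m) auto
  obtain x where x: "x \<in> I" using dyadic_facts(4)[OF stopping_dyadic[OF I]] by fastforce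
  then obtain J where J: "J \<in> dyadic_level n" "x \<in> J"
    using dyadic_level_cover dyadic_facts(1)[OF stopping_dyadic[OF I]] by blast
  have IJ: "I \<subseteq> J" using dyadic_nested[OF J(1) m] x J n by auto
  have lenJ: "len J = 2 * len I" using dyadic_level_len[OF J(1)] dyadic_level_len[OF m] n by simp
  hence "I \<noteq> J" using dyadic_facts(4)[OF stopping_dyadic[OF I]] by auto
  hence "average f J \<le> lam" using I J IJ dyadic_level_sub unfolding stopping_def by blast
  moreover have Jd: "J \<in> dyadic" using J dyadic_level_sub by auto
  ultimately have "mass f J \<le> lam * len J"
    using dyadic_facts[OF Jd] by (simp add: average_eq field_simps)
  moreover have "mass f I \<le> mass f J"
    using IJ dyadic_facts(3)[OF Jd] dyadic_facts(3)[OF stopping_dyadic[OF I]] f by (intro mass_mono) auto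
  ultimately show ?thesis unfolding lenJ by simp
qed

lemma dyadic_len_mono:
  assumes "I \<in> dyadic" "J \<in> dyadic" "I \<subseteq> J"
  shows "len I \<le> len J"
proof -
  obtain m k where "J = dint m k" using assms(2) by (rule dyadicE)
  hence "J \<in> lmeasurable" by (auto intro!: bounded_set_imp_lmeasurable simp: dint_def)
  thus ?thesis using assms dyadic_facts(5) by (intro measure_mono_fmeasurable) auto
qed

text \<open>Among the dyadic intervals that contain J and have average above \<open>lam\<close>, one
  of least level is maximal, for anything larger with such an average would sit at a smaller
  level.\<close>

lemma exists_stopping:
  assumes J: "J \<in> dyadic" and av: "average f J > lam"
  shows "\<exists>I\<in>stopping f lam. J \<subseteq> I"
proof -
  obtain n where n: "J \<in> dyadic_level n" using J unfolding dyadic_def by auto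
  let ?P = "\<lambda>m. \<exists>I\<in>dyadic_level m. J \<subseteq> I \<and> average f I > lam"
  have "?P n" using n av by auto
  define m where "m = (LEAST m. ?P m)"
  have Pm: "?P m" unfolding m_def by (rule LeastI[of ?P], fact)
  then obtain I where I: "I \<in> dyadic_level m" "J \<subseteq> I" "average f I > lam" by auto
  have Jne: "J \<noteq> {}" using dyadic_facts(4)[OF J] by auto
  have "average f K \<le> lam" if K: "K \<in> dyadic" "I \<subset> K" for K
  proof (rule ccontr)
    assume "\<not> average f K \<le> lam"
    obtain l where l: "K \<in> dyadic_level l" using K unfolding dyadic_def by auto
    with \<open>\<not> average f K \<le> lam\<close> K I have "?P l" by force
    hence "m \<le> l" unfolding m_def by (rule Least_le)
    hence "K \<subseteq> I" using dyadic_nested[OF I(1) l] K I Jne by auto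
    thus False using K by auto
  qed
  hence "I \<in> stopping f lam" using I subsetD[OF dyadic_level_sub[of m] I(1)] unfolding stopping_def by auto
  thus ?thesis using I by auto
qed

text \<open>The threshold will be both \<beta>_j and 1/n_j. A positive threshold leaves only
  finitely many intervals, so that all decompositions of f are finite sums.\<close>

definition large_stopping :: "(real \<Rightarrow> complex) \<Rightarrow> real \<Rightarrow> real \<Rightarrow> real set set" where
  "large_stopping f lam r = {I \<in> stopping f lam. len I > r}"

lemma large_stopping_finite:
  assumes "r > 0"
  shows "finite (large_stopping f lam r)"
proof -
  obtain n where n: "2 * pi / r < 2 ^ n"
    using real_arch_pow[of 2] by auto
  have "large_stopping f lam r \<subseteq> (\<Union>m<n. dyadic_level m)"
  proof
    fix I assume I: "I \<in> large_stopping f lam r"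
    then obtain m where m: "I \<in> dyadic_level m" "len I > r"
      using stopping_dyadic unfolding large_stopping_def dyadic_def by blast
    hence "2 * pi / 2 ^ m > r" using dyadic_level_len[OF m(1)] by simp
    hence "2 ^ m < 2 * pi / r" using assms by (simp add: field_simps)
    hence "(2::real) ^ m < 2 ^ n" using n by (rule order_less_trans)
    hence "m < n" by (simp only: power_strict_increasing_iff one_less_numeral_iff semiring_norm(76))
    thus "I \<in> (\<Union>m<n. dyadic_level m)" using m by auto
  qed
  thus ?thesis by (rule finite_subset) (auto simp: dyadic_level_finite)
qed

lemma large_stopping_facts: 
  assumes "I \<in> large_stopping f lam r"
  shows "I \<in> stopping f lam" "I \<in> dyadic" "len I > r" "I \<in> sets circ"
  using assms stopping_dyadic dyadic_facts(3) unfolding large_stopping_def by blast+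

lemma large_stopping_disjoint: "disjoint (large_stopping f lam r)"
  using stopping_disjoint[of f lam] unfolding large_stopping_def disjoint_def by auto

lemma large_stopping_sets: "r > 0 \<Longrightarrow> \<Union>(large_stopping f lam r) \<in> sets circ"
  using large_stopping_finite large_stopping_facts(4) by (intro sets.finite_Union) auto

text \<open>The weak-type (1,1) estimate of the dyadic maximal function: each interval has mass
  above \<open>lam\<close> times its length, and masses of disjoint intervals add up.\<close>

lemma large_stopping_sum_len:
  assumes f: "integrable circ f" and r: "r > 0"
  shows "lam * (\<Sum>I\<in>large_stopping f lam r. len I) \<le> norm_L1 f"
proof -
  have "lam * (\<Sum>I\<in>large_stopping f lam r. len I) \<le> (\<Sum>I\<in>large_stopping f lam r. mass f I)"
    unfolding sum_distrib_left by (intro sum_mono less_imp_le stopping_lower large_stopping_facts(1))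
  also have "\<dots> = mass f (\<Union>(large_stopping f lam r))"
    by (rule mass_UN[OF f large_stopping_finite[OF r] large_stopping_disjoint, symmetric]) (use large_stopping_facts(4) in blast)
  also have "\<dots> \<le> norm_L1 f" by (rule mass_le_norm[OF f large_stopping_sets[OF r]])
  finally show ?thesis .
qed

text \<open>If the average over J exceeds \<open>lam\<close>, then J lies in a stopping interval at
  least as long as J, hence longer than r, and nothing of J is left. Otherwise J already satisfies
  the bound.\<close>

lemma small_average:
  assumes f: "integrable circ f" and J: "J \<in> dyadic" "len J > r" and r: "r > 0" and lam: "lam \<ge> 0"
  shows "mass f (J - \<Union>(large_stopping f lam r)) \<le> lam * len J"
proof (cases "average f J > lam")
  case True
  then obtain I where I: "I \<in> stopping f lam" "J \<subseteq> I" using exists_stopping J by blast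
  hence "I \<in> large_stopping f lam r"
    using dyadic_len_mono[OF J(1) stopping_dyadic] J unfolding large_stopping_def by fastforce
  hence *: "J - \<Union>(large_stopping f lam r) = {}" using I by auto
  show ?thesis unfolding * using lam by (simp add: mass_def)
next
  case False
  note d = dyadic_facts[OF J(1)]
  have "mass f (J - \<Union>(large_stopping f lam r)) \<le> mass f J"
    using d large_stopping_sets[OF r, of f lam] by (intro mass_mono f sets.Diff) auto
  also have "\<dots> \<le> lam * len J" using False d by (simp add: average_eq field_simps)
  finally show ?thesis .
qed

section \<open>From dyadic averages to Fejer means\<close>

lemma poisson_comparable:
  fixes d p q :: real
  assumes "d > 0" "0 \<le> p" "0 \<le> q" "\<bar>p - q\<bar> \<le> d"
  shows "1 / (d\<^sup>2 + p\<^sup>2) \<le> 3 * (1 / (d\<^sup>2 + q\<^sup>2))"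
proof -
  have "q\<^sup>2 \<le> (p + d)\<^sup>2" using assms by (intro power_mono) auto
  also have "\<dots> \<le> 2 * p\<^sup>2 + 2 * d\<^sup>2"
    using sum_squares_bound[of p d] by (simp add: power2_eq_square algebra_simps)
  finally have "d\<^sup>2 + q\<^sup>2 \<le> 3 * (d\<^sup>2 + p\<^sup>2)" using zero_le_power2[of p] unfolding distrib_left by linarith
  moreover have "d\<^sup>2 + q\<^sup>2 > 0" "d\<^sup>2 + p\<^sup>2 > 0" using assms by (auto intro!: add_pos_nonneg)
  ultimately show ?thesis by (simp add: field_simps)
qed

lemma rho_diff_le: "\<bar>rho x s - rho x t\<bar> \<le> rho s t"
  using rho_triangle[of x s t] rho_triangle[of x t s] rho_commute[of s t] by linarith

lemma dint_rho: "s \<in> dint m k \<Longrightarrow> t \<in> dint m k \<Longrightarrow> rho s t \<le> 2 * pi / 2 ^ m"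
  using rho_le[of s t] unfolding dint_def by (auto simp: add_divide_distrib distrib_left)

lemma dyadic_rho: 
  assumes "I \<in> dyadic" "s \<in> I" "t \<in> I"
  shows "rho s t \<le> len I"
  using assms by (auto elim!: dyadicE simp: dint_len dint_rho)

text \<open>A bump of width d changes by at most a factor 3 under a move of size d. So its value at
  one point, times the length of I, is controlled by its integral over I, and sums over disjoint
  intervals turn into one integral.\<close>

lemma poisson_dyadic:
  assumes I: "I \<in> dyadic" and d: "len I \<le> d" and c: "c \<in> I"
  shows "len I * (1 / (d\<^sup>2 + (rho x c)\<^sup>2)) \<le> 3 * (LINT t|circ. indicator I t * (1 / (d\<^sup>2 + (rho x t)\<^sup>2)))"
proof -
  note D = dyadic_facts[OF I]
  have d0: "d > 0" using d D by simp
  have lenI: "measure circ I = len I"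
    unfolding circ_def using D by (simp add: measure_restrict_space)
  have "len I * (1 / (d\<^sup>2 + (rho x c)\<^sup>2)) = (LINT t|circ. indicator I t * (1 / (d\<^sup>2 + (rho x c)\<^sup>2)))"
    using D(1,3) lenI by (simp add: Int_absorb2)
  also have "\<dots> \<le> (LINT t|circ. 3 * (indicator I t * (1 / (d\<^sup>2 + (rho x t)\<^sup>2))))"
  proof (rule integral_mono)
    show "integrable circ (\<lambda>t. 3 * (indicator I t * (1 / (d\<^sup>2 + (rho x t)\<^sup>2))))"
      using integrable_circ_mult_real[OF poisson_integrable[OF d0, of x], of "indicator I" 1] D(3)
      by (intro integrable_mult_right) (auto simp: mult.commute indicator_def)
    show "indicator I t * (1 / (d\<^sup>2 + (rho x c)\<^sup>2)) \<le> 3 * (indicator I t * (1 / (d\<^sup>2 + (rho x t)\<^sup>2)))" for t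
    proof (cases "t \<in> I")
      case True
      have "\<bar>rho x c - rho x t\<bar> \<le> d"
        using rho_diff_le[of x c t] dyadic_rho[OF I c True] d by linarith
      from poisson_comparable[OF d0 _ _ this] True show ?thesis by simp
    qed simp
    show "integrable circ (\<lambda>t. indicator I t * (1 / (d\<^sup>2 + (rho x c)\<^sup>2)))"
      using D(3) by (intro integrable_mult_left circ.integrable_const_bound[of _ 1]) auto
  qed
  also have "\<dots> = 3 * (LINT t|circ. indicator I t * (1 / (d\<^sup>2 + (rho x t)\<^sup>2)))"
    by (rule integral_mult_right_zero)
  finally show ?thesis .
qed

text \<open>Widened to d, the Fejer majorant is nearly constant on intervals of length d and sees h
  only through its averages there. The constant is 5 * 9 * 16/(2 pi) = 360/pi < 120: height,
  comparison on J used twice, integral of the bump.\<close>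

lemma fejer_mean_dyadic_bound:
  assumes h: "integrable circ h" and d: "d = 2 * pi / 2 ^ k" and Md: "(real m + 1) * d \<ge> 1"
    and A: "\<And>J. J \<in> dyadic_level k \<Longrightarrow> mass h J \<le> A * d" and x: "x \<in> circle" and A0: "A \<ge> 0"
  shows "cmod (fejer_mean m h x) \<le> 120 * A * (real m + 1) * d"
proof -
  let ?M = "real m + 1" and ?p = "\<lambda>t. 1 / (d\<^sup>2 + (rho x t)\<^sup>2)" and ?L = "dyadic_level k"
  have d0: "d > 0" using d by simp
  have pint: "integrable circ (\<lambda>t. g t * ?p t)" if "integrable circ g" for g :: "real \<Rightarrow> real"
    using d0 by (intro integrable_circ_mult_real[OF that, of _ "1 / d\<^sup>2"]) 
      (auto intro!: measurable_circ frac_le)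
  have split: "(LINT t|circ. g t * ?p t) = (\<Sum>J\<in>?L. LINT t|circ. indicator J t * (g t * ?p t))"
    if g: "integrable circ g" for g :: "real \<Rightarrow> real"
  proof -
    have "(\<Sum>J\<in>?L. indicator J t) = (1::real)" if "t \<in> circle" for t
    proof -
      have "(\<Sum>J\<in>?L. indicator J t) = (indicator (\<Union>?L) t :: real)"
        by (rule sum_indicator_disjoint[OF dyadic_level_finite dyadic_level_disjoint])
      thus ?thesis using dyadic_level_cover[OF that, of k] by (auto simp: indicator_def)
    qed
    hence "(LINT t|circ. g t * ?p t) = (LINT t|circ. (\<Sum>J\<in>?L. indicator J t * (g t * ?p t)))"
      unfolding sum_distrib_right[symmetric] by (intro Bochner_Integration.integral_cong refl) simp
    also have "\<dots> = (\<Sum>J\<in>?L. LINT t|circ. indicator J t * (g t * ?p t))"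
    proof (rule Bochner_Integration.integral_sum)
      fix J assume "J \<in> ?L"
      hence "J \<in> sets circ" using dyadic_level_sub dyadic_facts(3) by blast
      thus "integrable circ (\<lambda>t. indicator J t * (g t * ?p t))"
        using integrable_circ_mult_real[OF pint[OF g], of "indicator J" 1] by (simp add: mult.commute indicator_def)
    qed
    finally show ?thesis .
  qed
  have local: "(LINT t|circ. indicator J t * (cmod (h t) * ?p t)) \<le> 9 * A * (LINT t|circ. indicator J t * (1 * ?p t))"
    if J: "J \<in> ?L" for J
  proof -
    have Jd: "J \<in> dyadic" using J dyadic_level_sub by auto
    note D = dyadic_facts[OF Jd]
    have len: "len J = d" using dyadic_level_len[OF J] d by simp
    obtain c where c: "c \<in> J" using D(4) by fastforce
    have "(LINT t|circ. indicator J t * (cmod (h t) * ?p t)) \<le> (LINT t|circ. 3 * ?p c * (indicator J t * cmod (h t)))"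
    proof (rule integral_mono')
      show "integrable circ (\<lambda>t. 3 * ?p c * (indicator J t * cmod (h t)))"
        by (intro integrable_mult_right mass_integrable h D)
      show "indicator J t * (cmod (h t) * ?p t) \<le> 3 * ?p c * (indicator J t * cmod (h t))" for t
      proof (cases "t \<in> J")
        case True
        have "\<bar>rho x t - rho x c\<bar> \<le> d"
          using rho_diff_le[of x t c] dyadic_rho[OF Jd True c] len by linarith
        from mult_right_mono[OF poisson_comparable[OF d0 _ _ this], of "cmod (h t)"] True show ?thesis
          by (simp add: mult_ac)
      qed simp
      show "0 \<le> 3 * ?p c * (indicator J t * cmod (h t))" for t by simp
    qed
    also have "\<dots> = 3 * ?p c * mass h J" unfolding mass_def by (rule integral_mult_right_zero)
    also have "\<dots> \<le> 3 * ?p c * (A * d)" by (intro mult_left_mono A J) simp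
    also have "\<dots> = 3 * A * (len J * ?p c)" by (simp add: len)
    also have "\<dots> \<le> 3 * A * (3 * (LINT t|circ. indicator J t * ?p t))"
      using A0 len by (intro mult_left_mono poisson_dyadic Jd c) auto
    finally show ?thesis by simp
  qed
  have "(LINT t|circ. cmod (h t) * (5 * ?M / (1 + ?M\<^sup>2 * (rho x t)\<^sup>2)))
      \<le> (LINT t|circ. 5 * ?M * d\<^sup>2 * (cmod (h t) * ?p t))"
  proof (rule integral_mono')
    show "integrable circ (\<lambda>t. 5 * ?M * d\<^sup>2 * (cmod (h t) * ?p t))"
      using h by (intro integrable_mult_right pint) auto
    fix t
    have "cmod (h t) * (5 * ?M / (1 + ?M\<^sup>2 * (rho x t)\<^sup>2)) \<le> cmod (h t) * (5 * ?M * d\<^sup>2 * ?p t)"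
      using Md d0 by (intro mult_left_mono fejer_poisson) auto
    thus "cmod (h t) * (5 * ?M / (1 + ?M\<^sup>2 * (rho x t)\<^sup>2)) \<le> 5 * ?M * d\<^sup>2 * (cmod (h t) * ?p t)"
      by (simp only: mult_ac)
  qed auto
  also have "\<dots> = 5 * ?M * d\<^sup>2 * (LINT t|circ. cmod (h t) * ?p t)" by (rule integral_mult_right_zero)
  also have "\<dots> \<le> 5 * ?M * d\<^sup>2 * (9 * A * (16 / d))"
  proof (rule mult_left_mono)
    have "(LINT t|circ. cmod (h t) * ?p t) \<le> (\<Sum>J\<in>?L. 9 * A * (LINT t|circ. indicator J t * (1 * ?p t)))"
      unfolding split[OF integrable_norm[OF h]] by (intro sum_mono local)
    also have "\<dots> = 9 * A * (LINT t|circ. 1 * ?p t)"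
      by (subst split) (simp_all add: sum_distrib_left)
    also have "\<dots> \<le> 9 * A * (16 / d)"
      using A0 d0 x by (intro mult_left_mono) (auto intro!: poisson_integral_le)
    finally show "(LINT t|circ. cmod (h t) * ?p t) \<le> 9 * A * (16 / d)" .
  qed simp
  also have "\<dots> = 720 * (A * ?M * d)" using d0 by (simp add: power2_eq_square)
  finally have "cmod (fejer_mean m h x) \<le> 1 / (2 * pi) * (720 * (A * ?M * d))"
    by (intro order_trans[OF norm_fejer_mean_le[OF h]] mult_left_mono) auto
  also have "\<dots> = 360 / pi * (A * ?M * d)" by simp
  also have "\<dots> \<le> 120 * (A * ?M * d)"
    using A0 d0 pi_approx by (intro mult_right_mono) (auto simp: field_simps)
  finally show ?thesis by (simp add: mult_ac)
qed

section \<open>Sums of Poisson-type bumps\<close>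

lemma integrable_circ_cont:
  fixes g :: "real \<Rightarrow> 'a::euclidean_space"
  assumes "continuous_on UNIV g"
  shows "integrable circ g"
proof -
  have "compact (g ` {-pi..pi})"
    by (intro compact_continuous_image continuous_on_subset[OF assms]) auto
  then obtain B where B: "\<And>x. x \<in> {-pi..pi} \<Longrightarrow> norm (g x) \<le> B"
    by (meson bounded_iff compact_imp_bounded imageI)
  show ?thesis
    by (rule integrable_circ_bounded[of _ B])
       (use assms B in \<open>auto intro!: measurable_circ borel_measurable_continuous_onI simp: circle_def\<close>)
qed

lemma continuous_Tpos [continuous_intros]: "continuous_on A (Tpos n h)"
  unfolding Tpos_def by (intro continuous_intros)

lemma continuous_fejer_mean [continuous_intros]: "continuous_on A (fejer_mean m h)"
  unfolding fejer_mean_def partial_sum_eq by (intro continuous_intros)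

lemma continuous_rho [continuous_intros]: "continuous_on A (\<lambda>x. rho x c)"
  unfolding rho_def by (intro continuous_intros)

text \<open>Any point of I serves as well as the midpoint, since only chords of length at most |I|
  inside I enter.\<close>

definition ctr :: "real set \<Rightarrow> real" where
  "ctr I = (SOME x. x \<in> I)"

lemma ctr_mem: "I \<in> dyadic \<Longrightarrow> ctr I \<in> I"
proof -
  assume "I \<in> dyadic"
  hence "I \<noteq> {}" using dyadic_facts(4)[of I] by auto
  thus ?thesis unfolding ctr_def by (simp add: some_in_eq)
qed

lemma ctr_circle: "I \<in> dyadic \<Longrightarrow> ctr I \<in> circle"
  using ctr_mem dyadic_facts(1) by blast

text \<open>Of order 1 near I and of order |I|^2/rho^2 far away, which is exactly the shape of the
  far bound for the cancelling remainder.\<close>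

definition phi :: "real set \<Rightarrow> real \<Rightarrow> real" where
  "phi I x = (len I)\<^sup>2 * (1 / ((len I)\<^sup>2 + (rho x (ctr I))\<^sup>2))"

lemma phi_nonneg: "0 \<le> phi I x"
  unfolding phi_def by simp

lemma continuous_phi: "I \<in> dyadic \<Longrightarrow> continuous_on A (phi I)"
  unfolding phi_def using dyadic_facts(4)[of I]
  by (intro continuous_intros) (metis add_pos_nonneg less_irrefl zero_le_power2 zero_less_power)

lemma phi_integral:
  assumes "I \<in> dyadic"
  shows "(LINT x|circ. phi I x) \<le> 16 * len I"
proof -
  note D = dyadic_facts[OF assms]
  have "(LINT x|circ. phi I x) = (len I)\<^sup>2 * (LINT x|circ. 1 / ((len I)\<^sup>2 + (rho (ctr I) x)\<^sup>2))"
    unfolding phi_def rho_commute[of _ "ctr I"] by (rule integral_mult_right_zero)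
  also have "\<dots> \<le> (len I)\<^sup>2 * (16 / len I)"
    by (intro mult_left_mono poisson_integral_le D ctr_circle assms) auto
  finally show ?thesis using D(4) by (simp add: power2_eq_square)
qed

text \<open>A point x has chord at least D/2 to one of two centres at chord D. If this is the centre
  of the wide bump, or if D \<le> a, the wide factor is at most four times the wide bump evaluated
  at D. Otherwise the narrow factor is O(b^2/D^2), and trading one b for a extracts the ratio
  b/a.\<close>

lemma poisson_product:
  fixes a b p q D :: real
  assumes ab: "0 < b" "b \<le> a" and pq: "0 \<le> p" "0 \<le> q" and D: "0 \<le> D" "D \<le> p + q"
  shows "a\<^sup>2 / (a\<^sup>2 + p\<^sup>2) * (b\<^sup>2 / (b\<^sup>2 + q\<^sup>2)) 
    \<le> a\<^sup>2 / (a\<^sup>2 + D\<^sup>2) * (4 * (b\<^sup>2 / (b\<^sup>2 + q\<^sup>2)) + 8 * (b / a) * (a\<^sup>2 / (a\<^sup>2 + p\<^sup>2)))"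
proof -
  have a0: "a > 0" using ab by simp
  have pos: "a\<^sup>2 + z > 0" "b\<^sup>2 + z > 0" if "z \<ge> 0" for z using ab a0 that by (auto intro!: add_pos_nonneg)
  define P Q R where "P = a\<^sup>2 / (a\<^sup>2 + p\<^sup>2)" and "Q = b\<^sup>2 / (b\<^sup>2 + q\<^sup>2)" and "R = a\<^sup>2 / (a\<^sup>2 + D\<^sup>2)"
  have nn: "0 \<le> P" "0 \<le> Q" "0 \<le> R" unfolding P_def Q_def R_def by auto
  have P1: "P \<le> 1" unfolding P_def using pos[of "p\<^sup>2"] by simp
  have "P * Q \<le> R * 4 * Q \<or> P * Q \<le> R * (8 * (b / a)) * P"
  proof (cases "p \<ge> D / 2")
    case True
    have "(D / 2)\<^sup>2 \<le> p\<^sup>2" using True D by (intro power_mono) auto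
    hence "D\<^sup>2 \<le> 4 * p\<^sup>2" by (simp add: power_divide)
    hence "a\<^sup>2 + D\<^sup>2 \<le> 4 * (a\<^sup>2 + p\<^sup>2)" using zero_le_power2[of a] unfolding distrib_left by linarith
    hence "4 * a\<^sup>2 / (4 * (a\<^sup>2 + p\<^sup>2)) \<le> 4 * a\<^sup>2 / (a\<^sup>2 + D\<^sup>2)"
      using pos(1)[of "p\<^sup>2"] pos(1)[of "D\<^sup>2"] by (intro divide_left_mono mult_pos_pos) auto
    moreover have "4 * a\<^sup>2 / (4 * (a\<^sup>2 + p\<^sup>2)) = P"
      unfolding P_def by (rule mult_divide_mult_cancel_left) simp
    moreover have "4 * a\<^sup>2 / (a\<^sup>2 + D\<^sup>2) = R * 4" unfolding R_def by simp
    ultimately have "P \<le> R * 4" by (simp only:)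
    thus ?thesis using nn by (auto intro: mult_right_mono)
  next
    case False
    show ?thesis
    proof (cases "D \<le> a")
      case True
      hence "D\<^sup>2 \<le> a\<^sup>2" using D by (intro power_mono) auto
      hence "1 \<le> R * 4" unfolding R_def using pos[of "D\<^sup>2"] by (simp add: field_simps)
      hence "P \<le> R * 4" using P1 by linarith
      thus ?thesis using nn by (auto intro: mult_right_mono)
    next
      case False
      hence Da: "D > a" by simp
      have "q \<ge> D / 2" using \<open>\<not> p \<ge> D / 2\<close> D by linarith
      hence "(D / 2)\<^sup>2 \<le> q\<^sup>2" using D by (intro power_mono) auto
      hence q: "D\<^sup>2 / 4 \<le> b\<^sup>2 + q\<^sup>2" by (simp add: power_divide add_increasing)
      have D2: "D\<^sup>2 > 0" "a\<^sup>2 \<le> D\<^sup>2" using Da a0 by (auto intro!: power_mono)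
      have "Q \<le> b\<^sup>2 / (D\<^sup>2 / 4)" unfolding Q_def
        using q D2 by (intro divide_left_mono mult_pos_pos pos) auto
      also have "\<dots> \<le> (a * b) / (D\<^sup>2 / 4)"
        using ab D2 by (intro divide_right_mono) (auto simp: power2_eq_square mult_right_mono)
      also have "\<dots> = 4 * (b / a) * (a\<^sup>2 / D\<^sup>2)" using a0 by (simp add: power2_eq_square)
      also have "\<dots> \<le> 4 * (b / a) * (2 * R)"
      proof (rule mult_left_mono)
        have "a\<^sup>2 / D\<^sup>2 = 2 * a\<^sup>2 / (D\<^sup>2 + D\<^sup>2)" by simp
        also have "\<dots> \<le> 2 * a\<^sup>2 / (a\<^sup>2 + D\<^sup>2)"
          using D2 pos[of "D\<^sup>2"] by (intro divide_left_mono mult_pos_pos) auto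
        finally show "a\<^sup>2 / D\<^sup>2 \<le> 2 * R" unfolding R_def by simp
      qed (use ab a0 in auto)
      finally have "Q \<le> R * (8 * (b / a))" by (simp add: mult_ac)
      from mult_right_mono[OF this nn(1)] show ?thesis by (simp add: mult_ac)
    qed
  qed
  moreover have "0 \<le> R * 4 * Q" "0 \<le> R * (8 * (b / a)) * P" using nn ab a0 by auto
  ultimately have "P * Q \<le> R * 4 * Q + R * (8 * (b / a)) * P" by linarith
  thus ?thesis unfolding P_def[symmetric] Q_def[symmetric] R_def[symmetric] by (simp add: distrib_left mult.assoc)
qed

text \<open>The ratio |J|/|I| in front of the wide bump compensates its larger integral, so both
  terms integrate to O(|J|): 192 = 4 * 16 + 8 * 16.\<close>

lemma phi_product_integral:
  assumes I: "I \<in> dyadic" and J: "J \<in> dyadic" and le: "len J \<le> len I"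
  shows "(LINT x|circ. phi I x * phi J x) \<le> 192 * (len J * phi I (ctr J))"
proof -
  note DI = dyadic_facts[OF I] note DJ = dyadic_facts[OF J]
  let ?R = "phi I (ctr J)" and ?b = "len J / len I"
  have int: "integrable circ (phi I)" "integrable circ (phi J)"
    using I J by (auto intro!: integrable_circ_cont continuous_phi)
  have "(LINT x|circ. phi I x * phi J x) \<le> (LINT x|circ. ?R * (4 * phi J x + 8 * ?b * phi I x))"
  proof (rule integral_mono')
    show "integrable circ (\<lambda>x. ?R * (4 * phi J x + 8 * ?b * phi I x))"
      using int by (intro integrable_mult_right Bochner_Integration.integrable_add) auto
    show "0 \<le> ?R * (4 * phi J x + 8 * ?b * phi I x)" for x
      using phi_nonneg DI DJ by (intro mult_nonneg_nonneg add_nonneg_nonneg) auto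
    show "phi I x * phi J x \<le> ?R * (4 * phi J x + 8 * ?b * phi I x)" for x
    proof -
      have "rho (ctr J) (ctr I) \<le> rho x (ctr I) + rho x (ctr J)"
        using rho_triangle[of "ctr J" "ctr I" x] rho_commute[of "ctr J" x] by simp
      from poisson_product[OF DJ(4) le _ _ _ this] show ?thesis unfolding phi_def by simp
    qed
  qed
  also have "\<dots> = ?R * (4 * (LINT x|circ. phi J x) + 8 * ?b * (LINT x|circ. phi I x))"
    using int by (simp add: Bochner_Integration.integral_add)
  also have "\<dots> \<le> ?R * (4 * (16 * len J) + 8 * ?b * (16 * len I))"
    using DI DJ by (intro mult_left_mono add_mono phi_integral I J phi_nonneg) auto
  also have "\<dots> = 192 * (len J * ?R)" using DI(4) by simp
  finally show ?thesis .
qed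

text \<open>For a pair with \<open>\<bar>J\<bar> \<le> \<bar>I\<bar>\<close> the bump of \<open>I\<close> is nearly constant on \<open>J\<close>, so summing over the disjoint
  \<open>J\<close> reproduces the integral of the bump of \<open>I\<close>.\<close>

lemma phi_sum_L2:
  assumes fin: "finite F" and disj: "disjoint F" and dy: "F \<subseteq> dyadic"
  shows "(LINT x|circ. (\<Sum>I\<in>F. phi I x)\<^sup>2) \<le> 20000 * (\<Sum>I\<in>F. len I)"
proof -
  let ?c = "\<lambda>I J. LINT x|circ. phi I x * phi J x"
  have int: "integrable circ (\<lambda>x. phi I x * phi J x)" if "I \<in> F" "J \<in> F" for I J
    using that dy by (intro integrable_circ_cont continuous_intros continuous_phi) auto
  have c0: "0 \<le> ?c I J" for I J by (intro Bochner_Integration.integral_nonneg) (simp add: phi_nonneg)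
  \<comment> \<open>9216 = 192 * 3 * 16: the product integral, the passage from \<open>ctr J\<close>
    to an integral over J, and the total integral of the bump of I.\<close>
  have one: "(\<Sum>J\<in>{J\<in>F. len J \<le> len I}. ?c I J) \<le> 9216 * len I" if I: "I \<in> F" for I
  proof -
    have Id: "I \<in> dyadic" using I dy by auto
    note D = dyadic_facts[OF Id]
    let ?p = "\<lambda>t. 1 / ((len I)\<^sup>2 + (rho (ctr I) t)\<^sup>2)" and ?G = "{J\<in>F. len J \<le> len I}"
    have ip: "integrable circ (\<lambda>t. indicator A t * ?p t)" if "A \<in> sets circ" for A
      using integrable_circ_mult_real[OF poisson_integrable[OF D(4), of "ctr I"], of "indicator A" 1] that
      by (simp add: mult.commute indicator_def)
    have "(\<Sum>J\<in>?G. ?c I J) \<le> (\<Sum>J\<in>?G. 192 * ((len I)\<^sup>2 * (3 * (LINT t|circ. indicator J t * ?p t))))"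
    proof (rule sum_mono)
      fix J assume "J \<in> ?G"
      hence J: "J \<in> dyadic" "len J \<le> len I" using dy by auto
      have "?c I J \<le> 192 * (len J * phi I (ctr J))" by (rule phi_product_integral[OF Id J])
      also have "len J * phi I (ctr J) = (len I)\<^sup>2 * (len J * ?p (ctr J))"
        unfolding phi_def by (simp add: rho_commute)
      also have "192 * \<dots> \<le> 192 * ((len I)\<^sup>2 * (3 * (LINT t|circ. indicator J t * ?p t)))"
        by (intro mult_left_mono poisson_dyadic J ctr_mem) auto
      finally show "?c I J \<le> 192 * ((len I)\<^sup>2 * (3 * (LINT t|circ. indicator J t * ?p t)))" .
    qed
    also have "\<dots> = 576 * (len I)\<^sup>2 * (\<Sum>J\<in>?G. LINT t|circ. indicator J t * ?p t)"
      by (simp add: sum_distrib_left mult.assoc)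
    also have "(\<Sum>J\<in>?G. LINT t|circ. indicator J t * ?p t) = (LINT t|circ. (\<Sum>J\<in>?G. indicator J t * ?p t))"
      using dy dyadic_facts(3) by (intro Bochner_Integration.integral_sum[symmetric] ip) auto
    also have "\<dots> = (LINT t|circ. indicator (\<Union>?G) t * ?p t)"
      unfolding sum_distrib_right[symmetric] using fin disj 
      by (subst sum_indicator_disjoint) (auto simp: disjoint_def)
    also have "\<dots> \<le> (LINT t|circ. ?p t)"
      using D by (intro integral_mono' poisson_integrable) (auto simp: indicator_def)
    also have "\<dots> \<le> 16 / len I" by (intro poisson_integral_le D ctr_circle Id)
    finally show ?thesis using D(4) by (simp add: power2_eq_square mult_left_mono)
  qed
  have "(LINT x|circ. (\<Sum>I\<in>F. phi I x)\<^sup>2) = (LINT x|circ. (\<Sum>I\<in>F. \<Sum>J\<in>F. phi I x * phi J x))"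
    by (intro Bochner_Integration.integral_cong refl) (simp add: power2_eq_square sum_product)
  also have "\<dots> = (\<Sum>I\<in>F. \<Sum>J\<in>F. ?c I J)"
    using int by (simp add: Bochner_Integration.integral_sum)
  \<comment> \<open>Each pair is arranged with the longer interval in the first slot. Pairs of equal
    length are counted twice, harmlessly since the terms are nonnegative.\<close>
  also have "\<dots> \<le> (\<Sum>I\<in>F. \<Sum>J\<in>F. (if len J \<le> len I then ?c I J else 0) + (if len I \<le> len J then ?c J I else 0))"
    using c0 by (intro sum_mono) (auto simp: mult.commute)
  also have "\<dots> = (\<Sum>I\<in>F. \<Sum>J\<in>F. if len J \<le> len I then ?c I J else 0) + (\<Sum>J\<in>F. \<Sum>I\<in>F. if len I \<le> len J then ?c J I else 0)"
    by (simp only: sum.distrib) (subst (2) sum.swap, rule refl)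
  also have "\<dots> = 2 * (\<Sum>I\<in>F. \<Sum>J\<in>{J\<in>F. len J \<le> len I}. ?c I J)"
    using fin by (simp add: sum.inter_filter)
  also have "\<dots> \<le> 2 * (\<Sum>I\<in>F. 9216 * len I)"
    by (intro mult_left_mono sum_mono one) auto
  also have "\<dots> = 18432 * (\<Sum>I\<in>F. len I)" by (simp add: sum_distrib_left)
  also have "\<dots> \<le> 20000 * (\<Sum>I\<in>F. len I)"
    by (intro mult_right_mono sum_nonneg) auto
  finally show ?thesis .
qed

text \<open>Only the tail 5/(M rho^2) of the kernel meets S. As rho \<ge> a/2, it is at most 25/M
  times a bump of width a, whose integral is at most 16/a; finally 400/(2 pi) = 200/pi < 80.\<close>

lemma fejer_mean_away:
  assumes S: "S \<in> sets circ" and a: "a > 0" and away: "\<And>t. t \<in> S \<Longrightarrow> rho x t \<ge> a / 2" and x: "x \<in> circle"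
  shows "cmod (fejer_mean m (indicator S) x) \<le> 80 / ((real m + 1) * a)"
proof -
  let ?M = "real m + 1"
  have ind: "integrable circ (indicator S :: real \<Rightarrow> complex)"
    by (rule integrable_circ_bounded[of _ 1]) (use S in \<open>auto simp: indicator_def\<close>)
  have "(LINT t|circ. cmod (indicator S t) * (5 * ?M / (1 + ?M\<^sup>2 * (rho x t)\<^sup>2)))
     \<le> (LINT t|circ. 25 / ?M * (1 / (a\<^sup>2 + (rho x t)\<^sup>2)))"
  proof (rule integral_mono')
    show "integrable circ (\<lambda>t. 25 / ?M * (1 / (a\<^sup>2 + (rho x t)\<^sup>2)))"
      by (intro integrable_mult_right poisson_integrable a)
    fix t
    show "0 \<le> 25 / ?M * (1 / (a\<^sup>2 + (rho x t)\<^sup>2))" by simp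
    show "cmod (indicator S t) * (5 * ?M / (1 + ?M\<^sup>2 * (rho x t)\<^sup>2)) \<le> 25 / ?M * (1 / (a\<^sup>2 + (rho x t)\<^sup>2))"
    proof (cases "t \<in> S")
      case True
      let ?r = "rho x t"
      have r: "?r \<ge> a / 2" "?r > 0" using away[OF True] a by auto
      have "(a / 2)\<^sup>2 \<le> ?r\<^sup>2" using r a by (intro power_mono) auto
      hence le: "a\<^sup>2 + ?r\<^sup>2 \<le> 5 * ?r\<^sup>2" by (simp add: power_divide)
      have "5 * ?M / (1 + ?M\<^sup>2 * ?r\<^sup>2) \<le> 5 * ?M / (?M\<^sup>2 * ?r\<^sup>2)"
        using r by (intro divide_left_mono mult_pos_pos) (auto intro!: add_pos_nonneg)
      also have "\<dots> = 25 / ?M * (1 / (5 * ?r\<^sup>2))"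
      proof -
        have "?M \<noteq> 0" by linarith
        thus ?thesis using r by (simp add: power2_eq_square divide_simps)
      qed
      also have "\<dots> \<le> 25 / ?M * (1 / (a\<^sup>2 + ?r\<^sup>2))"
        using le a by (intro mult_left_mono divide_left_mono mult_pos_pos) (auto intro!: add_pos_nonneg)
      finally show ?thesis using True by simp
    qed simp
  qed
  also have "\<dots> = 25 / ?M * (LINT t|circ. 1 / (a\<^sup>2 + (rho x t)\<^sup>2))" by (rule integral_mult_right_zero)
  also have "\<dots> \<le> 25 / ?M * (16 / a)"
    by (intro mult_left_mono poisson_integral_le a x) simp
  finally have "cmod (fejer_mean m (indicator S) x) \<le> 1 / (2 * pi) * (25 / ?M * (16 / a))"
    by (intro order_trans[OF norm_fejer_mean_le[OF ind]] mult_left_mono) auto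
  also have "\<dots> = 200 / pi * (1 / (?M * a))" by simp
  also have "\<dots> \<le> 80 * (1 / (?M * a))"
    using pi_approx a by (intro mult_right_mono) (auto simp: field_simps)
  finally show ?thesis by simp
qed

section \<open>Large and small stopping intervals\<close>

lemma stopping_height_nonneg:
  fixes f :: "real \<Rightarrow> complex"
  assumes "lam > norm_L1 f / (2 * pi)"
  shows "lam \<ge> 0"
proof -
  have "0 \<le> norm_L1 f / (2 * pi)" using norm_L1_nonneg[of f] by simp
  thus ?thesis using assms by linarith
qed

lemma fourier_coeff_add:
  assumes "integrable circ g" "integrable circ h"
  shows "fourier_coeff (\<lambda>t. g t + h t) k = fourier_coeff g k + fourier_coeff h k"
  unfolding fourier_coeff_eq using assms
  by (simp add: distrib_right distrib_left integrable_circ_cis[of _ "- of_int k", simplified])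

lemma Tpos_add:
  assumes "integrable circ g" "integrable circ h"
  shows "Tpos n (\<lambda>t. g t + h t) x = Tpos n g x + Tpos n h x"
  unfolding Tpos_def fourier_coeff_add[OF assms] sum.distrib[symmetric] by (simp only: distrib_left distrib_right)

lemma Tpos_zero: "Tpos n (\<lambda>t. 0) x = 0"
  unfolding Tpos_def fourier_coeff_eq by simp

lemma Tpos_sum:
  assumes "finite F" "\<And>I. I \<in> F \<Longrightarrow> integrable circ (g I)"
  shows "Tpos n (\<lambda>t. \<Sum>I\<in>F. g I t) x = (\<Sum>I\<in>F. Tpos n (g I) x)"
  using assms by (induction F rule: finite_induct) (simp_all add: Tpos_zero Tpos_add)

text \<open>On \<open>I\<close> split \<open>f\<close> into a multiple of \<open>e\<^bsup>int\<^esup>\<close> and a remainder orthogonal to \<open>e\<^bsup>int\<^esup>\<close>.\<close>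

definition osc :: "nat \<Rightarrow> (real \<Rightarrow> complex) \<Rightarrow> real set \<Rightarrow> complex" where
  "osc n f I = (LINT t|circ. indicator I t * f t * cis (- real n * t)) / len I"

definition osc_part :: "nat \<Rightarrow> (real \<Rightarrow> complex) \<Rightarrow> real set \<Rightarrow> real \<Rightarrow> complex" where
  "osc_part n f I t = indicator I t * (osc n f I * cis (real n * t))"

definition cancel_part :: "nat \<Rightarrow> (real \<Rightarrow> complex) \<Rightarrow> real set \<Rightarrow> real \<Rightarrow> complex" where
  "cancel_part n f I t = indicator I t * f t - osc_part n f I t"

lemma integrable_indicator_mult:
  assumes "integrable circ f" "A \<in> sets circ"
  shows "integrable circ (\<lambda>t. indicator A t * (f t :: complex))"
proof -
  have "integrable circ (\<lambda>t. f t * indicator A t)"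
    by (rule integrable_circ_mult[OF assms(1), of _ 1]) (use assms(2) in \<open>auto simp: indicator_def\<close>)
  thus ?thesis by (simp add: mult.commute)
qed

lemma measure_circ_dyadic: "I \<in> dyadic \<Longrightarrow> measure circ I = len I"
  unfolding circ_def using dyadic_facts[of I] by (simp add: measure_restrict_space)

lemma norm_indicator_mult: "cmod (indicator A t * z) = indicator A t * cmod z"
  by (simp add: indicator_def)

lemma osc_le:
  assumes f: "integrable circ f" and I: "I \<in> dyadic"
  shows "cmod (osc n f I) * len I \<le> mass f I"
proof -
  note D = dyadic_facts[OF I]
  have "cmod (LINT t|circ. indicator I t * f t * cis (- real n * t))
     \<le> (LINT t|circ. cmod (indicator I t * f t * cis (- real n * t)))"
    by (rule integral_norm_bound)
  also have "\<dots> = mass f I"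
    unfolding mass_def by (intro Bochner_Integration.integral_cong refl) (simp add: norm_mult norm_indicator_mult indicator_def)
  finally show ?thesis unfolding osc_def using D(4) by (simp add: norm_divide)
qed

lemma osc_part_integrable:
  assumes I: "I \<in> dyadic"
  shows "integrable circ (osc_part n f I)"
  unfolding osc_part_def
  by (intro integrable_indicator_mult dyadic_facts[OF I] integrable_circ_cont continuous_intros)

lemma cancel_part_integrable:
  assumes "integrable circ f" "I \<in> dyadic"
  shows "integrable circ (cancel_part n f I)"
  unfolding cancel_part_def
  by (intro Bochner_Integration.integrable_diff integrable_indicator_mult assms osc_part_integrable dyadic_facts[OF assms(2)])

lemma osc_part_norm:
  assumes I: "I \<in> dyadic"
  shows "(LINT t|circ. cmod (osc_part n f I t)) = cmod (osc n f I) * len I"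
proof -
  have "(LINT t|circ. cmod (osc_part n f I t)) = (LINT t|circ. cmod (osc n f I) * indicator I t)"
    by (intro Bochner_Integration.integral_cong refl) (simp add: osc_part_def norm_mult indicator_def)
  also have "\<dots> = cmod (osc n f I) * measure circ I"
    using dyadic_facts[OF I] by (simp add: Int_absorb2)
  finally show ?thesis by (simp add: measure_circ_dyadic I)
qed

lemma cancel_part_norm:
  assumes f: "integrable circ f" and I: "I \<in> dyadic"
  shows "(LINT t|circ. cmod (cancel_part n f I t)) \<le> 2 * mass f I"
proof -
  have "(LINT t|circ. cmod (cancel_part n f I t)) \<le> (LINT t|circ. indicator I t * cmod (f t) + cmod (osc_part n f I t))"
  proof (rule integral_mono)
    show "integrable circ (\<lambda>t. indicator I t * cmod (f t) + cmod (osc_part n f I t))"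
      by (intro Bochner_Integration.integrable_add mass_integrable f dyadic_facts[OF I] integrable_norm osc_part_integrable I)
    show "cmod (cancel_part n f I t) \<le> indicator I t * cmod (f t) + cmod (osc_part n f I t)" for t
      unfolding cancel_part_def norm_indicator_mult[symmetric] by (rule norm_triangle_ineq4)
  qed (intro integrable_norm cancel_part_integrable f I)
  also have "\<dots> = mass f I + cmod (osc n f I) * len I"
    unfolding mass_def osc_part_norm[OF I, symmetric]
    by (intro Bochner_Integration.integral_add mass_integrable f dyadic_facts[OF I] integrable_norm osc_part_integrable I)
  finally show ?thesis using osc_le[OF f I, of n] by simp
qed

lemma cancel_part_cancels:
  assumes f: "integrable circ f" and I: "I \<in> dyadic"
  shows "(LINT t|circ. cancel_part n f I t * cis (- real n * t)) = 0"
proof -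
  note D = dyadic_facts[OF I]
  have c: "cis (real n * t) * cis (- real n * t) = 1" for t by (simp add: cis_mult)
  have "(LINT t|circ. cancel_part n f I t * cis (- real n * t)) 
     = (LINT t|circ. indicator I t * f t * cis (- real n * t) - osc n f I * indicator I t)"
    using c by (intro Bochner_Integration.integral_cong refl)
       (simp add: cancel_part_def osc_part_def left_diff_distrib mult.assoc)
  also have "\<dots> = (LINT t|circ. indicator I t * f t * cis (- real n * t)) - (LINT t|circ. osc n f I * indicator I t)"
    using D by (intro Bochner_Integration.integral_diff integrable_circ_cis integrable_indicator_mult f integrable_mult_right)
      (auto intro!: integrable_circ_bounded[of _ 1] simp: indicator_def)
  also have "(LINT t|circ. osc n f I * indicator I t) = osc n f I * len I"
  proof -
    have "(LINT t|circ. osc n f I * indicator I t) = (LINT t|circ. indicator I t *\<^sub>R osc n f I)"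
      by (intro Bochner_Integration.integral_cong refl) (simp add: indicator_def)
    also have "\<dots> = (LINT t|circ. indicator I t) *\<^sub>R osc n f I"
      using D by (intro integral_scaleR_left circ.integrable_const_bound[of _ 1]) auto
    also have "(LINT t|circ. indicator I t) = len I"
      using D measure_circ_dyadic[OF I] by (simp add: Int_absorb2)
    finally show ?thesis by (simp add: scaleR_conv_of_real)
  qed
  finally show ?thesis unfolding osc_def using D(4) by simp
qed

text \<open>Near I the trivial kernel bound n and the weight bound cancel in n: n * 4 lam |I| *
  800/(n |I|) = 3200 lam, and \<open>phi\<close> is at least 1/5 there, whence 16000. Far from I the
  cancellation alone reproduces the shape of \<open>phi\<close>, and the weight enters only through
  w \<le> 16.\<close>

lemma cancel_part_pointwise:
  assumes f: "integrable circ f" and lam: "lam > norm_L1 f / (2 * pi)" and I: "I \<in> stopping f lam" and n: "n > 0"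
    and w: "0 \<le> w" "w \<le> 16" "rho x (ctr I) < 2 * len I \<Longrightarrow> w \<le> 800 / (real n * len I)"
  shows "w * cmod (Tpos n (cancel_part n f I) x) \<le> 16000 * lam * phi I x"
proof -
  have Id: "I \<in> dyadic" by (rule stopping_dyadic[OF I])
  note D = dyadic_facts[OF Id]
  let ?a = "len I" and ?r = "rho x (ctr I)"
  have lam0: "lam \<ge> 0" by (rule stopping_height_nonneg[OF lam])
  have nrm: "(LINT t|circ. cmod (cancel_part n f I t)) \<le> 4 * lam * ?a"
    using cancel_part_norm[OF f Id, of n] stopping_upper[OF f lam I] by simp
  have pos: "?a\<^sup>2 + ?r\<^sup>2 > 0" using D(4) by (simp add: add_pos_nonneg)
  show ?thesis
  proof (cases "?r < 2 * ?a")
    case True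
    have "w * cmod (Tpos n (cancel_part n f I) x) \<le> 800 / (real n * ?a) * (real n * (4 * lam * ?a))"
      using w(3)[OF True] n D(4) w(1) lam0
      by (intro mult_mono order_trans[OF Tpos_near[OF cancel_part_integrable[OF f Id]]] mult_left_mono nrm) auto
    also have "\<dots> = 3200 * lam" using n D(4) by simp
    also have "\<dots> \<le> 16000 * lam * phi I x"
    proof -
      have "?r\<^sup>2 \<le> (2 * ?a)\<^sup>2" using True by (intro power_mono) auto
      hence "1 / 5 \<le> phi I x" unfolding phi_def using pos by (simp add: field_simps)
      from mult_left_mono[OF this, of "16000 * lam"] show ?thesis using lam0 by simp
    qed
    finally show ?thesis .
  next
    case False
    hence r: "?r \<ge> 2 * ?a" by simp
    have r0: "?r > 0" using r D(4) by linarith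
    have "cmod (Tpos n (cancel_part n f I) x) \<le> 2 * ?a / ?r\<^sup>2 * (LINT t|circ. cmod (cancel_part n f I t))"
    proof (rule Tpos_far[OF cancel_part_integrable[OF f Id] n cancel_part_cancels[OF f Id] _ r D(4)])
      fix t assume "cancel_part n f I t \<noteq> 0"
      hence "t \<in> I" by (auto simp: cancel_part_def osc_part_def indicator_def split: if_splits)
      thus "rho t (ctr I) \<le> ?a" by (intro dyadic_rho[OF Id] ctr_mem Id)
    qed
    also have "\<dots> \<le> 2 * ?a / ?r\<^sup>2 * (4 * lam * ?a)" by (intro mult_left_mono nrm) (use D(4) in auto)
    also have "\<dots> = 8 * lam * (?a\<^sup>2 / ?r\<^sup>2)" by (simp add: power2_eq_square)
    also have "\<dots> \<le> 8 * lam * (5 / 4 * phi I x)"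
    proof (rule mult_left_mono)
      have "(2 * ?a)\<^sup>2 \<le> ?r\<^sup>2" using r D(4) by (intro power_mono) auto
      hence "?a\<^sup>2 + ?r\<^sup>2 \<le> 5 / 4 * ?r\<^sup>2" by simp
      moreover define X where "X = ?a\<^sup>2 + ?r\<^sup>2"
      ultimately have "1 / ?r\<^sup>2 \<le> 5 / 4 * (1 / X)"
        using r0 pos by (simp add: field_simps)
      from mult_left_mono[OF this, of "?a\<^sup>2"] show "?a\<^sup>2 / ?r\<^sup>2 \<le> 5 / 4 * phi I x"
        unfolding phi_def X_def[symmetric] by simp
    qed (use lam0 in auto)
    finally have T: "cmod (Tpos n (cancel_part n f I) x) \<le> 10 * lam * phi I x" by simp
    have "w * cmod (Tpos n (cancel_part n f I) x) \<le> 16 * (10 * lam * phi I x)"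
      using w T by (intro mult_mono) auto
    also have "\<dots> \<le> 16000 * lam * phi I x"
      using mult_nonneg_nonneg[OF lam0 phi_nonneg[of I x]] by simp
    finally show ?thesis .
  qed
qed

text \<open>The oscillating parts add up to a function bounded by 2 lam with L^1 norm at most that
  of f, so the Fejer duality applies to their sum. The remainders are summed in absolute value:
  lam^2 times the squared norm of the sum of bumps is O(lam^2) times the total length of the
  intervals, and this length is at most the L^1 norm of f over lam.\<close>

lemma large_intervals_L2:
  assumes f: "integrable circ f" and lam: "lam > norm_L1 f / (2 * pi)" and r: "r > 0" and n: "n > 0"
    and wc: "continuous_on UNIV w" and w: "\<And>x. x \<in> circle \<Longrightarrow> 0 \<le> w x" "\<And>x. x \<in> circle \<Longrightarrow> w x \<le> 16"
     "\<And>x I. x \<in> circle \<Longrightarrow> I \<in> large_stopping f lam r \<Longrightarrow> rho x (ctr I) < 2 * len I \<Longrightarrow> w x \<le> 800 / (real n * len I)"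
  shows "(LINT x|circ. (cmod (Tpos n (\<lambda>t. indicator (\<Union>(large_stopping f lam r)) t * f t) x) * w x)\<^sup>2) \<le> 10 ^ 14 * (lam * norm_L1 f)"
proof -
  let ?F = "large_stopping f lam r"
  have fin: "finite ?F" by (rule large_stopping_finite[OF r])
  have lam0: "lam \<ge> 0" by (rule stopping_height_nonneg[OF lam])
  define H where "H t = (\<Sum>I\<in>?F. osc_part n f I t)" for t
  have Hint: "integrable circ H"
    unfolding H_def by (intro Bochner_Integration.integrable_sum osc_part_integrable large_stopping_facts)
  have split: "indicator (\<Union>?F) t * f t = H t + (\<Sum>I\<in>?F. cancel_part n f I t)" for t
  proof -
    have "indicator (\<Union>?F) t * f t = of_real (indicator (\<Union>?F) t) * f t" by (simp add: indicator_def)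
    also have "\<dots> = (\<Sum>I\<in>?F. indicator I t * f t)"
      unfolding sum_indicator_disjoint[OF fin large_stopping_disjoint, symmetric]
      by (simp add: sum_distrib_right of_real_sum) (intro sum.cong refl, simp add: indicator_def)
    finally show ?thesis by (simp add: H_def cancel_part_def sum_subtractf)
  qed
  have T: "Tpos n (\<lambda>t. indicator (\<Union>?F) t * f t) x = Tpos n H x + (\<Sum>I\<in>?F. Tpos n (cancel_part n f I) x)" for x
    unfolding split
    by (subst Tpos_add) (auto intro!: Hint Bochner_Integration.integrable_sum cancel_part_integrable f Tpos_sum fin dest: large_stopping_facts)
  \<comment> \<open>By disjointness at most one term survives at t; its coefficient is at most the
    average of |f| over a stopping interval, hence at most 2 lam.\<close>
  have Hbd: "cmod (H t) \<le> 2 * lam" for t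
  proof (cases "\<exists>I\<in>?F. t \<in> I")
    case True
    then obtain I where I: "I \<in> ?F" "t \<in> I" by auto
    have "H t = osc_part n f I t"
      unfolding H_def
    proof (rule sum.remove[OF fin I(1), THEN trans])
      have "osc_part n f J t = 0" if "J \<in> ?F - {I}" for J
        using that I large_stopping_disjoint[of f lam r] unfolding osc_part_def disjoint_def by (auto simp: indicator_def)
      thus "osc_part n f I t + (\<Sum>J\<in>?F - {I}. osc_part n f J t) = osc_part n f I t" by simp
    qed
    also have "cmod \<dots> = cmod (osc n f I)" using I by (simp add: osc_part_def norm_mult)
    also have "\<dots> \<le> 2 * lam"
      using osc_le[OF f large_stopping_facts(2)[OF I(1)], of n] stopping_upper[OF f lam large_stopping_facts(1)[OF I(1)]]
        dyadic_facts(4)[OF large_stopping_facts(2)[OF I(1)]] by (smt (verit) mult_le_cancel_right)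
    finally show ?thesis .
  next
    case False
    hence "H t = 0" unfolding H_def by (intro sum.neutral) (auto simp: osc_part_def indicator_def)
    thus ?thesis using lam0 by simp
  qed
  have Hnorm: "(LINT t|circ. cmod (H t)) \<le> norm_L1 f"
  proof -
    have "(LINT t|circ. cmod (H t)) \<le> (LINT t|circ. (\<Sum>I\<in>?F. cmod (osc_part n f I t)))"
      unfolding H_def by (intro integral_mono' norm_sum Bochner_Integration.integrable_sum integrable_norm osc_part_integrable large_stopping_facts sum_nonneg) auto
    also have "\<dots> = (\<Sum>I\<in>?F. cmod (osc n f I) * len I)"
      by (subst Bochner_Integration.integral_sum) (auto intro!: integrable_norm osc_part_integrable osc_part_norm sum.cong dest: large_stopping_facts)
    also have "\<dots> \<le> (\<Sum>I\<in>?F. mass f I)" by (intro sum_mono osc_le f large_stopping_facts)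
    also have "\<dots> = mass f (\<Union>?F)"
      by (rule mass_UN[OF f fin large_stopping_disjoint, symmetric]) (use large_stopping_facts(4) in blast)
    also have "\<dots> \<le> norm_L1 f" by (rule mass_le_norm[OF f large_stopping_sets[OF r]])
    finally show ?thesis .
  qed
  have TH: "(LINT x|circ. (cmod (Tpos n H x))\<^sup>2) \<le> 2 * (16 * (2 * lam)) * norm_L1 f"
  proof -
    have "(LINT x|circ. (cmod (Tpos n H x))\<^sup>2) \<le> 2 * (16 * (2 * lam)) * (LINT t|circ. cmod (H t))"
      by (rule Tpos_L2[OF Hint]) (rule norm_fejer_mean_bounded[OF Hint Hbd])
    also have "\<dots> \<le> 2 * (16 * (2 * lam)) * norm_L1 f" using lam0 by (intro mult_left_mono Hnorm) auto
    finally show ?thesis .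
  qed
  have iTH: "integrable circ (\<lambda>x. (cmod (Tpos n H x))\<^sup>2)"
    by (intro integrable_circ_cont continuous_intros)
  have iphi: "integrable circ (\<lambda>x. (\<Sum>I\<in>?F. phi I x)\<^sup>2)"
    by (intro integrable_circ_cont continuous_intros continuous_phi large_stopping_facts)
  have pw: "(cmod (Tpos n (\<lambda>t. indicator (\<Union>?F) t * f t) x) * w x)\<^sup>2 
     \<le> 512 * (cmod (Tpos n H x))\<^sup>2 + 2 * (16000 * lam)\<^sup>2 * (\<Sum>I\<in>?F. phi I x)\<^sup>2" if x: "x \<in> circle" for x
  proof -
    have "cmod (Tpos n (\<lambda>t. indicator (\<Union>?F) t * f t) x) * w x 
       \<le> (cmod (Tpos n H x) + (\<Sum>I\<in>?F. cmod (Tpos n (cancel_part n f I) x))) * w x"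
      unfolding T by (intro mult_right_mono w x order_trans[OF norm_triangle_ineq] add_left_mono norm_sum)
    also have "\<dots> = w x * cmod (Tpos n H x) + (\<Sum>I\<in>?F. w x * cmod (Tpos n (cancel_part n f I) x))"
      by (simp add: distrib_left sum_distrib_left mult.commute)
    also have "\<dots> \<le> 16 * cmod (Tpos n H x) + (\<Sum>I\<in>?F. 16000 * lam * phi I x)"
      using x by (intro add_mono sum_mono mult_right_mono cancel_part_pointwise f lam n w) (auto dest: large_stopping_facts)
    finally have "cmod (Tpos n (\<lambda>t. indicator (\<Union>?F) t * f t) x) * w x 
       \<le> 16 * cmod (Tpos n H x) + 16000 * lam * (\<Sum>I\<in>?F. phi I x)" by (simp add: sum_distrib_left)
    hence "(cmod (Tpos n (\<lambda>t. indicator (\<Union>?F) t * f t) x) * w x)\<^sup>2 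
       \<le> (16 * cmod (Tpos n H x) + 16000 * lam * (\<Sum>I\<in>?F. phi I x))\<^sup>2"
      using w x by (intro power_mono) auto
    also have "\<dots> \<le> 2 * (16 * cmod (Tpos n H x))\<^sup>2 + 2 * (16000 * lam * (\<Sum>I\<in>?F. phi I x))\<^sup>2"
      using sum_squares_bound[of "16 * cmod (Tpos n H x)" "16000 * lam * (\<Sum>I\<in>?F. phi I x)"]
      unfolding power2_sum by linarith
    finally show ?thesis by (simp add: power_mult_distrib)
  qed
  have "(LINT x|circ. (cmod (Tpos n (\<lambda>t. indicator (\<Union>?F) t * f t) x) * w x)\<^sup>2)
     \<le> (LINT x|circ. 512 * (cmod (Tpos n H x))\<^sup>2 + 2 * (16000 * lam)\<^sup>2 * (\<Sum>I\<in>?F. phi I x)\<^sup>2)"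
  proof (rule integral_mono)
    show "integrable circ (\<lambda>x. 512 * (cmod (Tpos n H x))\<^sup>2 + 2 * (16000 * lam)\<^sup>2 * (\<Sum>I\<in>?F. phi I x)\<^sup>2)"
      by (intro Bochner_Integration.integrable_add integrable_mult_right iTH iphi)
    show "integrable circ (\<lambda>x. (cmod (Tpos n (\<lambda>t. indicator (\<Union>?F) t * f t) x) * w x)\<^sup>2)"
      by (intro integrable_circ_cont continuous_intros wc)
  qed (use pw in simp)
  also have "\<dots> = 512 * (LINT x|circ. (cmod (Tpos n H x))\<^sup>2) + 2 * (16000 * lam)\<^sup>2 * (LINT x|circ. (\<Sum>I\<in>?F. phi I x)\<^sup>2)"
    by (subst Bochner_Integration.integral_add[OF integrable_mult_right[OF iTH] integrable_mult_right[OF iphi]])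
       (simp only: integral_mult_right_zero)
  also have "\<dots> \<le> 512 * (2 * (16 * (2 * lam)) * norm_L1 f) + 2 * (16000 * lam)\<^sup>2 * (20000 * (\<Sum>I\<in>?F. len I))"
    using large_stopping_facts by (intro add_mono mult_left_mono TH phi_sum_L2 fin large_stopping_disjoint) auto
  also have "2 * (16000 * lam)\<^sup>2 * (20000 * (\<Sum>I\<in>?F. len I)) = 10240000000000 * lam * (lam * (\<Sum>I\<in>?F. len I))"
    by (simp add: power2_eq_square)
  also have "\<dots> \<le> 10240000000000 * lam * norm_L1 f"
    using lam0 by (intro mult_left_mono large_stopping_sum_len f r) auto
  also have "512 * (2 * (16 * (2 * lam)) * norm_L1 f) + 10240000000000 * lam * norm_L1 f \<le> 10 ^ 14 * (lam * norm_L1 f)"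
    using mult_nonneg_nonneg[OF lam0 norm_L1_nonneg[of f]] by simp
  finally show ?thesis by simp
qed

lemma exists_scale:
  assumes "0 < r" "r < 2 * pi"
  shows "\<exists>k. r < 2 * pi / 2 ^ k \<and> 2 * pi / 2 ^ k \<le> 2 * r"
proof -
  let ?P = "\<lambda>k. 2 * pi / 2 ^ k \<le> 2 * r"
  obtain n where "pi / r < 2 ^ n" using real_arch_pow[of 2] by auto
  hence "?P n" using assms by (simp add: field_simps)
  define k where "k = (LEAST k. ?P k)"
  have Pk: "?P k" unfolding k_def by (rule LeastI[of ?P], fact)
  have "r < 2 * pi / 2 ^ k"
  proof (cases k)
    case (Suc j)
    have "\<not> ?P j" using not_less_Least[of j ?P] Suc unfolding k_def by simp
    thus ?thesis using Suc by (simp add: field_simps)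
  qed (use assms in simp)
  thus ?thesis using Pk by auto
qed

text \<open>Off the stopping intervals longer than r, averages at a dyadic scale between r and 2r
  are at most \<open>lam\<close>. Widening the Fejer kernel of order 4n to that scale costs a factor
  of order n r. The lemma is applied with r = 1/n, where the cost is constant, and with r =
  \<beta>_j for the middle intervals.\<close>

lemma small_intervals_L2:
  assumes f: "integrable circ f" and lam: "lam > norm_L1 f / (2 * pi)" and n: "n > 0" and r: "r \<ge> 1 / real n"
    and h: "integrable circ h" "\<And>t. cmod (h t) \<le> indicator (- \<Union>(large_stopping f lam r)) t * cmod (f t)"
  shows "(LINT x|circ. (cmod (Tpos n h x))\<^sup>2) \<le> 2400 * lam * (real n * r) * (LINT t|circ. cmod (h t))"
proof -
  have lam0: "lam \<ge> 0" by (rule stopping_height_nonneg[OF lam])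
  have r0: "r > 0" using r n by (smt (verit) divide_pos_pos of_nat_0_less_iff)
  have nr: "real n * r \<ge> 1" using r n by (simp add: field_simps)
  have massh: "mass h J \<le> mass f (J - \<Union>(large_stopping f lam r))" if J: "J \<in> dyadic" for J
    unfolding mass_def
  proof (rule integral_mono[OF mass_integrable mass_integrable])
    show "J \<in> sets circ" "J - \<Union>(large_stopping f lam r) \<in> sets circ"
      using dyadic_facts[OF J] large_stopping_sets[OF r0] by auto
    show "indicator J x * cmod (h x) \<le> indicator (J - \<Union>(large_stopping f lam r)) x * cmod (f x)" for x
    proof (cases "x \<in> \<Union>(large_stopping f lam r)")
      case True
      hence "indicator (- \<Union>(large_stopping f lam r)) x = (0::real)" by (simp only: indicator_simps Compl_iff not_not)
      hence "h x = 0" using h(2)[of x] by simp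
      thus ?thesis by simp
    next
      case False
      hence "indicator (- \<Union>(large_stopping f lam r)) x = (1::real)" by (simp only: indicator_simps Compl_iff not_False_eq_True)
      thus ?thesis using h(2)[of x] False by (auto simp: indicator_def)
    qed
  qed (use f h in auto)
  obtain k where k: "2 * pi / 2 ^ k \<le> 2 * r" "real n * (2 * pi / 2 ^ k) \<ge> 1"
    "\<And>J. J \<in> dyadic_level k \<Longrightarrow> mass h J \<le> lam * (2 * pi / 2 ^ k)"
  proof (cases "r < 2 * pi")
    case True
    then obtain k where k: "r < 2 * pi / 2 ^ k" "2 * pi / 2 ^ k \<le> 2 * r" using exists_scale r0 by blast
    have avg: "mass h J \<le> lam * (2 * pi / 2 ^ k)" if "J \<in> dyadic_level k" for J
    proof -
      have Jd: "J \<in> dyadic" using that dyadic_level_sub by auto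
      have "mass h J \<le> mass f (J - \<Union>(large_stopping f lam r))" by (rule massh[OF Jd])
      also have "\<dots> \<le> lam * len J"
        using k dyadic_level_len[OF that] by (intro small_average f Jd r0 lam0) auto
      finally show ?thesis by (simp add: dyadic_level_len[OF that])
    qed
    have "real n * (2 * pi / 2 ^ k) \<ge> real n * r" using k by (intro mult_left_mono) auto
    hence "real n * (2 * pi / 2 ^ k) \<ge> 1" using nr by linarith
    from that[OF k(2) this avg] show ?thesis .
  next
    \<comment> \<open>No dyadic interval is longer than r here. The circle itself is taken as the
      scale, with average below \<open>lam\<close> by assumption.\<close>
    case False
    have avg: "mass h J \<le> lam * (2 * pi / 2 ^ 0)" if "J \<in> dyadic_level 0" for J
    proof -
      have Jd: "J \<in> dyadic" using that dyadic_level_sub by auto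
      have "mass h J \<le> mass f (J - \<Union>(large_stopping f lam r))" by (rule massh[OF Jd])
      also have "\<dots> \<le> norm_L1 f"
        using dyadic_facts[OF Jd] large_stopping_sets[OF r0] by (intro mass_le_norm f) auto
      also have "\<dots> \<le> lam * (2 * pi / 2 ^ 0)" using lam by (simp add: field_simps)
      finally show ?thesis .
    qed
    have 1: "real n * (2 * pi / 2 ^ 0) \<ge> 1"
    proof -
      have "1 * (2 * pi) \<le> real n * (2 * pi)" using n by (intro mult_right_mono) auto
      thus ?thesis using pi_gt3 unfolding power_0 div_by_1 by linarith
    qed
    have "2 * pi / 2 ^ 0 \<le> 2 * r" using False pi_gt_zero unfolding power_0 div_by_1 by linarith
    from that[OF this 1 avg] show ?thesis .
  qed
  have fej: "cmod (fejer_mean (4 * n) h x) \<le> 1200 * lam * (real n * r)" if "x \<in> circle" for x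
  proof -
    have "cmod (fejer_mean (4 * n) h x) \<le> 120 * lam * (real (4 * n) + 1) * (2 * pi / 2 ^ k)"
    proof (rule fejer_mean_dyadic_bound[OF h(1) refl _ k(3) that lam0])
      have "real n * (2 * pi / 2 ^ k) \<le> (real (4 * n) + 1) * (2 * pi / 2 ^ k)"
        by (intro mult_right_mono) auto
      thus "1 \<le> (real (4 * n) + 1) * (2 * pi / 2 ^ k)" using k(2) by linarith
    qed
    also have "\<dots> \<le> 120 * lam * (5 * real n) * (2 * r)"
      using n lam0 k(1) by (intro mult_mono) auto
    finally show ?thesis by simp
  qed
  show ?thesis using Tpos_L2[OF h(1) fej] by simp
qed

section \<open>The estimate at a single scale\<close>

text \<open>From \<beta> \<ge> 9 the dilate contains the translates with |i| \<le> 4, so an excluded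
  point has arc distance at least 4|I| from every point of I. The chord is then at least (8/pi)|I|,
  which exceeds 5/2 |I| because pi < 3.2.\<close>

lemma dilate_away:
  assumes \<beta>: "\<beta> \<ge> 9" and I: "I \<in> dyadic" and t: "t \<in> circle" "t \<notin> dilate \<beta> I"
  shows "rho t (ctr I) \<ge> 5 / 2 * len I"
proof -
  obtain m k where mk: "I = dint m k" using I by (rule dyadicE)
  let ?a = "len I" and ?o = "- pi + 2 * pi * real k / 2 ^ m" and ?c = "ctr I"
  have a0: "?a > 0" by (rule dyadic_facts(4)[OF I])
  have Ieq: "I = {?o..<?o + ?a}"
  proof -
    have "- pi + 2 * pi * (real k + 1) / 2 ^ m = ?o + 2 * pi / 2 ^ m"
      by (simp add: add_divide_distrib distrib_left)
    thus ?thesis unfolding mk dint_len by (simp only: dint_def)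
  qed
  have "?c \<in> {?o..<?o + ?a}" by (subst Ieq[symmetric]) (rule ctr_mem[OF I])
  hence c: "?o \<le> ?c" "?c < ?o + ?a" by (simp_all only: atLeastLessThan_iff)
  have cc: "?c \<in> circle" by (rule ctr_circle[OF I])
  have "\<exists>j::int. \<bar>t - ?c + 2 * pi * of_int j\<bar> \<le> pi"
  proof -
    have "\<bar>t - ?c + 2 * pi * of_int 0\<bar> \<le> pi \<or> \<bar>t - ?c + 2 * pi * of_int 1\<bar> \<le> pi \<or> \<bar>t - ?c + 2 * pi * of_int (-1)\<bar> \<le> pi"
      using t(1) cc by (auto simp: circle_def)
    thus ?thesis by blast
  qed
  then obtain j :: int where j: "\<bar>t - ?c + 2 * pi * of_int j\<bar> \<le> pi" by auto
  define d where "d = t - ?c + 2 * pi * of_int j"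
  have "\<bar>d\<bar> \<ge> 4 * ?a"
  proof (rule ccontr)
    assume "\<not> \<bar>d\<bar> \<ge> 4 * ?a"
    hence d: "- 4 * ?a < d" "d < 4 * ?a" by auto
    \<comment> \<open>The index of the translate of I that holds the representative c + d of t.
      Since c lies in I and |d| < 4|I|, the quotient is strictly between -4 and 5.\<close>
    define i where "i = \<lfloor>(?c + d - ?o) / ?a\<rfloor>"
    have i1: "of_int i * ?a \<le> ?c + d - ?o" "?c + d - ?o < (of_int i + 1) * ?a"
      using a0 unfolding i_def by (simp_all add: pos_le_divide_eq[symmetric] pos_divide_less_eq[symmetric])
    have "(?c + d - ?o) / ?a < 5" "- 4 < (?c + d - ?o) / ?a"
      unfolding pos_divide_less_eq[OF a0] pos_less_divide_eq[OF a0] using d c by linarith+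
    hence "i < 5" "- 4 \<le> i" unfolding i_def by (simp_all add: floor_less_iff le_floor_iff)
    hence "\<bar>i\<bar> \<le> 4" by linarith
    hence "real_of_int \<bar>i\<bar> \<le> 4" by linarith
    hence "real_of_int \<bar>i\<bar> \<le> (real \<beta> - 1) / 2" using \<beta> by simp
    moreover have "t \<in> neighbour I i"
      unfolding neighbour_def circle_translate_def
    proof (intro CollectI conjI t(1) bexI exI)
      show "t = (?c + d - ?a * of_int i) + ?a * of_int i + 2 * pi * of_int (- j)"
        unfolding d_def by simp
      show "?c + d - ?a * of_int i \<in> I"
        using i1 by (subst Ieq, unfold atLeastLessThan_iff distrib_right) (auto simp: mult.commute)
    qed
    ultimately show False using t(2) unfolding dilate_def by blast
  qed
  moreover have "2 / pi * \<bar>d\<bar> \<le> rho t ?c"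
  proof -
    have "\<bar>t - (?c + 2 * pi * of_int (- j))\<bar> \<le> pi" using j by (simp add: algebra_simps)
    from rho_ge[OF this] show ?thesis unfolding rho_shift d_def by (simp add: algebra_simps)
  qed
  moreover have "5 / 2 * ?a \<le> 2 / pi * (4 * ?a)" using a0 pi_less_32 by (simp add: field_simps)
  ultimately show ?thesis using mult_left_mono[of "4 * ?a" "\<bar>d\<bar>" "2 / pi"] by simp
qed

lemma circle_translate_borel:
  assumes "I \<in> dyadic"
  shows "circle_translate I a \<in> sets borel"
proof -
  obtain m k where mk: "I = dint m k" using assms by (rule dyadicE)
  have "circle_translate I a = circle \<inter> (\<Union>j::int. {x. x - (a + 2 * pi * of_int j) \<in> I})"
    unfolding circle_translate_def
  proof (intro equalityI subsetI)
    fix x assume "x \<in> circle \<inter> (\<Union>j::int. {x. x - (a + 2 * pi * of_int j) \<in> I})"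
    then obtain j :: int where "x \<in> circle" "x - (a + 2 * pi * of_int j) \<in> I" by auto
    thus "x \<in> {x \<in> circle. \<exists>y\<in>I. \<exists>k::int. x = y + a + 2 * pi * of_int k}"
      by (auto intro!: bexI[of _ "x - (a + 2 * pi * of_int j)"] exI[of _ j])
  next
    fix x assume "x \<in> {x \<in> circle. \<exists>y\<in>I. \<exists>k::int. x = y + a + 2 * pi * of_int k}"
    then obtain y and j :: int where "x \<in> circle" "y \<in> I" "x = y + a + 2 * pi * of_int j" by auto
    hence "x \<in> circle" "x - (a + 2 * pi * of_int j) \<in> I" by simp_all
    thus "x \<in> circle \<inter> (\<Union>j::int. {x. x - (a + 2 * pi * of_int j) \<in> I})" by blast
  qed
  also have "\<dots> \<in> sets borel"
  proof (intro sets.Int sets.countable_UN' countableI_type image_subsetI)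
    show "circle \<in> sets borel" unfolding circle_def by simp
    show "{x. x - (a + 2 * pi * of_int j) \<in> I} \<in> sets borel" for j :: int
    proof -
      have "{x. x - (a + 2 * pi * of_int j) \<in> I} = (\<lambda>x. x - (a + 2 * pi * of_int j)) -` I \<inter> space borel" by auto
      also have "\<dots> \<in> sets borel"
        by (rule measurable_sets[of _ borel borel]) (use mk in auto)
      finally show ?thesis .
    qed
  qed
  finally show ?thesis .
qed

lemma dilated_stopping_sets: "circle - dilated_stopping \<beta> f lam r \<in> sets circ"
proof (rule sets_circ)
  have "countable dyadic" unfolding dyadic_def
    by (intro countable_UN) (auto intro: countable_finite dyadic_level_finite)
  hence c: "countable {I \<in> stopping f lam. len I > r}"
    by (rule countable_subset[rotated]) (auto dest: stopping_dyadic)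
  have "dilate \<beta> I \<in> sets borel" if "I \<in> dyadic" for I
    unfolding dilate_def neighbour_def
    by (intro sets.countable_UN' countableI_type image_subsetI circle_translate_borel that)
  hence "dilated_stopping \<beta> f lam r \<in> sets borel"
    unfolding dilated_stopping_def by (intro sets.countable_UN' c image_subsetI) (auto dest: stopping_dyadic)
  thus "circle - dilated_stopping \<beta> f lam r \<in> sets borel" by (auto simp: circle_def)
qed auto

text \<open>Points of the complement keep chord 5/2 |I| from the centre, and x is closer than 2|I|,
  which leaves the gap |I|/2 that the tail estimate needs. Since m is a floor, it is m + 1 that is
  bounded below by n/10, also when m = 0; this turns 80 into 800.\<close>

lemma weight_bounds:
  fixes f :: "real \<Rightarrow> complex" and lam r :: real
  assumes \<beta>: "\<beta> \<ge> 9" and n: "n > 0" and m: "int m = \<lfloor>real n / 10\<rfloor>" and x: "x \<in> circle"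
  defines "w \<equiv> \<lambda>x. cmod (fejer_mean m (indicator (circle - dilated_stopping \<beta> f lam r)) x)"
  shows "w x \<le> 16"
    "I \<in> large_stopping f lam r \<Longrightarrow> rho x (ctr I) < 2 * len I \<Longrightarrow> w x \<le> 800 / (real n * len I)"
proof -
  let ?S = "circle - dilated_stopping \<beta> f lam r"
  have S: "?S \<in> sets circ" by (rule dilated_stopping_sets)
  have ind: "integrable circ (indicator ?S :: real \<Rightarrow> complex)"
    by (rule integrable_circ_bounded[of _ 1]) (use S in \<open>auto simp: indicator_def\<close>)
  show "w x \<le> 16"
    unfolding w_def using norm_fejer_mean_bounded[OF ind _ x, of 1 m] by (simp add: indicator_def)
  assume I: "I \<in> large_stopping f lam r" and near: "rho x (ctr I) < 2 * len I"
  have Id: "I \<in> dyadic" and a0: "len I > 0" using large_stopping_facts[OF I] dyadic_facts by auto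
  have "w x \<le> 80 / ((real m + 1) * len I)"
    unfolding w_def
  proof (rule fejer_mean_away[OF S a0 _ x])
    fix t assume t: "t \<in> ?S"
    have "t \<notin> dilate \<beta> I" using t I unfolding dilated_stopping_def large_stopping_def by auto
    hence "rho t (ctr I) \<ge> 5 / 2 * len I" using dilate_away[OF \<beta> Id] t by auto
    thus "len I / 2 \<le> rho x t"
      using rho_triangle[of t "ctr I" x] rho_commute[of t x] near by linarith
  qed
  also have "\<dots> \<le> 80 / (real n / 10 * len I)"
  proof -
    have "real n / 10 \<le> real m + 1" using m by linarith
    thus ?thesis using n a0 by (intro divide_left_mono mult_right_mono mult_pos_pos) auto
  qed
  also have "\<dots> = 800 / (real n * len I)" by simp
  finally show "w x \<le> 800 / (real n * len I)" .
qed

text \<open>Only the part on long intervals exploits the smallness of the weight; for the other two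
  w \<le> 16 is enough, giving 768 = 3 * 16^2. The weight is abstract so that the same one can
  accompany both f and its conjugate.\<close>

lemma weighted_L2:
  assumes f: "integrable circ f" and lam: "lam > norm_L1 f / (2 * pi)" and n: "n > 0" and b: "b \<ge> 1 / real n"
    and wc: "continuous_on UNIV w" and w: "\<And>x. x \<in> circle \<Longrightarrow> 0 \<le> w x" "\<And>x. x \<in> circle \<Longrightarrow> w x \<le> 16"
     "\<And>x I. x \<in> circle \<Longrightarrow> I \<in> large_stopping f lam b \<Longrightarrow> rho x (ctr I) < 2 * len I \<Longrightarrow> w x \<le> 800 / (real n * len I)"
  shows "(LINT x|circ. (cmod (Tpos n f x) * w x)\<^sup>2) \<le> 10 ^ 15 * (lam * norm_L1 f 
      + lam * (real n * b) * mass f (\<Union>(large_stopping f lam (1 / real n)) - \<Union>(large_stopping f lam b)))"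
proof -
  have lam0: "lam \<ge> 0" by (rule stopping_height_nonneg[OF lam])
  have n1: "1 / real n > 0" using n by simp
  have b0: "b > 0" using n1 b by linarith
  let ?U = "\<Union>(large_stopping f lam b)" and ?V = "\<Union>(large_stopping f lam (1 / real n))"
  have UV: "?U \<subseteq> ?V" using b unfolding large_stopping_def by auto
  have sets: "?U \<in> sets circ" "?V \<in> sets circ" "?V - ?U \<in> sets circ" "circle - ?V \<in> sets circ"
    using large_stopping_sets[OF b0, of f lam] large_stopping_sets[OF n1, of f lam] sets.top[of circ] by (auto simp del: sets.top)
  define g1 where "g1 t = indicator ?U t * f t" for t
  define g2 where "g2 t = indicator (?V - ?U) t * f t" for t
  define g3 where "g3 t = indicator (circle - ?V) t * f t" for t
  have int: "integrable circ g1" "integrable circ g2" "integrable circ g3"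
    unfolding g1_def g2_def g3_def by (intro integrable_indicator_mult f sets)+
  have T: "Tpos n f x = Tpos n g1 x + Tpos n g2 x + Tpos n g3 x" for x
  proof -
    have "fourier_coeff f k = fourier_coeff (\<lambda>t. g1 t + g2 t + g3 t) k" for k
      unfolding fourier_coeff_eq
      by (intro arg_cong2[where f = "(*)"] refl Bochner_Integration.integral_cong)
         (use UV in \<open>auto simp: g1_def g2_def g3_def indicator_def\<close>)
    hence "Tpos n f x = Tpos n (\<lambda>t. g1 t + g2 t + g3 t) x" unfolding Tpos_def by simp
    also have "\<dots> = Tpos n g1 x + Tpos n g2 x + Tpos n g3 x"
      using int by (simp add: Tpos_add)
    finally show ?thesis .
  qed
  have L1: "(LINT x|circ. (cmod (Tpos n g1 x) * w x)\<^sup>2) \<le> 10 ^ 14 * (lam * norm_L1 f)"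
    unfolding g1_def by (rule large_intervals_L2[OF f lam b0 n wc w])
  have nrm2: "(LINT t|circ. cmod (g2 t)) = mass f (?V - ?U)"
    unfolding g2_def mass_def norm_indicator_mult ..
  have nrm3: "(LINT t|circ. cmod (g3 t)) \<le> norm_L1 f"
    unfolding g3_def norm_indicator_mult mass_def[symmetric] by (rule mass_le_norm[OF f sets(4)])
  have L2: "(LINT x|circ. (cmod (Tpos n g2 x))\<^sup>2) \<le> 2400 * lam * (real n * b) * mass f (?V - ?U)"
    unfolding nrm2[symmetric]
    by (rule small_intervals_L2[OF f lam n b int(2)]) (auto simp: g2_def indicator_def)
  have "(LINT x|circ. (cmod (Tpos n g3 x))\<^sup>2) \<le> 2400 * lam * (real n * (1 / real n)) * (LINT t|circ. cmod (g3 t))"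
    by (rule small_intervals_L2[OF f lam n order_refl int(3)]) (auto simp: g3_def indicator_def)
  also have "\<dots> \<le> 2400 * lam * norm_L1 f"
    using n lam0 nrm3 by (auto intro!: mult_left_mono)
  finally have L3: "(LINT x|circ. (cmod (Tpos n g3 x))\<^sup>2) \<le> 2400 * lam * norm_L1 f" .
  have pw: "(cmod (Tpos n f x) * w x)\<^sup>2 \<le> 3 * (cmod (Tpos n g1 x) * w x)\<^sup>2 + 768 * (cmod (Tpos n g2 x))\<^sup>2 + 768 * (cmod (Tpos n g3 x))\<^sup>2"
    if x: "x \<in> circle" for x
  proof -
    have three: "(p + q + s)\<^sup>2 \<le> 3 * p\<^sup>2 + 3 * q\<^sup>2 + 3 * s\<^sup>2" for p q s :: real
    proof -
      have "0 \<le> (p - q)\<^sup>2 + (q - s)\<^sup>2 + (p - s)\<^sup>2" by simp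
      thus ?thesis by (simp add: power2_eq_square algebra_simps)
    qed
    have "cmod (Tpos n f x) * w x \<le> (cmod (Tpos n g1 x) + cmod (Tpos n g2 x) + cmod (Tpos n g3 x)) * w x"
      unfolding T by (intro mult_right_mono w x) (meson norm_triangle_ineq order_trans add_right_mono)
    also have "\<dots> \<le> cmod (Tpos n g1 x) * w x + 16 * cmod (Tpos n g2 x) + 16 * cmod (Tpos n g3 x)"
      using mult_left_mono[OF w(2)[OF x] norm_ge_zero[of "Tpos n g2 x"]] mult_left_mono[OF w(2)[OF x] norm_ge_zero[of "Tpos n g3 x"]]
      unfolding distrib_right by linarith
    finally have "(cmod (Tpos n f x) * w x)\<^sup>2 \<le> (cmod (Tpos n g1 x) * w x + 16 * cmod (Tpos n g2 x) + 16 * cmod (Tpos n g3 x))\<^sup>2"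
      using w(1)[OF x] by (intro power_mono) auto
    also note three
    finally show ?thesis by (simp add: power_mult_distrib)
  qed
  have i1: "integrable circ (\<lambda>x. (cmod (Tpos n g x) * w x)\<^sup>2)" "integrable circ (\<lambda>x. (cmod (Tpos n g x))\<^sup>2)" for g
    by (intro integrable_circ_cont continuous_intros wc)+
  have "(LINT x|circ. (cmod (Tpos n f x) * w x)\<^sup>2) 
    \<le> (LINT x|circ. 3 * (cmod (Tpos n g1 x) * w x)\<^sup>2 + 768 * (cmod (Tpos n g2 x))\<^sup>2 + 768 * (cmod (Tpos n g3 x))\<^sup>2)"
    using pw by (intro integral_mono Bochner_Integration.integrable_add integrable_mult_right i1) auto
  also have "\<dots> = 3 * (LINT x|circ. (cmod (Tpos n g1 x) * w x)\<^sup>2) + 768 * (LINT x|circ. (cmod (Tpos n g2 x))\<^sup>2) + 768 * (LINT x|circ. (cmod (Tpos n g3 x))\<^sup>2)"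
    by (simp only: Bochner_Integration.integral_add Bochner_Integration.integrable_add integrable_mult_right i1 integral_mult_right_zero)
  also have "\<dots> \<le> 3 * (10 ^ 14 * (lam * norm_L1 f)) + 768 * (2400 * lam * (real n * b) * mass f (?V - ?U)) + 768 * (2400 * lam * norm_L1 f)"
    by (intro add_mono mult_left_mono L1 L2 L3) auto
  also have "\<dots> \<le> 10 ^ 15 * (lam * norm_L1 f + lam * (real n * b) * mass f (?V - ?U))"
  proof -
    have "3 * (10 ^ 14 * u) + 768 * (2400 * v) + 768 * (2400 * u) \<le> 10 ^ 15 * (u + v)"
      if "0 \<le> u" "0 \<le> v" for u v :: real using that by simp
    moreover have "0 \<le> lam * norm_L1 f" "0 \<le> lam * (real n * b) * mass f (?V - ?U)"
      using lam0 b0 norm_L1_nonneg[of f] mass_nonneg[of f] by auto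
    ultimately show ?thesis by (simp only: mult.assoc)
  qed
  finally show ?thesis .
qed

lemma cnj_stopping: "large_stopping (\<lambda>t. cnj (f t)) lam r = large_stopping f lam r" "mass (\<lambda>t. cnj (f t)) A = mass f A"
  "norm_L1 (\<lambda>t. cnj (f t)) = norm_L1 f"
  unfolding large_stopping_def stopping_def average_def mass_def norm_L1_def by simp_all

lemma single_scale_bound:
  assumes \<beta>: "\<beta> \<ge> 9" and f: "integrable circ f" and lam: "lam > norm_L1 f / (2 * pi)" and n: "n > 0" 
    and b: "b \<ge> 1 / real n" and m: "int m = \<lfloor>real n / 10\<rfloor>"
  defines "w \<equiv> \<lambda>x. cmod (fejer_mean m (indicator (circle - dilated_stopping \<beta> f lam b)) x)"
  shows "(LINT x|circ. (cmod (partial_sum n f x - vp_mean n f x) * w x)\<^sup>2) \<le> 4 * 10 ^ 15 * (lam * norm_L1 f 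
      + lam * (real n * b) * mass f (\<Union>(large_stopping f lam (1 / real n)) - \<Union>(large_stopping f lam b)))"
proof -
  let ?f = "\<lambda>t. cnj (f t)" 
  let ?R = "10 ^ 15 * (lam * norm_L1 f + lam * (real n * b) * mass f (\<Union>(large_stopping f lam (1 / real n)) - \<Union>(large_stopping f lam b)))"
  have wc: "continuous_on UNIV w" unfolding w_def by (intro continuous_intros)
  have w0: "0 \<le> w x" for x unfolding w_def by simp
  have w1: "w x \<le> 16" if "x \<in> circle" for x
    unfolding w_def by (rule weight_bounds(1)[OF \<beta> n m that])
  have w2: "w x \<le> 800 / (real n * len I)" if "x \<in> circle" "I \<in> large_stopping f lam b" "rho x (ctr I) < 2 * len I" for x I
    unfolding w_def by (rule weight_bounds(2)[OF \<beta> n m that])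
  have f': "integrable circ ?f" using f by simp
  have A: "(LINT x|circ. (cmod (Tpos n f x) * w x)\<^sup>2) \<le> ?R"
    by (rule weighted_L2[OF f lam n b wc w0]) (fact w1 w2)+
  have B: "(LINT x|circ. (cmod (Tpos n ?f x) * w x)\<^sup>2) \<le> ?R"
    by (rule weighted_L2[OF f' _ n b wc w0, unfolded cnj_stopping, OF lam]) (fact w1 w2)+
  have i: "integrable circ (\<lambda>x. (cmod (Tpos n g x) * w x)\<^sup>2)" for g
    by (intro integrable_circ_cont continuous_intros wc)
  have "(LINT x|circ. (cmod (partial_sum n f x - vp_mean n f x) * w x)\<^sup>2) 
    \<le> (LINT x|circ. 2 * (cmod (Tpos n f x) * w x)\<^sup>2 + 2 * (cmod (Tpos n ?f x) * w x)\<^sup>2)"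
  proof (rule integral_mono')
    show "integrable circ (\<lambda>x. 2 * (cmod (Tpos n f x) * w x)\<^sup>2 + 2 * (cmod (Tpos n ?f x) * w x)\<^sup>2)"
      by (intro Bochner_Integration.integrable_add integrable_mult_right i)
    fix x
    have "cmod (partial_sum n f x - vp_mean n f x) * w x \<le> (cmod (Tpos n f x) + cmod (Tpos n ?f x)) * w x"
      unfolding partial_sum_minus_vp_mean[OF n] norm_minus_cancel
      using norm_triangle_ineq[of "Tpos n f x" "cnj (Tpos n ?f x)"] by (intro mult_right_mono w0) simp
    hence "(cmod (partial_sum n f x - vp_mean n f x) * w x)\<^sup>2 \<le> (cmod (Tpos n f x) * w x + cmod (Tpos n ?f x) * w x)\<^sup>2"
      using w0 by (intro power_mono) (auto simp: distrib_right)
    also have "\<dots> \<le> 2 * (cmod (Tpos n f x) * w x)\<^sup>2 + 2 * (cmod (Tpos n ?f x) * w x)\<^sup>2"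
      using sum_squares_bound[of "cmod (Tpos n f x) * w x" "cmod (Tpos n ?f x) * w x"] unfolding power2_sum by linarith
    finally show "(cmod (partial_sum n f x - vp_mean n f x) * w x)\<^sup>2 \<le> 2 * (cmod (Tpos n f x) * w x)\<^sup>2 + 2 * (cmod (Tpos n ?f x) * w x)\<^sup>2" .
  qed simp
  also have "\<dots> = 2 * (LINT x|circ. (cmod (Tpos n f x) * w x)\<^sup>2) + 2 * (LINT x|circ. (cmod (Tpos n ?f x) * w x)\<^sup>2)"
    by (simp only: Bochner_Integration.integral_add integrable_mult_right i integral_mult_right_zero)
  also have "\<dots> \<le> 2 * ?R + 2 * ?R" by (intro add_mono mult_left_mono A B) auto
  finally show ?thesis by (simp add: algebra_simps)
qed

section \<open>Orthogonality and lacunarity\<close>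

text \<open>Only the location of the frequencies is recorded, which is all that orthogonality of
  products requires. It is meant for finite A: a sum over an infinite set is 0 by
  convention.\<close>

definition spectrum_in :: "int set \<Rightarrow> (real \<Rightarrow> complex) \<Rightarrow> bool" where
  "spectrum_in A u \<longleftrightarrow> (\<exists>c. \<forall>x. u x = (\<Sum>k\<in>A. c k * cis (of_int k * x)))"

lemma spectrum_in_single: "finite A \<Longrightarrow> k \<in> A \<Longrightarrow> spectrum_in A (\<lambda>x. c * cis (of_int k * x))"
proof -
  assume A: "finite A" "k \<in> A"
  have "(\<Sum>l\<in>A. (if l = k then c else 0) * cis (of_int l * x)) = c * cis (of_int k * x)" for x
    using A by (subst sum.remove[OF A]) (auto intro!: sum.neutral)
  thus ?thesis unfolding spectrum_in_def by (intro exI[of _ "\<lambda>l. if l = k then c else 0"]) simp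
qed

lemma spectrum_in_add: "spectrum_in A u \<Longrightarrow> spectrum_in A v \<Longrightarrow> spectrum_in A (\<lambda>x. u x + v x)"
  unfolding spectrum_in_def
proof (elim exE)
  fix c d
  assume "\<forall>x. u x = (\<Sum>k\<in>A. c k * cis (of_int k * x))" "\<forall>x. v x = (\<Sum>k\<in>A. d k * cis (of_int k * x))"
  thus "\<exists>c. \<forall>x. u x + v x = (\<Sum>k\<in>A. c k * cis (of_int k * x))"
    by (intro exI[of _ "\<lambda>k. c k + d k"]) (simp add: distrib_right sum.distrib)
qed

lemma spectrum_in_zero: "spectrum_in A (\<lambda>x. 0)"
  unfolding spectrum_in_def by (rule exI[of _ "\<lambda>_. 0"]) simp

lemma spectrum_in_sum: "finite B \<Longrightarrow> (\<And>i. i \<in> B \<Longrightarrow> spectrum_in A (u i)) \<Longrightarrow> spectrum_in A (\<lambda>x. \<Sum>i\<in>B. u i x)"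
  by (induction B rule: finite_induct) (auto intro: spectrum_in_add spectrum_in_zero)

lemma spectrum_in_cmult: "spectrum_in A u \<Longrightarrow> spectrum_in A (\<lambda>x. a * u x)"
  unfolding spectrum_in_def
proof (elim exE)
  fix c assume "\<forall>x. u x = (\<Sum>k\<in>A. c k * cis (of_int k * x))"
  thus "\<exists>c. \<forall>x. a * u x = (\<Sum>k\<in>A. c k * cis (of_int k * x))"
    by (intro exI[of _ "\<lambda>k. a * c k"]) (simp add: sum_distrib_left mult.assoc)
qed

lemma spectrum_in_mult:
  assumes "spectrum_in A u" "spectrum_in B v" "finite A" "finite B" "finite C" "\<And>k l. k \<in> A \<Longrightarrow> l \<in> B \<Longrightarrow> k + l \<in> C"
  shows "spectrum_in C (\<lambda>x. u x * v x)"
proof -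
  obtain c d where cd: "\<And>x. u x = (\<Sum>k\<in>A. c k * cis (of_int k * x))" "\<And>x. v x = (\<Sum>l\<in>B. d l * cis (of_int l * x))"
    using assms(1,2) unfolding spectrum_in_def by auto
  have "u x * v x = (\<Sum>k\<in>A. \<Sum>l\<in>B. (c k * d l) * cis (of_int (k + l) * x))" for x
  proof -
    have *: "cis (of_int (k + l) * x) = cis (of_int k * x) * cis (of_int l * x)" for k l
      by (subst cis_mult) (simp add: algebra_simps)
    show ?thesis unfolding cd sum_product * by (simp only: mult_ac)
  qed
  hence "(\<lambda>x. u x * v x) = (\<lambda>x. \<Sum>k\<in>A. \<Sum>l\<in>B. (c k * d l) * cis (of_int (k + l) * x))" by (rule ext)
  moreover have "spectrum_in C \<dots>"
    using assms by (intro spectrum_in_sum spectrum_in_single) auto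
  ultimately show ?thesis by simp
qed

lemma spectrum_in_orthogonal:
  assumes "spectrum_in A u" "spectrum_in B v" "finite A" "finite B" "A \<inter> B = {}"
  shows "(LINT x|circ. u x * cnj (v x)) = 0"
proof -
  obtain c d where cd: "\<And>x. u x = (\<Sum>k\<in>A. c k * cis (of_int k * x))" "\<And>x. v x = (\<Sum>l\<in>B. d l * cis (of_int l * x))"
    using assms(1,2) unfolding spectrum_in_def by auto
  have "(LINT x|circ. u x * cnj (v x)) = 2 * pi * (\<Sum>p\<in>A. \<Sum>q\<in>B. if p = q then c p * cnj (d q) else 0)"
    unfolding cd by (rule integral_trig_prod[OF assms(3,4), of c "\<lambda>k. k" d "\<lambda>k. k"])
  also have "(\<Sum>p\<in>A. \<Sum>q\<in>B. if p = q then c p * cnj (d q) else 0) = (\<Sum>p\<in>A. \<Sum>q\<in>B. 0)"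
    using assms(5) by (intro sum.cong refl) auto
  finally show ?thesis by simp
qed

lemma spectrum_in_continuous: "spectrum_in A u \<Longrightarrow> continuous_on UNIV u"
  unfolding spectrum_in_def by (elim exE) (simp add: fun_eq_iff[symmetric], intro continuous_intros)

lemma pythagoras_circ:
  assumes fin: "finite J" and cont: "\<And>j. j \<in> J \<Longrightarrow> continuous_on UNIV (u j)"
    and orth: "\<And>i j. i \<in> J \<Longrightarrow> j \<in> J \<Longrightarrow> i \<noteq> j \<Longrightarrow> (LINT x|circ. u i x * cnj (u j x)) = 0"
  shows "(LINT x|circ. (cmod (\<Sum>j\<in>J. u j x))\<^sup>2) = (\<Sum>j\<in>J. LINT x|circ. (cmod (u j x))\<^sup>2)"
proof -
  have sq: "complex_of_real (LINT x|circ. (cmod (g x))\<^sup>2) = (LINT x|circ. g x * cnj (g x))" for g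
  proof -
    have "complex_of_real (LINT x|circ. (cmod (g x))\<^sup>2) = (LINT x|circ. of_real ((cmod (g x))\<^sup>2))"
      by (rule integral_complex_of_real[symmetric])
    also have "\<dots> = (LINT x|circ. g x * cnj (g x))" by (simp only: complex_norm_square)
    finally show ?thesis .
  qed
  have int: "integrable circ (\<lambda>x. u i x * cnj (u j x))" if "i \<in> J" "j \<in> J" for i j
    using that by (intro integrable_circ_cont continuous_intros cont)
  have "complex_of_real (LINT x|circ. (cmod (\<Sum>j\<in>J. u j x))\<^sup>2) = (LINT x|circ. (\<Sum>i\<in>J. \<Sum>j\<in>J. u i x * cnj (u j x)))"
    unfolding sq by (simp add: sum_product)
  also have "\<dots> = (\<Sum>i\<in>J. \<Sum>j\<in>J. (LINT x|circ. u i x * cnj (u j x)))"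
    using int by (simp add: Bochner_Integration.integral_sum)
  also have "\<dots> = (\<Sum>i\<in>J. \<Sum>j\<in>J. if i = j then (LINT x|circ. u i x * cnj (u i x)) else 0)"
    using orth by (intro sum.cong refl) auto
  also have "\<dots> = (\<Sum>i\<in>J. complex_of_real (LINT x|circ. (cmod (u i x))\<^sup>2))"
    using fin unfolding sq by simp
  finally show ?thesis by (simp only: of_real_sum[symmetric] of_real_eq_iff)
qed

definition band :: "nat \<Rightarrow> int set" where
  "band n = {k. 9 * int n < 10 * \<bar>k\<bar> \<and> 10 * \<bar>k\<bar> < 21 * int n}"

lemma finite_band: "finite (band n)"
  by (rule finite_subset[of _ "{- (3 * int n)..3 * int n}"]) (auto simp: band_def)

lemma spectrum_in_product:
  assumes n: "n > 0" and m: "int m = \<lfloor>real n / 10\<rfloor>"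
  shows "spectrum_in (band n) (\<lambda>x. (partial_sum n f x - vp_mean n f x) * fejer_mean m g x)"
proof -
  let ?A = "{k. int n < \<bar>k\<bar> \<and> \<bar>k\<bar> < 2 * int n}" and ?B = "{- int m..int m}"
  have fA: "finite ?A" by (rule finite_subset[of _ "{- (2 * int n)..2 * int n}"]) auto
  have m10: "10 * int m \<le> int n" using m by linarith
  have T: "spectrum_in ?A (Tpos n h)" for h
    unfolding Tpos_def by (intro spectrum_in_sum spectrum_in_single fA) auto
  have T': "spectrum_in ?A (\<lambda>x. cnj (Tpos n h x))" for h
  proof -
    have "(\<lambda>x. cnj (Tpos n h x)) = (\<lambda>x. \<Sum>k\<in>{n<..<2 * n}. cnj (of_real ((2 * real n - real k) / real n) * fourier_coeff h (int k)) * cis (of_int (- int k) * x))"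
      unfolding Tpos_def by (simp add: cis_cnj)
    moreover have "spectrum_in ?A \<dots>" by (intro spectrum_in_sum spectrum_in_single fA) auto
    ultimately show ?thesis by (simp only:)
  qed
  have "spectrum_in ?A (\<lambda>x. (-1) * (Tpos n f x + cnj (Tpos n (\<lambda>t. cnj (f t)) x)))"
    by (intro spectrum_in_cmult spectrum_in_add T T')
  hence 1: "spectrum_in ?A (\<lambda>x. partial_sum n f x - vp_mean n f x)"
    unfolding partial_sum_minus_vp_mean[OF n] by simp
  have 2: "spectrum_in ?B (fejer_mean m g)"
    unfolding fejer_mean_def partial_sum_eq by (intro spectrum_in_cmult spectrum_in_sum spectrum_in_single) auto
  show ?thesis
  proof (rule spectrum_in_mult[OF 1 2 fA _ finite_band])
    fix k l assume kl: "k \<in> ?A" "l \<in> ?B"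
    have "\<bar>k\<bar> - \<bar>l\<bar> \<le> \<bar>k + l\<bar>" "\<bar>k + l\<bar> \<le> \<bar>k\<bar> + \<bar>l\<bar>" "\<bar>l\<bar> \<le> int m" "int n < \<bar>k\<bar>" "\<bar>k\<bar> < 2 * int n"
      using kl by auto
    thus "k + l \<in> band n" using m10 unfolding band_def mem_Collect_eq by (intro conjI) linarith+
  qed auto
qed

section \<open>Counting the scales at which a stopping interval is of middle length\<close>

lemma lacunary_power:
  assumes "\<And>j. j \<ge> 1 \<Longrightarrow> real (n (j + 1)) \<ge> q * real (n j)" "q > 5 / 2" "i \<ge> (1::nat)"
  shows "real (n (i + d)) \<ge> (5 / 2) ^ d * real (n i)"
proof (induction d)
  case (Suc d)
  have "(5 / 2) ^ Suc d * real (n i) \<le> 5 / 2 * real (n (i + d))" using Suc by (simp add: mult.commute)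
  also have "\<dots> \<le> q * real (n (i + d))" using assms(2) by (intro mult_right_mono) auto
  also have "\<dots> \<le> real (n (i + d + 1))" using assms(1)[of "i + d"] assms(3) by simp
  finally show ?case by simp
qed simp

lemma ln2_ge_half: "ln (2::real) \<ge> 1 / 2"
  using ln2_ge_two_thirds by simp

text \<open>Let i and k be the first and last index whose middle set contains x. One stopping
  interval I is responsible for both, with 1/n_i < |I| \<le> b_k. Hence (5/2)^(k-i) \<le> n_k/n_i <
  n_k b_k, which is polynomial in N up to logarithms, so k - i = O(log N). Only the extent of the
  index set matters; it may have gaps.\<close>

lemma lacunary_count:
  assumes n: "\<And>j. j \<ge> 1 \<Longrightarrow> n j > 0" "\<And>j. j \<ge> 1 \<Longrightarrow> real (n (j + 1)) \<ge> q * real (n j)" "q > 5 / 2"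
    and N: "N \<ge> 1" and b: "\<And>j. j \<in> {1..N} \<Longrightarrow> real (n j) * b j \<le> 20 * (real N + 1) * (ln (real N + 1))\<^sup>2"
  shows "(\<Sum>j=1..N. indicator (\<Union>(large_stopping f lam (1 / real (n j))) - \<Union>(large_stopping f lam (b j))) x) \<le> 80 * ln (real N + 1)"
proof -
  let ?D = "\<lambda>j. \<Union>(large_stopping f lam (1 / real (n j))) - \<Union>(large_stopping f lam (b j))" and ?l = "ln (real N + 1)"
  define J where "J = {j\<in>{1..N}. x \<in> ?D j}"
  have l: "?l \<ge> 1 / 2"
    using ln2_ge_half N ln_le_cancel_iff[of 2 "real N + 1"] by linarith
  have sum: "(\<Sum>j=1..N. indicator (?D j) x) = real (card J)"
  proof -
    have "(\<Sum>j=1..N. indicator (?D j) x) = (\<Sum>j\<in>{1..N}. if x \<in> ?D j then 1 else (0::real))"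
      by (intro sum.cong refl) (simp add: indicator_def)
    also have "\<dots> = real (card J)" unfolding J_def by (subst sum.inter_filter[symmetric]) auto
    finally show ?thesis .
  qed
  show ?thesis
  proof (cases "J = {}")
    case True
    thus ?thesis using sum l by simp
  next
    case False
    have finJ: "finite J" unfolding J_def by simp
    define i where "i = Min J" define k where "k = Max J"
    have ik: "i \<in> J" "k \<in> J" "i \<le> k" unfolding i_def k_def using finJ False by auto
    have ikN: "1 \<le> i" "i \<in> {1..N}" "k \<in> {1..N}" using ik unfolding J_def by auto
    obtain I where I: "I \<in> large_stopping f lam (1 / real (n i))" "x \<in> I" using ik unfolding J_def by auto
    obtain I' where I': "I' \<in> large_stopping f lam (1 / real (n k))" "x \<in> I'" using ik unfolding J_def by auto
    \<comment> \<open>Stopping intervals are disjoint whatever the threshold, so x determines its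
      interval independently of the index.\<close>
    have "I = I'" using I I' large_stopping_facts(1) stopping_disjoint[of f lam] unfolding disjoint_def by blast
    have "x \<notin> \<Union>(large_stopping f lam (b k))" using ik unfolding J_def by auto
    hence Ib: "len I \<le> b k" using I large_stopping_facts(1)[OF I(1)] unfolding large_stopping_def by fastforce
    have "1 / real (n i) < len I" using large_stopping_facts(3)[OF I(1)] .
    hence low: "1 < real (n i) * len I" using n(1)[of i] ikN by (simp add: field_simps)
    have "(5 / 2) ^ (k - i) * 1 \<le> (5 / 2) ^ (k - i) * (real (n i) * len I)"
      using low by (intro mult_left_mono) auto
    also have "\<dots> = ((5 / 2) ^ (k - i) * real (n i)) * len I" by simp
    also have "\<dots> \<le> real (n k) * len I"
      using lacunary_power[where n = n and q = q and i = i and d = "k - i", OF n(2,3) ikN(1)] ik dyadic_facts(4)[OF large_stopping_facts(2)[OF I(1)]]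
      by (intro mult_right_mono) auto
    also have "\<dots> \<le> real (n k) * b k" using Ib by (intro mult_left_mono) auto
    also have "\<dots> \<le> 20 * (real N + 1) * ?l\<^sup>2" by (rule b[OF ikN(3)])
    finally have pow: "(5 / 2) ^ (k - i) \<le> 20 * (real N + 1) * ?l\<^sup>2" by simp
    have "2 ^ (k - i) \<le> (5 / 2 :: real) ^ (k - i)" by (intro power_mono) auto
    hence "ln (2 ^ (k - i)) \<le> ln (20 * (real N + 1) * ?l\<^sup>2)"
      using pow l by (intro ln_mono) auto
    also have "\<dots> = ln 20 + ?l + 2 * ln ?l"
    proof -
      have "ln (20 * u * v\<^sup>2) = ln 20 + ln u + 2 * ln v" if "u > 0" "v > 0" for u v :: real
        using that by (simp add: ln_mult ln_realpow)
      from this[of "real N + 1" ?l] show ?thesis using l by (simp only:)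
    qed
    \<comment> \<open>Crude use of ln z \<le> z - 1; the additive constants are absorbed at the end
      because the logarithm is at least 1/2.\<close>
    also have "\<dots> \<le> 19 + ?l + 2 * ?l"
    proof -
      have "ln 20 \<le> (19::real)" using ln_le_minus_one[of 20] by simp
      moreover have "ln ?l \<le> ?l" using ln_le_minus_one[of ?l] l by linarith
      ultimately show ?thesis by linarith
    qed
    finally have "real (k - i) * ln 2 \<le> 19 + 3 * ?l" by (simp add: ln_realpow)
    moreover have "real (k - i) * (2 / 3) \<le> real (k - i) * ln 2"
      using ln2_ge_two_thirds by (intro mult_left_mono) auto
    ultimately have ki: "real (k - i) \<le> 3 / 2 * (19 + 3 * ?l)" by simp
    have "J \<subseteq> {i..k}" unfolding i_def k_def using finJ by auto
    hence "card J \<le> card {i..k}" by (intro card_mono) auto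
    hence "real (card J) \<le> real (k - i) + 1" using ik by simp
    also have "\<dots> \<le> 3 / 2 * (19 + 3 * ?l) + 1" using ki by simp
    also have "\<dots> \<le> 80 * ?l"
    proof -
      have "3 / 2 * (19 + 3 * z) + 1 \<le> 80 * z" if "1 / 2 \<le> z" for z :: real
        using that by (simp add: algebra_simps)
      thus ?thesis using l by blast
    qed
    finally show ?thesis unfolding sum .
  qed
qed

lemma norm_L2_square: "(norm_L2 g)\<^sup>2 = (LINT x|circ. (norm (g x))\<^sup>2)"
  for g :: "real \<Rightarrow> 'a::real_normed_vector"
  unfolding norm_L2_def set_integral_circ
  by (rule real_sqrt_pow2) (rule Bochner_Integration.integral_nonneg, simp)

text \<open>Bounded overlap: the sum of the masses integrates |f| against the number of sets that
  contain the point.\<close>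

lemma sum_mass_le:
  assumes f: "integrable circ f" and D: "\<And>j. j \<in> J \<Longrightarrow> D j \<in> sets circ" and fin: "finite J"
    and K: "\<And>x. (\<Sum>j\<in>J. indicator (D j) x) \<le> (K::real)"
  shows "(\<Sum>j\<in>J. mass f (D j)) \<le> K * norm_L1 f"
proof -
  have "(\<Sum>j\<in>J. mass f (D j)) = (LINT x|circ. (\<Sum>j\<in>J. indicator (D j) x * cmod (f x)))"
    unfolding mass_def using D by (intro Bochner_Integration.integral_sum[symmetric] mass_integrable f) auto
  also have "\<dots> \<le> (LINT x|circ. K * cmod (f x))"
  proof (rule integral_mono)
    show "integrable circ (\<lambda>x. \<Sum>j\<in>J. indicator (D j) x * cmod (f x))"
      by (intro Bochner_Integration.integrable_sum mass_integrable f D)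
    show "integrable circ (\<lambda>x. K * cmod (f x))" using f by simp
    show "(\<Sum>j\<in>J. indicator (D j) x * cmod (f x)) \<le> K * cmod (f x)" for x
      unfolding sum_distrib_right[symmetric] by (intro mult_right_mono K) simp
  qed
  finally show ?thesis unfolding norm_L1_eq by simp
qed

theorem lemma6p1:
  fixes \<beta> :: nat
  assumes "odd \<beta>" and "\<beta> > 7"
  shows "\<exists>C::real. \<forall>(N::nat) (f::real \<Rightarrow> complex) (lam::real) (q::real) (n::nat \<Rightarrow> nat)
           (b::nat \<Rightarrow> real) (m::nat \<Rightarrow> nat).
      N \<ge> 1 \<longrightarrow>
      integrable_circle f \<longrightarrow>
      lam > norm_L1 f / (2 * pi) \<longrightarrow>
      q > 5 / 2 \<longrightarrow>
      (\<forall>j\<ge>1. n j > 0) \<longrightarrow>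
      (\<forall>j\<ge>1. real (n (j + 1)) \<ge> q * real (n j)) \<longrightarrow>
      (\<forall>j\<in>{1..N}. real (n j) * b j = 20 * (real j + 1) * (ln (real j + 1))\<^sup>2) \<longrightarrow>
      (\<forall>j\<in>{1..N}. int (m j) = \<lfloor>real (n j) / 10\<rfloor>) \<longrightarrow>
      (norm_L2 (\<lambda>x. \<Sum>j=1..N. (partial_sum (n j) f x - vp_mean (n j) f x) *
           fejer_mean (m j) (indicator (circle - dilated_stopping \<beta> f lam (b j))) x))\<^sup>2
        = (\<Sum>j=1..N. (norm_L2 (\<lambda>x. cmod (partial_sum (n j) f x - vp_mean (n j) f x) *
           cmod (fejer_mean (m j) (indicator (circle - dilated_stopping \<beta> f lam (b j))) x)))\<^sup>2)
      \<and> (\<Sum>j=1..N. (norm_L2 (\<lambda>x. cmod (partial_sum (n j) f x - vp_mean (n j) f x) *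
           cmod (fejer_mean (m j) (indicator (circle - dilated_stopping \<beta> f lam (b j))) x)))\<^sup>2)
        \<le> C * real N * (ln (real N + 1)) ^ 5 * norm_L1 f * lam"
proof (intro exI[of _ "10 ^ 20"] allI impI)
  fix N :: nat and f :: "real \<Rightarrow> complex" and lam q :: real and n :: "nat \<Rightarrow> nat" and b :: "nat \<Rightarrow> real" and m :: "nat \<Rightarrow> nat"
  assume N: "N \<ge> 1" and f': "integrable_circle f" and lam: "lam > norm_L1 f / (2 * pi)" and q: "q > 5 / 2"
    and n0: "\<forall>j\<ge>1. n j > 0" and nq: "\<forall>j\<ge>1. real (n (j + 1)) \<ge> q * real (n j)"
    and b: "\<forall>j\<in>{1..N}. real (n j) * b j = 20 * (real j + 1) * (ln (real j + 1))\<^sup>2"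
    and m: "\<forall>j\<in>{1..N}. int (m j) = \<lfloor>real (n j) / 10\<rfloor>"
  have f: "integrable circ f" using f' by (simp add: set_integrable_circ)
  \<comment> \<open>Oddness excludes 8.\<close>
  have \<beta>: "\<beta> \<ge> 9" using assms by (cases "\<beta> = 8") auto
  have lam0: "lam \<ge> 0" by (rule stopping_height_nonneg[OF lam])
  have nrm0: "norm_L1 f \<ge> 0" by (rule norm_L1_nonneg)
  let ?w = "\<lambda>j. fejer_mean (m j) (indicator (circle - dilated_stopping \<beta> f lam (b j)))"
  let ?d = "\<lambda>j x. partial_sum (n j) f x - vp_mean (n j) f x"
  let ?l = "ln (real N + 1)"
  let ?D = "\<lambda>j. \<Union>(large_stopping f lam (1 / real (n j))) - \<Union>(large_stopping f lam (b j))"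
  have l: "?l \<ge> 1 / 2"
    using ln2_ge_half N ln_le_cancel_iff[of 2 "real N + 1"] by linarith
  have npos: "n j > 0" if "j \<ge> 1" for j using n0 that by auto
  have lj: "1 / 2 \<le> ln (real j + 1)" "ln (real j + 1) \<le> ?l" if "j \<in> {1..N}" for j
    using that ln2_ge_half ln_le_cancel_iff[of 2 "real j + 1"] by (auto intro: order_trans)
  \<comment> \<open>For j \<ge> 1 the defining product is at least 20 * 2 * (1/2)^2 = 10, so the
    middle range starts above the scale 1/n_j.\<close>
  have blow: "b j \<ge> 1 / real (n j)" if "j \<in> {1..N}" for j
  proof -
    have "20 * 2 * (1 / 2)\<^sup>2 \<le> 20 * (real j + 1) * (ln (real j + 1))\<^sup>2"
      using lj[OF that] that by (intro mult_mono power_mono) auto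
    hence "real (n j) * b j \<ge> 1" using b that by (simp add: power2_eq_square)
    thus ?thesis using npos[of j] that by (simp add: field_simps)
  qed
  have bup: "real (n j) * b j \<le> 20 * (real N + 1) * ?l\<^sup>2" if "j \<in> {1..N}" for j
  proof -
    have "real (n j) * b j = 20 * (real j + 1) * (ln (real j + 1))\<^sup>2" using b that by auto
    also have "\<dots> \<le> 20 * (real N + 1) * ?l\<^sup>2"
      using lj[OF that] that by (intro mult_mono power_mono) auto
    finally show ?thesis .
  qed
  have sp: "spectrum_in (band (n j)) (\<lambda>x. ?d j x * ?w j x)" if "j \<in> {1..N}" for j
    using that npos m by (intro spectrum_in_product) auto
  have disj: "band (n i) \<inter> band (n j) = {}" if "1 \<le> i" "i < j" for i j
  proof -
    have "(5 / 2) ^ 1 * real (n i) \<le> (5 / 2) ^ (j - i) * real (n i)"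
      using that by (intro mult_right_mono power_increasing) auto
    also have "\<dots> \<le> real (n (i + (j - i)))"
      by (rule lacunary_power[where q = q]) (use nq q that in auto)
    \<comment> \<open>The edges of a band have ratio 21/9 = 7/3 < 5/2: from 5 n_i \<le> 2 n_j
      follows 21 n_i \<le> 8.4 n_j, so the upper edge of band i does not reach the lower edge 9 n_j
      of band j.\<close>
    finally have "5 * n i \<le> 2 * n j" using that by simp
    thus ?thesis unfolding band_def by auto
  qed
  have "(LINT x|circ. (cmod (\<Sum>j=1..N. ?d j x * ?w j x))\<^sup>2) = (\<Sum>j=1..N. LINT x|circ. (cmod (?d j x * ?w j x))\<^sup>2)"
  proof (rule pythagoras_circ)
    show "continuous_on UNIV (\<lambda>x. ?d j x * ?w j x)" if "j \<in> {1..N}" for j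
      by (rule spectrum_in_continuous[OF sp[OF that]])
    show "(LINT x|circ. ?d i x * ?w i x * cnj (?d j x * ?w j x)) = 0" if "i \<in> {1..N}" "j \<in> {1..N}" "i \<noteq> j" for i j
    proof (rule spectrum_in_orthogonal[OF sp[OF that(1)] sp[OF that(2)] finite_band finite_band])
      show "band (n i) \<inter> band (n j) = {}"
        using disj[of i j] disj[of j i] that by (cases "i < j") auto
    qed
  qed simp
  hence eq: "(norm_L2 (\<lambda>x. \<Sum>j=1..N. ?d j x * ?w j x))\<^sup>2 = (\<Sum>j=1..N. (norm_L2 (\<lambda>x. cmod (?d j x) * cmod (?w j x)))\<^sup>2)"
    unfolding norm_L2_square by (simp add: norm_mult)
  have each: "(norm_L2 (\<lambda>x. cmod (?d j x) * cmod (?w j x)))\<^sup>2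
     \<le> 4 * 10 ^ 15 * (lam * norm_L1 f + lam * (20 * (real N + 1) * ?l\<^sup>2) * mass f (?D j))" if j: "j \<in> {1..N}" for j
  proof -
    have "(norm_L2 (\<lambda>x. cmod (?d j x) * cmod (?w j x)))\<^sup>2 = (LINT x|circ. (cmod (?d j x) * cmod (?w j x))\<^sup>2)"
      unfolding norm_L2_square by simp
    also have "\<dots> \<le> 4 * 10 ^ 15 * (lam * norm_L1 f + lam * (real (n j) * b j) * mass f (?D j))"
      using j m npos by (intro single_scale_bound \<beta> f lam blow) auto
    also have "\<dots> \<le> 4 * 10 ^ 15 * (lam * norm_L1 f + lam * (20 * (real N + 1) * ?l\<^sup>2) * mass f (?D j))"
      using lam0 by (intro mult_left_mono add_left_mono mult_right_mono bup j mass_nonneg) auto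
    finally show ?thesis .
  qed
  have count: "(\<Sum>j=1..N. mass f (?D j)) \<le> 80 * ?l * norm_L1 f"
  proof (rule sum_mass_le[OF f])
    show "?D j \<in> sets circ" if "j \<in> {1..N}" for j
    proof -
      have "1 / real (n j) > 0" using npos[of j] that by auto
      moreover from this have "b j > 0" using blow[OF that] by linarith
      ultimately show ?thesis by (intro sets.Diff large_stopping_sets)
    qed
    show "(\<Sum>j=1..N. indicator (?D j) x) \<le> 80 * ?l" for x
      by (rule lacunary_count[where q = q]) (use npos nq q N bup in auto)
  qed simp
  have "(\<Sum>j=1..N. (norm_L2 (\<lambda>x. cmod (?d j x) * cmod (?w j x)))\<^sup>2)
     \<le> (\<Sum>j=1..N. 4 * 10 ^ 15 * (lam * norm_L1 f + lam * (20 * (real N + 1) * ?l\<^sup>2) * mass f (?D j)))"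
    by (intro sum_mono each)
  also have "\<dots> = 4 * 10 ^ 15 * (real N * (lam * norm_L1 f) + lam * (20 * (real N + 1) * ?l\<^sup>2) * (\<Sum>j=1..N. mass f (?D j)))"
    unfolding sum_distrib_left[symmetric] sum.distrib by simp
  also have "\<dots> \<le> 4 * 10 ^ 15 * (real N * (lam * norm_L1 f) + lam * (20 * (2 * real N) * ?l\<^sup>2) * (80 * ?l * norm_L1 f))"
    using lam0 N l by (intro mult_left_mono add_left_mono mult_mono count sum_nonneg mass_nonneg) auto
  also have "\<dots> = 4 * 10 ^ 15 * (real N * (lam * norm_L1 f)) * (1 + 3200 * ?l ^ 3)"
    by (simp add: power2_eq_square power3_eq_cube algebra_simps)
  \<comment> \<open>As the logarithm is at least 1/2, its fifth power absorbs 1 at the price 32 and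
    its third power at the price 4; 12832 = 32 + 4 * 3200.\<close>
  also have "\<dots> \<le> 4 * 10 ^ 15 * (real N * (lam * norm_L1 f)) * (12832 * ?l ^ 5)"
  proof (rule mult_left_mono)
    have "(1 / 2) ^ 5 \<le> ?l ^ 5" using l by (intro power_mono) auto
    hence "1 \<le> 32 * ?l ^ 5" by (simp add: power_divide)
    moreover have "?l ^ 3 \<le> 4 * ?l ^ 5"
    proof -
      have "(1 / 2)\<^sup>2 \<le> ?l\<^sup>2" using l by (intro power_mono) auto
      hence "?l ^ 3 * 1 \<le> ?l ^ 3 * (4 * ?l\<^sup>2)" using l by (intro mult_left_mono) (auto simp: power_divide)
      moreover have "?l ^ 5 = ?l ^ 3 * ?l\<^sup>2" by (simp flip: power_add)
      ultimately show ?thesis by (simp only: mult_1_right mult.left_commute)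
    qed
    ultimately show "1 + 3200 * ?l ^ 3 \<le> 12832 * ?l ^ 5" by linarith
  qed (use lam0 nrm0 in auto)
  also have "\<dots> = 51328000000000000000 * (real N * ?l ^ 5 * norm_L1 f * lam)"
    by simp
  also have "\<dots> \<le> 10 ^ 20 * (real N * ?l ^ 5 * norm_L1 f * lam)"
    using lam0 nrm0 l by (intro mult_right_mono) auto
  finally have "(\<Sum>j=1..N. (norm_L2 (\<lambda>x. cmod (?d j x) * cmod (?w j x)))\<^sup>2) \<le> 10 ^ 20 * real N * ?l ^ 5 * norm_L1 f * lam"
    by (simp only: mult.assoc)
  with eq show "(norm_L2 (\<lambda>x. \<Sum>j=1..N. ?d j x * ?w j x))\<^sup>2
        = (\<Sum>j=1..N. (norm_L2 (\<lambda>x. cmod (?d j x) * cmod (?w j x)))\<^sup>2)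
      \<and> (\<Sum>j=1..N. (norm_L2 (\<lambda>x. cmod (?d j x) * cmod (?w j x)))\<^sup>2)
        \<le> 10 ^ 20 * real N * ?l ^ 5 * norm_L1 f * lam" by blast
qed

end
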